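(* Let $\mathcal{N}$ be a non-degenerate nilpotent Lie group of step two and let $m\ge0$ be an integer. Then there is a constant $C$ such that $$\mathscr{P}_m=p.v.\,P_m+C\delta_{\mathbf{0}}$$ as distributions on $\mathcal{N}$, where $\delta_{\mathbf{0}}$ is the delta distribution at $\mathbf{0}$ and, for $\phi\in\mathcal{S}(\mathcal{N})$, $$\langle p.v.\,P_m,\phi\rangle=\lim_{\varepsilon\to0^+}\int_{\mathbb{R}^{2n+r}\setminus B(\mathbf{0},\varepsilon)}\phi(\mathbf{y},\mathbf{t})P_m(\mathbf{y},\mathbf{t})\,d\mathbf{y}\,d\mathbf{t},\qquad B(\mathbf{0},\varepsilon)=\{(\mathbf{y},\mathbf{t}):(|\mathbf{y}|^4+|\mathbf{t}|^2)^{1/4}\le\varepsilon\}.$$ Moreover $P_m$ has mean value zero: $\int_{\partial B(\mathbf{0},1)}P_m\,d\sigma=0$.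
   Context: Let $n,r\ge1$ and let $B=(B^1,\dots,B^r):\mathbb{R}^{2n}\times\mathbb{R}^{2n}\to\mathbb{R}^r$ be a skew-symmetric bilinear map, $B^\beta(\mathbf{x},\mathbf{y})=\sum_{k,l}B^\beta_{kl}x_ky_l$. The nilpotent Lie group of step two $\mathcal{N}$ is $\mathbb{R}^{2n}\times\mathbb{R}^r$ with product $(\mathbf{x},\mathbf{t})\cdot(\mathbf{y},\mathbf{s})=(\mathbf{x}+\mathbf{y},\mathbf{t}+\mathbf{s}+2B(\mathbf{x},\mathbf{y}))$. For $\tau\in\mathbb{R}^r$ let $B^\tau=\sum_\beta\tau_\beta B^\beta$ (a skew-symmetric $2n\times2n$ matrix). $\mathcal{N}$ is non-degenerate if $B^\tau$ is invertible for every $\tau\ne0$. $\mathcal{S}(\mathcal{N})$ is the Schwartz space on $\mathbb{R}^{2n+r}$; put $Q=2n+2r$. For $\tau\ne0$ let $\pm i\mu_1(\tau),\dots,\pm i\mu_n(\tau)$, $\mu_1(\tau)\ge\dots\ge\mu_n(\tau)>0$, be the eigenvalues of $B^\tau$, and choose an orthonormal basis $v_1^\tau,\dots,v_{2n}^\tau$ of $\mathbb{R}^{2n}$ (depending only on $\tau/|\tau|$) such that $O(\tau)=(v_1^\tau,\dots,v_{2n}^\tau)$ satisfies $O(\tau)^tB^\tau O(\tau)=$ block diagonal matrix with blocks $\begin{pmatrix}0&-\mu_j(\tau)\\ \mu_j(\tau)&0\end{pmatrix}$. Write $\mathbf{y}=\sum_k y_k^\tau v_k^\tau$ and $\mathbf{y}_j^\tau=(y_{2j-1}^\tau,y_{2j}^\tau)$.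 With $L_k^{(p)}$ the generalized Laguerre polynomials, for $\mathbf{k}\in\mathbb{Z}_{\ge0}^n$ put $$\widetilde{\mathscr L}_{\mathbf{k}}^{(\mathbf{0})}(\mathbf{y},\tau)=\prod_{j=1}^n\frac{2\mu_j(\tau)}{\pi}L_{k_j}^{(0)}\big(2\mu_j(\tau)|\mathbf{y}_j^\tau|^2\big)e^{-\mu_j(\tau)|\mathbf{y}_j^\tau|^2},\qquad Q_m(\mathbf{y},\tau)=\sum_{|\mathbf{k}|=m}\widetilde{\mathscr L}_{\mathbf{k}}^{(\mathbf{0})}(\mathbf{y},\tau).$$ For $\mathbf{y}\ne\mathbf{0}$, $P_m(\mathbf{y},\mathbf{t}):=(2\pi)^{-r}\int_{\mathbb{R}^r}e^{i\mathbf{t}\cdot\tau}Q_m(\mathbf{y},\tau)\,d\tau$; this function extends (uniquely) to a continuous, locally Lipschitz function on $\mathcal{N}\setminus\{\mathbf{0}\}$, still denoted $P_m$. The distribution $\mathscr{P}_m$ is defined by $\langle\mathscr{P}_m,\phi\rangle=(2\pi)^{-r}\int_{\mathbb{R}^{2n+r}}Q_m(\mathbf{y},\tau)\widetilde\phi(\mathbf{y},-\tau)\,d\mathbf{y}\,d\tau$ for $\phi\in\mathcal{S}(\mathcal{N})$, where $\widetilde\phi(\mathbf{y},\tau)=\int_{\mathbb{R}^r}e^{-i\tau\cdot\mathbf{t}}\phi(\mathbf{y},\mathbf{t})\,d\mathbf{t}$. The measure $\sigma$ on $\partial B(\mathbf{0},1)=\{(\mathbf y,\mathbf t):|\mathbf{y}|^4+|\mathbf{t}|^2=1\}$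 is the one from homogeneous polar coordinates: $\int_{\mathcal{N}}f\,d\mathbf{y}\,d\mathbf{t}=\int_0^\infty\int_{\partial B(\mathbf{0},1)}f(\rho\mathbf{y},\rho^2\mathbf{t})\,\rho^{Q-1}\,d\sigma(\mathbf{y},\mathbf{t})\,d\rho$ for all $f\in L^1(\mathcal N)$. *)

theory Defs
  imports "HOL-Analysis.Analysis"
begin

text \<open>
  The group has underlying space \<open>(real ^ 'd) \<times> (real ^ 'r)\<close> with \<open>CARD('d) = 2 n\<close> and product
  \<open>(x, t) \<cdot> (y, s) = (x + y, t + s + 2 B(x, y))\<close>. It is determined by the skew-symmetric
  bilinear map \<open>B\<close>, through which alone it enters below.
\<close>

definition skew_bilinear :: "(real ^ 'd \<Rightarrow> real ^ 'd \<Rightarrow> real ^ 'r) \<Rightarrow> bool" where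
  "skew_bilinear B \<longleftrightarrow> bilinear B \<and> (\<forall>x y. B x y = - B y x)"

definition Bmat :: "(real ^ 'd \<Rightarrow> real ^ 'd \<Rightarrow> real ^ 'r) \<Rightarrow> real ^ 'r \<Rightarrow> real ^ 'd ^ 'd" where
  "Bmat B \<tau> = (\<chi> k l. \<Sum>\<beta>\<in>UNIV. \<tau> $ \<beta> * B (axis k 1) (axis l 1) $ \<beta>)"

definition nondegenerate :: "(real ^ 'd \<Rightarrow> real ^ 'd \<Rightarrow> real ^ 'r) \<Rightarrow> bool" where
  "nondegenerate B \<longleftrightarrow> (\<forall>\<tau>. \<tau> \<noteq> 0 \<longrightarrow> invertible (Bmat B \<tau>))"


subsection \<open>Eigenvalues and adapted orthonormal bases\<close>

text \<open>
  The eigenvalues are listed with multiplicity, i.e. as the roots of the characteristic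
  polynomial. Indices \<open>j \<in> {1..n}\<close> and \<open>k \<in> {1..2 n}\<close> are natural numbers; values of \<open>\<mu>\<close> and \<open>v\<close>
  outside these ranges, or at \<open>\<tau> = 0\<close>, are unconstrained.
\<close>

definition eigenvalue_family ::
  "(real ^ 'd \<Rightarrow> real ^ 'd \<Rightarrow> real ^ 'r) \<Rightarrow> nat \<Rightarrow> (real ^ 'r \<Rightarrow> nat \<Rightarrow> real) \<Rightarrow> bool" where
  "eigenvalue_family B n \<mu> \<longleftrightarrow> (\<forall>\<tau>. \<tau> \<noteq> 0 \<longrightarrow>
     (\<forall>j\<in>{1..n}. \<mu> \<tau> j > 0) \<and>
     (\<forall>i\<in>{1..n}. \<forall>j\<in>{1..n}. i \<le> j \<longrightarrow> \<mu> \<tau> j \<le> \<mu> \<tau> i) \<and>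
     (\<forall>z::complex. det (mat z - (\<chi> k l. complex_of_real (Bmat B \<tau> $ k $ l))) =
        (\<Prod>j=1..n. (z - \<i> * of_real (\<mu> \<tau> j)) * (z + \<i> * of_real (\<mu> \<tau> j)))))"

text \<open>Entry \<open>(k, l)\<close> of the block diagonal matrix with blocks \<open>(0, -m j; m j, 0)\<close>, \<open>1 \<le> j \<le> n\<close>.\<close>

definition block_entry :: "(nat \<Rightarrow> real) \<Rightarrow> nat \<Rightarrow> nat \<Rightarrow> real" where
  "block_entry m k l =
     (if odd k \<and> l = k + 1 then - m (l div 2)
      else if odd l \<and> k = l + 1 then m (k div 2)
      else 0)"

definition adapted_basis ::
  "(real ^ 'd \<Rightarrow> real ^ 'd \<Rightarrow> real ^ 'r) \<Rightarrow> nat \<Rightarrow> (real ^ 'r \<Rightarrow> nat \<Rightarrow> real) \<Rightarrow>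
   (real ^ 'r \<Rightarrow> nat \<Rightarrow> real ^ 'd) \<Rightarrow> bool" where
  "adapted_basis B n \<mu> v \<longleftrightarrow> (\<forall>\<tau>. \<tau> \<noteq> 0 \<longrightarrow>
     (\<forall>k\<in>{1..2*n}. \<forall>l\<in>{1..2*n}. v \<tau> k \<bullet> v \<tau> l = (if k = l then 1 else 0)) \<and>
     (\<forall>k\<in>{1..2*n}. \<forall>l\<in>{1..2*n}. v \<tau> k \<bullet> (Bmat B \<tau> *v v \<tau> l) = block_entry (\<mu> \<tau>) k l) \<and>
     (\<forall>k\<in>{1..2*n}. v \<tau> k = v (\<tau> /\<^sub>R norm \<tau>) k))"


subsection \<open>Laguerre functions\<close>

definition laguerre :: "real \<Rightarrow> nat \<Rightarrow> real \<Rightarrow> real" where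
  "laguerre p k x = (\<Sum>i\<le>k. (- 1) ^ i * ((real k + p) gchoose (k - i)) * x ^ i / fact i)"

text \<open>\<open>|y\<^sub>j\<^sup>\<tau>|\<^sup>2\<close>, where \<open>w\<close> is the orthonormal basis at \<open>\<tau>\<close>.\<close>

definition pair_norm_sq :: "(nat \<Rightarrow> real ^ 'd) \<Rightarrow> nat \<Rightarrow> real ^ 'd \<Rightarrow> real" where
  "pair_norm_sq w j y = (y \<bullet> w (2 * j - 1))\<^sup>2 + (y \<bullet> w (2 * j))\<^sup>2"

definition laguerre_fun ::
  "nat \<Rightarrow> (real ^ 'r \<Rightarrow> nat \<Rightarrow> real) \<Rightarrow> (real ^ 'r \<Rightarrow> nat \<Rightarrow> real ^ 'd) \<Rightarrow> (nat \<Rightarrow> nat) \<Rightarrow>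
   real ^ 'd \<Rightarrow> real ^ 'r \<Rightarrow> real" where
  "laguerre_fun n \<mu> v k y \<tau> =
     (\<Prod>j=1..n. 2 * \<mu> \<tau> j / pi * laguerre 0 (k j) (2 * \<mu> \<tau> j * pair_norm_sq (v \<tau>) j y)
        * exp (- \<mu> \<tau> j * pair_norm_sq (v \<tau>) j y))"

definition multi_indices :: "nat \<Rightarrow> nat \<Rightarrow> (nat \<Rightarrow> nat) set" where
  "multi_indices n m = {k \<in> {1..n} \<rightarrow>\<^sub>E UNIV. (\<Sum>j=1..n. k j) = m}"

lemma finite_multi_indices: "finite (multi_indices n m)"
proof (rule finite_subset)
  show "multi_indices n m \<subseteq> {1..n} \<rightarrow>\<^sub>E {..m}"
  proof
    fix k assume k: "k \<in> multi_indices n m"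
    have "k j \<le> m" if "j \<in> {1..n}" for j
      using member_le_sum[of j "{1..n}" k] that k by (auto simp: multi_indices_def)
    then show "k \<in> {1..n} \<rightarrow>\<^sub>E {..m}"
      using k by (auto simp: multi_indices_def PiE_iff)
  qed
qed (simp add: finite_PiE)

definition Qm ::
  "nat \<Rightarrow> (real ^ 'r \<Rightarrow> nat \<Rightarrow> real) \<Rightarrow> (real ^ 'r \<Rightarrow> nat \<Rightarrow> real ^ 'd) \<Rightarrow> nat \<Rightarrow>
   real ^ 'd \<Rightarrow> real ^ 'r \<Rightarrow> real" where
  "Qm n \<mu> v m y \<tau> = (\<Sum>k\<in>multi_indices n m. laguerre_fun n \<mu> v k y \<tau>)"


subsection \<open>The kernel \<open>P\<^sub>m\<close>\<close>

definition Pm_integral ::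
  "nat \<Rightarrow> (real ^ 'r \<Rightarrow> nat \<Rightarrow> real) \<Rightarrow> (real ^ 'r \<Rightarrow> nat \<Rightarrow> real ^ 'd) \<Rightarrow> nat \<Rightarrow>
   real ^ 'd \<Rightarrow> real ^ 'r \<Rightarrow> complex" where
  "Pm_integral n \<mu> v m y t =
     (LINT \<tau>|lborel. cis (t \<bullet> \<tau>) * of_real (Qm n \<mu> v m y \<tau>)) / of_real ((2 * pi) ^ CARD('r))"

text \<open>
  \<open>P\<close> is the continuous, locally Lipschitz extension of the integral from \<open>y \<noteq> 0\<close> to the
  complement of the origin. By density this determines \<open>P\<close> there; \<open>P 0\<close> is irrelevant.
\<close>

definition is_Pm ::
  "nat \<Rightarrow> (real ^ 'r \<Rightarrow> nat \<Rightarrow> real) \<Rightarrow> (real ^ 'r \<Rightarrow> nat \<Rightarrow> real ^ 'd) \<Rightarrow> nat \<Rightarrow>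
   ((real ^ 'd) \<times> (real ^ 'r) \<Rightarrow> complex) \<Rightarrow> bool" where
  "is_Pm n \<mu> v m P \<longleftrightarrow>
     (\<forall>y t. y \<noteq> 0 \<longrightarrow> P (y, t) = Pm_integral n \<mu> v m y t) \<and>
     continuous_on (- {0}) P \<and>
     (\<forall>p. p \<noteq> 0 \<longrightarrow> (\<exists>e>0. \<exists>L. L-lipschitz_on (ball p e - {0}) P))"


subsection \<open>Schwartz functions and the distributions\<close>

fun iterated_partial :: "'a::euclidean_space list \<Rightarrow> ('a \<Rightarrow> complex) \<Rightarrow> 'a \<Rightarrow> complex" where
  "iterated_partial [] f = f"
| "iterated_partial (b # bs) f = (\<lambda>x. frechet_derivative (iterated_partial bs f) (at x) b)"

text \<open>Differentiability of all iterated partial derivatives says that \<open>f\<close> is smooth.\<close>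

definition schwartz :: "('a::euclidean_space \<Rightarrow> complex) set" where
  "schwartz = {f. \<forall>bs. set bs \<subseteq> Basis \<longrightarrow>
     (\<forall>x. iterated_partial bs f differentiable (at x)) \<and>
     (\<forall>N::nat. \<exists>K. \<forall>x. norm x ^ N * norm (iterated_partial bs f x) \<le> K)}"

definition partial_fourier ::
  "((real ^ 'd) \<times> (real ^ 'r) \<Rightarrow> complex) \<Rightarrow> real ^ 'd \<Rightarrow> real ^ 'r \<Rightarrow> complex" where
  "partial_fourier \<phi> y \<tau> = (LINT t|lborel. cis (- (\<tau> \<bullet> t)) * \<phi> (y, t))"

definition Pm_dist_integrand ::
  "nat \<Rightarrow> (real ^ 'r \<Rightarrow> nat \<Rightarrow> real) \<Rightarrow> (real ^ 'r \<Rightarrow> nat \<Rightarrow> real ^ 'd) \<Rightarrow> nat \<Rightarrow>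
   ((real ^ 'd) \<times> (real ^ 'r) \<Rightarrow> complex) \<Rightarrow> (real ^ 'd) \<times> (real ^ 'r) \<Rightarrow> complex" where
  "Pm_dist_integrand n \<mu> v m \<phi> = (\<lambda>(y, \<tau>). of_real (Qm n \<mu> v m y \<tau>) * partial_fourier \<phi> y (- \<tau>))"

definition Pm_dist ::
  "nat \<Rightarrow> (real ^ 'r \<Rightarrow> nat \<Rightarrow> real) \<Rightarrow> (real ^ 'r \<Rightarrow> nat \<Rightarrow> real ^ 'd) \<Rightarrow> nat \<Rightarrow>
   ((real ^ 'd) \<times> (real ^ 'r) \<Rightarrow> complex) \<Rightarrow> complex" where
  "Pm_dist n \<mu> v m \<phi> = (LINT p|lborel. Pm_dist_integrand n \<mu> v m \<phi> p) / of_real ((2 * pi) ^ CARD('r))"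

definition hom_ball :: "real \<Rightarrow> ((real ^ 'd) \<times> (real ^ 'r)) set" where
  "hom_ball \<epsilon> = {(y, t). root 4 (norm y ^ 4 + norm t ^ 2) \<le> \<epsilon>}"

definition hom_sphere :: "((real ^ 'd) \<times> (real ^ 'r)) set" where
  "hom_sphere = {(y, t). norm y ^ 4 + norm t ^ 2 = 1}"

text \<open>The principal value of \<open>P\<close> at \<open>\<phi>\<close> exists (with absolutely convergent integrals) and is \<open>L\<close>.\<close>

definition has_pv ::
  "((real ^ 'd) \<times> (real ^ 'r) \<Rightarrow> complex) \<Rightarrow> ((real ^ 'd) \<times> (real ^ 'r) \<Rightarrow> complex) \<Rightarrow> complex \<Rightarrow> bool" where
  "has_pv P \<phi> L \<longleftrightarrow>
     (\<forall>\<epsilon>>0. set_integrable lborel (- hom_ball \<epsilon>) (\<lambda>p. \<phi> p * P p)) \<and>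
     ((\<lambda>\<epsilon>. LINT p:- hom_ball \<epsilon>|lborel. \<phi> p * P p) \<longlongrightarrow> L) (at_right 0)"

text \<open>
  \<open>\<sigma>\<close> is a Borel measure on the unit sphere satisfying the polar coordinate formula, whose
  exponent is \<open>Q - 1\<close> with \<open>Q = 2 n + 2 r\<close>. Indicator functions of cones over Borel subsets of
  the sphere show that the formula determines \<open>\<sigma>\<close>.
\<close>

definition polar_measure :: "((real ^ 'd) \<times> (real ^ 'r)) measure \<Rightarrow> bool" where
  "polar_measure \<sigma> \<longleftrightarrow>
     space \<sigma> = hom_sphere \<and>
     sets \<sigma> = sets (restrict_space borel hom_sphere) \<and>
     (\<forall>f :: (real ^ 'd) \<times> (real ^ 'r) \<Rightarrow> complex. integrable lborel f \<longrightarrow>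
        (LINT p|lborel. f p) =
        (LINT \<rho>:{0<..}|lborel. LINT p|\<sigma>.
           f (\<rho> *\<^sub>R fst p, \<rho>\<^sup>2 *\<^sub>R snd p) * of_real (\<rho> ^ (CARD('d) + 2 * CARD('r) - 1))))"

end

theory Submission
  imports Defs "HOL-Computational_Algebra.Formal_Power_Series"
begin

text \<open>
  Multiplying the generating functions of the Laguerre polynomials gives
  \<open>Q\<^sub>m(y, \<tau>) = D(\<tau>) \<psi>(2 S) exp(- S)\<close> with a polynomial \<open>\<psi>\<close>, \<open>S = \<Sum>j. \<mu>\<^sub>j |y\<^sub>j|\<^sup>2\<close> and
  \<open>D = \<Prod>j. 2 \<mu>\<^sub>j / \<pi>\<close>. Since \<open>\<mu>\<^sub>j\<close> is comparable to \<open>|\<tau>|\<close>, \<open>Q\<^sub>m\<close> is measurable and bounded by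
  a multiple of \<open>|\<tau>|\<^sup>n exp(- c |\<tau>| |y|\<^sup>2)\<close>, whose integral over \<open>y\<close> does not depend on \<open>\<tau>\<close>;
  as the partial Fourier transform of a Schwartz function decays in \<open>\<tau>\<close> uniformly in \<open>y\<close>, the
  integral defining the distribution converges absolutely.

  By Fubini the distribution at \<open>\<phi>\<close> is the limit of the integrals of \<open>\<phi> P\<^sub>m\<close> over the exteriors
  \<open>|y| > \<epsilon>\<close> of cylinders. The exterior of the homogeneous ball of radius \<open>\<epsilon>\<close> differs from this by
  the dilate by \<open>\<epsilon>\<close> of the region where the homogeneous norm exceeds 1 but \<open>|y| \<le> 1\<close>. As \<open>P\<^sub>m\<close> is
  homogeneous of degree \<open>- Q\<close> and integrable over that region, the difference tends to \<open>\<phi>(0)\<close> times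
  its integral there, which is \<open>- C\<close>.

  Existence of the limit over \<open>|y| > \<epsilon>\<close> for a Gaussian \<open>\<phi>\<close> forces the integral of \<open>P\<^sub>m\<close> over
  \<open>1 < |y| \<le> 2\<close> to vanish, hence also the integral over the homogeneous annulus of radii 1 and 2, which by
  the polar coordinate formula is \<open>ln 2\<close> times the integral over the sphere.
\<close>

subsection \<open>Integrals over Euclidean spaces\<close>

text \<open>A dyadic decomposition. The \<open>k\<close>-th cube has volume
  \<open>(4 * 2 ^ k) ^ DIM('a)\<close>, while the integrand is at most
  \<open>(1 / 2 ^ k) ^ (DIM('a) + 1)\<close> at a point with \<open>2 ^ k \<le> 1 + norm x\<close>;
  one surplus factor \<open>1 / 2 ^ k\<close> remains and gives a geometric series.\<close>

lemma nn_integral_inverse_power_norm_finite: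
  "(\<integral>\<^sup>+x. ennreal (1 / (1 + norm (x :: 'a :: euclidean_space)) ^ (DIM('a) + 1)) \<partial>lborel) < \<infinity>"
proof -
  let ?D = "DIM('a)"
  let ?A = "\<lambda>k::nat. cbox (- (2 ^ Suc k) *\<^sub>R One) ((2 ^ Suc k) *\<^sub>R One :: 'a)"
  have em: "emeasure lborel (?A k) = ennreal ((2 * 2 ^ Suc k) ^ ?D)" for k
  proof -
    have "(\<Prod>b\<in>Basis. ((2 ^ Suc k) *\<^sub>R One - (- (2 ^ Suc k) *\<^sub>R One) :: 'a) \<bullet> b) = (\<Prod>b\<in>(Basis::'a set). 2 * 2 ^ Suc k)"
      by (intro prod.cong refl) (simp add: inner_diff_left inner_add_left)
    then show ?thesis
      by (subst emeasure_lborel_cbox) (simp_all add: inner_diff_left)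
  qed
  have pt: "ennreal (1 / (1 + norm x) ^ (?D + 1)) \<le> (\<Sum>k. ennreal ((1 / 2 ^ k) ^ (?D + 1)) * indicator (?A k) x)"
    for x :: 'a
  proof -
    obtain k0 where k0: "norm x < 2 ^ k0"
      using real_arch_pow[of 2 "norm x"] by auto
    \<comment> \<open>Minimality gives the lower bound \<open>2 ^ k \<le> norm x\<close> only for
      positive \<open>k\<close>; for \<open>k = 0\<close> the summand 1 in \<open>1 + norm x\<close>
      takes over.\<close>
    define k where "k = (LEAST k. norm x < 2 ^ Suc k)"
    have ex: "norm x < 2 ^ Suc k0"
      using k0 by (rule order_less_le_trans) simp
    have k1: "norm x < 2 ^ Suc k"
      unfolding k_def by (rule LeastI[of _ k0]) (rule ex)
    have k2: "2 ^ k \<le> 1 + norm x"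
    proof (cases k)
      case (Suc j)
      have "\<not> norm x < 2 ^ Suc j"
        using not_less_Least[of j "\<lambda>k. norm x < 2 ^ Suc k"] Suc unfolding k_def by auto
      then show ?thesis using Suc by simp
    qed simp
    have xA: "x \<in> ?A k"
    proof -
      have "\<bar>x \<bullet> b\<bar> \<le> 2 ^ Suc k" if "b \<in> Basis" for b
        using Basis_le_norm[OF that, of x] k1 by linarith
      then show ?thesis by (force simp: mem_box abs_le_iff)
    qed
    have "1 / (1 + norm x) ^ (?D + 1) \<le> 1 / (2 ^ k) ^ (?D + 1)"
      using k2 by (intro divide_left_mono power_mono mult_pos_pos zero_less_power) (auto intro: add_pos_nonneg)
    then have "ennreal (1 / (1 + norm x) ^ (?D + 1)) \<le> ennreal ((1 / 2 ^ k) ^ (?D + 1)) * indicator (?A k) x"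
      using xA by (simp add: power_divide ennreal_leI)
    also have "\<dots> = (\<Sum>j\<in>{k}. ennreal ((1 / 2 ^ j) ^ (?D + 1)) * indicator (?A j) x)"
      by (subst sum.insert) simp_all
    also have "\<dots> \<le> (\<Sum>k. ennreal ((1 / 2 ^ k) ^ (?D + 1)) * indicator (?A k) x)"
      by (rule sum_le_suminf) auto
    finally show ?thesis .
  qed
  have "(\<integral>\<^sup>+x. ennreal (1 / (1 + norm (x :: 'a)) ^ (?D + 1)) \<partial>lborel) \<le>
        (\<integral>\<^sup>+x. (\<Sum>k. ennreal ((1 / 2 ^ k) ^ (?D + 1)) * indicator (?A k) x) \<partial>lborel)"
    by (intro nn_integral_mono pt)
  also have "\<dots> = (\<Sum>k. ennreal ((1 / 2 ^ k) ^ (?D + 1)) * emeasure lborel (?A k))"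
    by (subst nn_integral_suminf) (auto simp: nn_integral_cmult)
  also have "\<dots> = (\<Sum>k. ennreal (4 ^ ?D * (1/2) ^ k))"
  proof (intro suminf_cong)
    fix k
    have "((1 / 2 ^ k) ^ (?D + 1)) * ((2 * 2 ^ Suc k) ^ ?D) = ((4::real) ^ ?D * (1/2) ^ k)"
    proof -
      have "((1 / 2 ^ k) ^ (?D + 1)) * ((2 * 2 ^ Suc k) ^ ?D) = ((1 / 2 ^ k) * (2 * 2 ^ Suc k :: real)) ^ ?D * (1 / 2 ^ k)"
        by (simp only: power_mult_distrib power_add power_one_right mult_ac)
      then show ?thesis by (simp add: power_divide)
    qed
    then show "ennreal ((1 / 2 ^ k) ^ (?D + 1)) * emeasure lborel (?A k) = ennreal (4 ^ ?D * (1/2) ^ k)"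
      unfolding em by (simp flip: ennreal_mult' del: power_Suc power_add)
  qed
  also have "\<dots> = ennreal (\<Sum>k. 4 ^ ?D * (1/2) ^ k)"
    by (rule suminf_ennreal2) (auto intro!: summable_mult complete_algebra_summable_geometric)
  also have "\<dots> < \<infinity>" by simp
  finally show ?thesis .
qed

lemma integrable_inverse_power_norm:
  "integrable lborel (\<lambda>x :: 'a :: euclidean_space. 1 / (1 + norm x) ^ (DIM('a) + 1))"
  using nn_integral_inverse_power_norm_finite[where 'a = 'a]
  by (intro integrableI_bounded) auto

lemma integrable_of_decay:
  fixes f :: "'a :: euclidean_space \<Rightarrow> 'b :: {banach, second_countable_topology}"
  assumes "f \<in> borel_measurable borel"
    and "\<And>x. norm (f x) \<le> K / (1 + norm x) ^ (DIM('a) + 1)"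
  shows "integrable lborel f"
proof (rule Bochner_Integration.integrable_bound)
  show "integrable lborel (\<lambda>x::'a. K * (1 / (1 + norm x) ^ (DIM('a) + 1)))"
    by (intro integrable_mult_right integrable_inverse_power_norm)
  show "AE x in lborel. norm (f x) \<le> norm (K * (1 / (1 + norm x) ^ (DIM('a) + 1)))"
  proof (intro AE_I2)
    fix x
    have "norm (f x) \<le> K * (1 / (1 + norm x) ^ (DIM('a) + 1))"
      using assms(2)[of x] by (simp only: times_divide_eq_right mult_1_right)
    also have "\<dots> \<le> norm (K * (1 / (1 + norm x) ^ (DIM('a) + 1)))"
      by (simp only: real_norm_def abs_ge_self)
    finally show "norm (f x) \<le> norm (K * (1 / (1 + norm x) ^ (DIM('a) + 1)))" .
  qed
qed (use assms in auto)

text \<open>The substitution \<open>e = inverse t\<close> turns the limit at 0 from the right into a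
  limit at infinity.\<close>

lemma integral_dominated_convergence_at_right:
  fixes s :: "real \<Rightarrow> 'a \<Rightarrow> 'b :: {banach, second_countable_topology}" and w :: "'a \<Rightarrow> real"
  assumes "f \<in> borel_measurable M" "\<And>e. s e \<in> borel_measurable M" "integrable M w"
    and "AE x in M. ((\<lambda>e. s e x) \<longlongrightarrow> f x) (at_right 0)"
    and "eventually (\<lambda>e. AE x in M. norm (s e x) \<le> w x) (at_right 0)"
  shows "((\<lambda>e. integral\<^sup>L M (s e)) \<longlongrightarrow> integral\<^sup>L M f) (at_right 0)"
proof -
  have "((\<lambda>t. integral\<^sup>L M (s (inverse t))) \<longlongrightarrow> integral\<^sup>L M f) at_top"
    using assms
    by (intro integral_dominated_convergence_at_top[where w = w])
       (auto simp: at_right_to_top filterlim_filtermap eventually_filtermap)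
  then show ?thesis
    by (simp add: at_right_to_top filterlim_filtermap)
qed

lemma one_plus_norm_le_mult:
  fixes x c :: "'a :: real_normed_vector"
  assumes "norm c \<le> r"
  shows "1 + norm x \<le> (1 + r) * (1 + norm (x + c))"
proof -
  have "norm x \<le> norm (x + c) + norm c"
    using norm_triangle_ineq4[of "x + c" c] by simp
  moreover have "0 \<le> r * norm (x + c)"
    using assms norm_ge_zero[of c] by (intro mult_nonneg_nonneg) (use norm_ge_zero[of c] in linarith, simp)
  ultimately show ?thesis
    using assms by (simp add: algebra_simps)
qed

text \<open>A Peetre-type inequality: a bounded shift changes a polynomial weight by a bounded
  factor only. It supplies one integrable majorant for all difference quotients of a decaying
  function.\<close>

lemma inverse_power_one_plus_norm_le:
  fixes x c :: "'a :: real_normed_vector"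
  assumes "norm c \<le> r"
  shows "1 / (1 + norm (x + c)) ^ N \<le> (1 + r) ^ N * (1 / (1 + norm x) ^ N)"
proof -
  have "(1 + norm x) ^ N \<le> ((1 + r) * (1 + norm (x + c))) ^ N"
    using assms by (intro power_mono one_plus_norm_le_mult) auto
  then have "(1 + norm x) ^ N \<le> (1 + r) ^ N * (1 + norm (x + c)) ^ N"
    by (simp only: power_mult_distrib)
  moreover have "0 < (1 + norm x) ^ N" "0 < (1 + norm (x + c)) ^ N"
    by (auto intro!: zero_less_power simp: add_pos_nonneg)
  moreover have "1 / b \<le> r' * (1 / a)" if "a \<le> r' * b" "0 < a" "0 < b" for a b r' :: real
    using that by (simp add: field_simps)
  ultimately show ?thesis by blast
qed

text \<open>
  The integral of a difference quotient vanishes by translation invariance; the mean value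
  inequality and the decay of the derivative allow the limit to be taken under the integral.
\<close>

lemma integral_directional_derivative_eq_0:
  fixes f :: "'a :: euclidean_space \<Rightarrow> complex"
  assumes der: "\<And>x. (f has_derivative f' x) (at x)"
    and f: "\<And>x. norm (f x) \<le> K / (1 + norm x) ^ (DIM('a) + 1)"
    and f': "\<And>x. norm (f' x b) \<le> K / (1 + norm x) ^ (DIM('a) + 1)"
  shows "(LINT x|lborel. f' x b) = 0"
proof -
  let ?D = "DIM('a) + 1"
  have "continuous_on UNIV f"
    using der by (meson continuous_at_imp_continuous_on has_derivative_continuous)
  then have [measurable]: "f \<in> borel_measurable borel"
    by (rule borel_measurable_continuous_onI)
  have intf: "integrable lborel f"
    by (rule integrable_of_decay[OF _ f]) simp
  have K: "0 \<le> K"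
    using order_trans[OF norm_ge_zero f[of 0]] by simp
  define s where "s n x = real (Suc n) *\<^sub>R (f (x + (1 / real (Suc n)) *\<^sub>R b) - f x)" for n x
  have [measurable]: "s n \<in> borel_measurable borel" for n
    unfolding s_def by measurable
  have line: "((\<lambda>h. f (x + h *\<^sub>R b)) has_derivative (\<lambda>h. f' (x + u *\<^sub>R b) (h *\<^sub>R b))) (at u)" for x u
    by (rule has_derivative_compose[of "\<lambda>h. x + h *\<^sub>R b" "\<lambda>h. h *\<^sub>R b", OF _ der])
       (auto intro!: derivative_eq_intros)
  have lin: "f' x (h *\<^sub>R b) = h *\<^sub>R f' x b" for x h
    using has_derivative_linear[OF der] by (simp add: linear_cmul)
  have lim: "(\<lambda>n. s n x) \<longlonglongrightarrow> f' x b" for x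
  proof -
    have "((\<lambda>h. f (x + h *\<^sub>R b)) has_vector_derivative f' x b) (at 0)"
      using line[of x 0] by (simp add: has_vector_derivative_def lin)
    then have "((\<lambda>h. (f (x + h *\<^sub>R b) - f x) /\<^sub>R h) \<longlongrightarrow> f' x b) (at 0)"
    proof -
      assume "((\<lambda>h. f (x + h *\<^sub>R b)) has_vector_derivative f' x b) (at 0)"
      then have "((\<lambda>h. norm (f (x + h *\<^sub>R b) - f x - h *\<^sub>R f' x b) / norm h) \<longlongrightarrow> 0) (at 0)"
        by (simp add: has_vector_derivative_def has_derivative_at)
      moreover have "norm (f (x + h *\<^sub>R b) - f x - h *\<^sub>R f' x b) / norm h
          = norm ((f (x + h *\<^sub>R b) - f x) /\<^sub>R h - f' x b)" if "h \<noteq> 0" for h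
      proof -
        have "(f (x + h *\<^sub>R b) - f x) /\<^sub>R h - f' x b = (f (x + h *\<^sub>R b) - f x - h *\<^sub>R f' x b) /\<^sub>R h"
          using that by (simp add: scaleR_diff_right)
        then show ?thesis by (simp add: divide_inverse mult.commute)
      qed
      ultimately have "((\<lambda>h. norm ((f (x + h *\<^sub>R b) - f x) /\<^sub>R h - f' x b)) \<longlongrightarrow> 0) (at 0)"
        by (subst (asm) LIM_cong[OF refl]) auto
      then show ?thesis
        by (simp add: tendsto_norm_zero_iff LIM_zero_iff)
    qed
    moreover have "filterlim (\<lambda>n. 1 / real (Suc n)) (at 0) sequentially"
      by (rule filterlim_atI) (use LIMSEQ_inverse_real_of_nat in \<open>auto simp: inverse_eq_divide\<close>)
    ultimately have "(\<lambda>n. (f (x + (1 / real (Suc n)) *\<^sub>R b) - f x) /\<^sub>R (1 / real (Suc n))) \<longlonglongrightarrow> f' x b"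
      by (rule filterlim_compose)
    then show ?thesis by (simp add: s_def)
  qed
  have bound: "norm (s n x) \<le> K * (1 + norm b) ^ ?D * (1 / (1 + norm x) ^ ?D)" for n x
  proof -
    let ?h = "1 / real (Suc n)"
    have "\<exists>u\<in>{0<..<?h}. norm (f (x + ?h *\<^sub>R b) - f (x + 0 *\<^sub>R b)) \<le> norm (f' (x + u *\<^sub>R b) ((?h - 0) *\<^sub>R b))"
      by (rule mvt_general[where f = "\<lambda>h. f (x + h *\<^sub>R b)"])
         (auto intro: line has_derivative_at_withinI continuous_at_imp_continuous_on has_derivative_continuous)
    then obtain u where u: "0 < u" "u < ?h"
      and le: "norm (f (x + ?h *\<^sub>R b) - f x) \<le> ?h * norm (f' (x + u *\<^sub>R b) b)"
      by (auto simp: lin)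
    have "norm (s n x) = real (Suc n) * norm (f (x + ?h *\<^sub>R b) - f x)"
      by (simp add: s_def)
    also have "\<dots> \<le> real (Suc n) * (?h * norm (f' (x + u *\<^sub>R b) b))"
      by (intro mult_left_mono le) auto
    also have "\<dots> = norm (f' (x + u *\<^sub>R b) b)" by simp
    also have "\<dots> \<le> K / (1 + norm (x + u *\<^sub>R b)) ^ ?D" by (rule f')
    also have "\<dots> \<le> K * (1 + norm b) ^ ?D * (1 / (1 + norm x) ^ ?D)"
    proof -
      have "?h \<le> 1" by simp
      then have "u \<le> 1" using u by linarith
      then have "norm (u *\<^sub>R b) \<le> norm b"
        using u by (simp add: mult_left_le_one_le)
      then have "1 / (1 + norm (x + u *\<^sub>R b)) ^ ?D \<le> (1 + norm b) ^ ?D * (1 / (1 + norm x) ^ ?D)"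
        by (rule inverse_power_one_plus_norm_le)
      from mult_left_mono[OF this K] show ?thesis by (simp only: mult.assoc times_divide_eq_right mult_1_right)
    qed
    finally show ?thesis .
  qed
  have zero: "(LINT x|lborel. s n x) = 0" for n
  proof -
    have tr: "integrable lborel (\<lambda>x. f (c + x))" "(LINT x|lborel. f (c + x)) = (LINT x|lborel. f x)" for c
    proof -
      show "integrable lborel (\<lambda>x. f (c + x))"
        using intf by (subst (asm) lborel_distr_plus[symmetric, of c], subst (asm) integrable_distr_eq) auto
      show "(LINT x|lborel. f (c + x)) = (LINT x|lborel. f x)"
        by (subst (2) lborel_distr_plus[symmetric, of c], subst integral_distr) auto
    qed
    show ?thesis
      unfolding s_def using tr[of "(1 / real (Suc n)) *\<^sub>R b"] intf by (simp add: add.commute)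
  qed
  have "(\<lambda>n. LINT x|lborel. s n x) \<longlonglongrightarrow> (LINT x|lborel. f' x b)"
  proof (rule integral_dominated_convergence)
    show "(\<lambda>x. f' x b) \<in> borel_measurable lborel"
      using borel_measurable_LIMSEQ_metric[of s borel "\<lambda>x. f' x b"] lim by auto
    show "integrable lborel (\<lambda>x :: 'a. K * (1 + norm b) ^ ?D * (1 / (1 + norm x) ^ ?D))"
      by (rule integrable_mult_right) (rule integrable_inverse_power_norm)
  qed (use lim bound in auto)
  then show ?thesis
    by (simp add: zero LIMSEQ_const_iff)
qed

subsection \<open>Schwartz functions\<close>

lemma iterated_partial_append:
  "iterated_partial (bs @ cs) f = iterated_partial bs (iterated_partial cs f)"
  by (induction bs) auto

text \<open>In \<open>iterated_partial\<close> the head of the list is the outermost derivative, so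
  differentiating first in direction \<open>b\<close> amounts to appending \<open>b\<close> at the
  end.\<close>

lemma schwartz_partial:
  assumes "f \<in> schwartz" "b \<in> Basis"
  shows "(\<lambda>x. frechet_derivative f (at x) b) \<in> schwartz"
proof -
  have *: "iterated_partial bs (\<lambda>x. frechet_derivative f (at x) b) = iterated_partial (bs @ [b]) f" for bs
    by (simp add: iterated_partial_append)
  show ?thesis
    using assms unfolding schwartz_def mem_Collect_eq * by auto
qed

lemma schwartz_has_derivative:
  assumes "f \<in> schwartz"
  shows "(f has_derivative frechet_derivative f (at x)) (at x)"
proof -
  have "f differentiable (at x)"
    using assms unfolding schwartz_def mem_Collect_eq
    by (metis empty_subsetI iterated_partial.simps(1) list.set(1))
  then show ?thesis by (simp add: frechet_derivative_works)
qed

lemma schwartz_continuous: "f \<in> schwartz \<Longrightarrow> continuous_on UNIV f"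
  by (meson continuous_at_imp_continuous_on has_derivative_continuous schwartz_has_derivative)

lemma borel_measurable_schwartz: "f \<in> schwartz \<Longrightarrow> f \<in> borel_measurable borel"
  by (intro borel_measurable_continuous_onI schwartz_continuous)

lemma power_one_plus_le:
  fixes t :: real
  assumes "0 \<le> t"
  shows "(1 + t) ^ N \<le> 2 ^ N * (1 + t ^ N)"
proof (cases "t \<le> 1")
  case True
  then have "(1 + t) ^ N \<le> 2 ^ N" using assms by (intro power_mono) auto
  also have "\<dots> \<le> 2 ^ N * (1 + t ^ N)" using assms by simp
  finally show ?thesis .
next
  case False
  then have "(1 + t) ^ N \<le> (2 * t) ^ N" using assms by (intro power_mono) auto
  also have "\<dots> \<le> 2 ^ N * (1 + t ^ N)" by (simp add: power_mult_distrib)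
  finally show ?thesis .
qed

text \<open>The weight \<open>norm x ^ N\<close> degenerates at the origin; adding the bound for
  exponent 0 allows it to be replaced by \<open>(1 + norm x) ^ N\<close>.\<close>

lemma schwartz_decay:
  assumes "f \<in> schwartz"
  obtains K where "0 \<le> K" "\<And>x. norm (f x) \<le> K / (1 + norm x) ^ N"
proof -
  have "\<forall>M. \<exists>K. \<forall>x. norm x ^ M * norm (f x) \<le> K"
    using assms unfolding schwartz_def mem_Collect_eq
    by (metis empty_subsetI iterated_partial.simps(1) list.set(1))
  then obtain K where K: "\<And>M x. norm x ^ M * norm (f x) \<le> K M" by metis
  define L where "L = 2 ^ N * (K 0 + K N)"
  have le: "(1 + norm x) ^ N * norm (f x) \<le> L" for x
  proof -
    have "(1 + norm x) ^ N * norm (f x) \<le> 2 ^ N * (1 + norm x ^ N) * norm (f x)"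
      by (intro mult_right_mono power_one_plus_le) auto
    also have "\<dots> = 2 ^ N * (norm x ^ 0 * norm (f x) + norm x ^ N * norm (f x))"
      by (simp add: algebra_simps)
    also have "\<dots> \<le> L"
      unfolding L_def by (intro mult_left_mono add_mono K) auto
    finally show ?thesis .
  qed
  show ?thesis
  proof
    show "0 \<le> L" by (rule order_trans[OF _ le[of 0]]) simp
    show "norm (f x) \<le> L / (1 + norm x) ^ N" for x
      using le[of x] by (simp add: field_simps add_pos_nonneg)
  qed
qed

text \<open>Polynomials times a Gaussian form a class closed under differentiation, all of whose
  members decay rapidly. It serves to show that the Gaussian is a Schwartz function, which yields a
  test function that does not vanish at the origin.\<close>

inductive gaussian_poly :: "('a :: euclidean_space \<Rightarrow> complex) \<Rightarrow> bool" where
  base: "gaussian_poly (\<lambda>x. of_real (exp (- (x \<bullet> x))))"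
| mult: "gaussian_poly f \<Longrightarrow> gaussian_poly (\<lambda>x. of_real (x \<bullet> b) * f x)"
| add: "gaussian_poly f \<Longrightarrow> gaussian_poly g \<Longrightarrow> gaussian_poly (\<lambda>x. f x + g x)"
| scale: "gaussian_poly f \<Longrightarrow> gaussian_poly (\<lambda>x. of_real c * f x)"

lemma gaussian_poly_derivative:
  assumes "gaussian_poly f"
  shows "\<exists>f'. (\<forall>x. (f has_derivative f' x) (at x)) \<and> (\<forall>b. gaussian_poly (\<lambda>x. f' x b))"
  using assms
proof induction
  case base
  show ?case
  proof (intro exI conjI allI)
    show "((\<lambda>x. complex_of_real (exp (- (x \<bullet> x)))) has_derivative
        (\<lambda>h. of_real (- 2) * (of_real (x \<bullet> h) * of_real (exp (- (x \<bullet> x)))))) (at x)" for x :: 'a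
      by (auto intro!: derivative_eq_intros simp: inner_commute algebra_simps)
    show "gaussian_poly (\<lambda>x. of_real (- 2) * (of_real (x \<bullet> b) * of_real (exp (- (x \<bullet> x)))))" for b :: 'a
      by (intro gaussian_poly.intros)
  qed
next
  case (mult f a)
  then obtain f' where f': "\<And>x. (f has_derivative f' x) (at x)" "\<And>b. gaussian_poly (\<lambda>x. f' x b)"
    by blast
  show ?case
  proof (intro exI conjI allI)
    show "((\<lambda>x. of_real (x \<bullet> a) * f x) has_derivative
        (\<lambda>h. of_real (h \<bullet> a) * f x + of_real (x \<bullet> a) * f' x h)) (at x)" for x
      by (auto intro!: derivative_eq_intros f'(1))
    show "gaussian_poly (\<lambda>x. of_real (b \<bullet> a) * f x + of_real (x \<bullet> a) * f' x b)" for b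
      by (intro gaussian_poly.intros f' mult)
  qed
next
  case (add f g)
  then obtain f' g' where "\<And>x. (f has_derivative f' x) (at x)" "\<And>b. gaussian_poly (\<lambda>x. f' x b)"
    "\<And>x. (g has_derivative g' x) (at x)" "\<And>b. gaussian_poly (\<lambda>x. g' x b)"
    by blast
  then show ?case
    by (intro exI[of _ "\<lambda>x h. f' x h + g' x h"]) (auto intro: derivative_intros gaussian_poly.intros)
next
  case (scale f c)
  then obtain f' where "\<And>x. (f has_derivative f' x) (at x)" "\<And>b. gaussian_poly (\<lambda>x. f' x b)"
    by blast
  then show ?case
    by (intro exI[of _ "\<lambda>x h. of_real c * f' x h"]) (auto intro!: derivative_eq_intros gaussian_poly.intros)
qed

lemma gaussian_poly_bound:
  assumes "gaussian_poly f"
  shows "\<exists>K N. \<forall>x. norm (f x) \<le> K * (1 + norm x) ^ N * exp (- (norm x)\<^sup>2)"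
  using assms
proof induction
  case base
  show ?case by (intro exI[of _ 1] exI[of _ 0]) (simp add: power2_norm_eq_inner)
next
  case (mult f b)
  then obtain K N where K: "\<And>x. norm (f x) \<le> K * (1 + norm x) ^ N * exp (- (norm x)\<^sup>2)" by blast
  have "norm (of_real (x \<bullet> b) * f x) \<le> (norm b * K) * (1 + norm x) ^ Suc N * exp (- (norm x)\<^sup>2)" for x
  proof -
    have "\<bar>x \<bullet> b\<bar> \<le> (1 + norm x) * norm b"
      using Cauchy_Schwarz_ineq2[of x b] by (simp add: algebra_simps) (smt (verit) norm_ge_zero)
    then have "norm (of_real (x \<bullet> b) * f x) \<le> ((1 + norm x) * norm b) * (K * (1 + norm x) ^ N * exp (- (norm x)\<^sup>2))"
      unfolding norm_mult norm_of_real by (intro mult_mono K) auto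
    then show ?thesis by (simp add: algebra_simps)
  qed
  then show ?case by blast
next
  case (add f g)
  then obtain K N K' N' where K: "\<And>x. norm (f x) \<le> K * (1 + norm x) ^ N * exp (- (norm x)\<^sup>2)"
    "\<And>x. norm (g x) \<le> K' * (1 + norm x) ^ N' * exp (- (norm x)\<^sup>2)" by metis
  have "norm (f x + g x) \<le> (\<bar>K\<bar> + \<bar>K'\<bar>) * (1 + norm x) ^ (N + N') * exp (- (norm x)\<^sup>2)" for x
  proof -
    have "norm (f x + g x) \<le> K * (1 + norm x) ^ N * exp (- (norm x)\<^sup>2) + K' * (1 + norm x) ^ N' * exp (- (norm x)\<^sup>2)"
      by (rule order_trans[OF norm_triangle_ineq]) (intro add_mono K)
    also have "\<dots> \<le> \<bar>K\<bar> * (1 + norm x) ^ (N + N') * exp (- (norm x)\<^sup>2) + \<bar>K'\<bar> * (1 + norm x) ^ (N + N') * exp (- (norm x)\<^sup>2)"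
      by (intro add_mono mult_mono power_increasing) auto
    finally show ?thesis by (simp add: algebra_simps)
  qed
  then show ?case by blast
next
  case (scale f c)
  then obtain K N where K: "\<And>x. norm (f x) \<le> K * (1 + norm x) ^ N * exp (- (norm x)\<^sup>2)" by blast
  have "norm (of_real c * f x) \<le> (\<bar>c\<bar> * K) * (1 + norm x) ^ N * exp (- (norm x)\<^sup>2)" for x
    using mult_left_mono[OF K[of x], of "\<bar>c\<bar>"] by (simp add: norm_mult mult.assoc)
  then show ?case by blast
qed

text \<open>A single term of the exponential series. Every later exchange of a power for an
  exponential goes through this estimate.\<close>

lemma power_over_fact_le_exp:
  fixes x :: real
  assumes "0 \<le> x"
  shows "x ^ N / fact N \<le> exp x"
proof -
  have "x ^ N / fact N = (\<Sum>n\<in>{N}. x ^ n /\<^sub>R fact n)"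
    by (simp add: divide_inverse mult.commute)
  also have "\<dots> \<le> exp x"
    unfolding sums_unique[OF exp_converges]
    by (rule sum_le_suminf) (use assms summable_exp_generic[of x] in auto)
  finally show ?thesis .
qed

lemma power_times_gaussian_le:
  fixes t :: real
  assumes "0 \<le> t"
  shows "(1 + t) ^ N * exp (- t\<^sup>2) \<le> fact N * exp 2"
proof -
  have "(1 + t) ^ N / fact N \<le> exp (1 + t)"
    using assms by (intro power_over_fact_le_exp) auto
  then have "(1 + t) ^ N * exp (- t\<^sup>2) \<le> fact N * exp (1 + t) * exp (- t\<^sup>2)"
    by (intro mult_right_mono) (auto simp: field_simps)
  also have "\<dots> = fact N * exp (1 + t - t\<^sup>2)"
    by (simp add: exp_diff exp_minus divide_inverse)
  also have "\<dots> \<le> fact N * exp 2"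
  proof (intro mult_left_mono)
    \<comment> \<open>Completing the square bounds the exponent \<open>1 + t - t\<^sup>2\<close> by
      \<open>5/4\<close>, which is rounded up to 2.\<close>
    have "0 \<le> (t - 1/2)\<^sup>2" by simp
    then have "1 + t - t\<^sup>2 \<le> 2" by (simp add: power2_eq_square algebra_simps)
    then show "exp (1 + t - t\<^sup>2) \<le> exp 2" by simp
  qed auto
  finally show ?thesis .
qed

lemma gaussian_poly_schwartz:
  assumes "gaussian_poly f"
  shows "f \<in> schwartz"
proof -
  have it: "gaussian_poly (iterated_partial bs f)" for bs
  proof (induction bs)
    case (Cons b bs)
    then obtain f' where "\<And>x. (iterated_partial bs f has_derivative f' x) (at x)" "gaussian_poly (\<lambda>x. f' x b)"
      using gaussian_poly_derivative by blast
    moreover from this have "frechet_derivative (iterated_partial bs f) (at x) = f' x" for x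
      using frechet_derivative_at by metis
    ultimately show ?case by simp
  qed (use assms in simp)
  have bd: "\<exists>K. \<forall>x. norm x ^ M * norm (g x) \<le> K" if g: "gaussian_poly g" for g :: "'a \<Rightarrow> complex" and M
  proof -
    from gaussian_poly_bound[OF g] obtain K N
      where K: "\<And>x. norm (g x) \<le> K * (1 + norm x) ^ N * exp (- (norm x)\<^sup>2)" by blast
    have "norm x ^ M * norm (g x) \<le> \<bar>K\<bar> * (fact (M + N) * exp 2)" for x
    proof -
      have "norm x ^ M * norm (g x) \<le> (1 + norm x) ^ M * (\<bar>K\<bar> * (1 + norm x) ^ N * exp (- (norm x)\<^sup>2))"
        by (intro mult_mono power_mono order_trans[OF K] mult_right_mono) auto
      also have "\<dots> = \<bar>K\<bar> * ((1 + norm x) ^ (M + N) * exp (- (norm x)\<^sup>2))"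
        by (simp add: power_add)
      also have "\<dots> \<le> \<bar>K\<bar> * (fact (M + N) * exp 2)"
        by (intro mult_left_mono power_times_gaussian_le) auto
      finally show ?thesis .
    qed
    then show ?thesis by blast
  qed
  have "iterated_partial bs f differentiable (at x)" for bs x
    using gaussian_poly_derivative[OF it[of bs]] by (auto simp: differentiable_def)
  with bd[OF it] show ?thesis
    by (auto simp: schwartz_def)
qed

subsection \<open>Decay of the partial Fourier transform\<close>

text \<open>Integration by parts: the \<open>i\<close>-th partial derivative of
  \<open>cis (- (\<tau> \<bullet> t)) * \<phi> (y, t)\<close> in \<open>t\<close> has integral 0,
  and the product rule splits it into the two sides of the claim.\<close>

lemma partial_fourier_partial:
  fixes \<phi> :: "(real ^ 'd) \<times> (real ^ 'r) \<Rightarrow> complex"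
  assumes \<phi>: "\<phi> \<in> schwartz"
  shows "partial_fourier (\<lambda>p. frechet_derivative \<phi> (at p) (0, axis i 1)) y \<tau>
    = \<i> * of_real (\<tau> $ i) * partial_fourier \<phi> y \<tau>"
proof -
  let ?b = "axis i 1 :: real ^ 'r"
  let ?D = "DIM(real ^ 'r) + 1"
  let ?\<psi> = "\<lambda>p. frechet_derivative \<phi> (at p) (0, ?b)"
  have \<psi>: "?\<psi> \<in> schwartz"
    by (rule schwartz_partial[OF \<phi>]) (auto simp: Basis_prod_def axis_in_Basis_iff)
  obtain K where K: "0 \<le> K" "\<And>p. norm (\<phi> p) \<le> K / (1 + norm p) ^ ?D" using schwartz_decay[OF \<phi>] by blast
  obtain L where L: "0 \<le> L" "\<And>p. norm (?\<psi> p) \<le> L / (1 + norm p) ^ ?D" using schwartz_decay[OF \<psi>] by blast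
  have norm_le: "norm t \<le> norm (y, t)" for t :: "real ^ 'r"
    by (simp add: norm_Pair)
  have sec: "c / (1 + norm (y, t)) ^ ?D \<le> c / (1 + norm t) ^ ?D" if "0 \<le> c" for c and t :: "real ^ 'r"
    using that norm_le[of t]
    by (intro divide_left_mono power_mono add_left_mono mult_pos_pos zero_less_power) (auto intro: add_pos_nonneg)
  define f where "f t = cis (- (\<tau> \<bullet> t)) * \<phi> (y, t)" for t
  define f' where "f' t h = cis (- (\<tau> \<bullet> t)) * frechet_derivative \<phi> (at (y, t)) (0, h)
      + (- (\<tau> \<bullet> h)) *\<^sub>R (\<i> * cis (- (\<tau> \<bullet> t))) * \<phi> (y, t)" for t h
  have der: "(f has_derivative f' t) (at t)" for t
  proof -
    have "((\<lambda>t. \<phi> (y, t)) has_derivative (\<lambda>h. frechet_derivative \<phi> (at (y, t)) (0, h))) (at t)"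
      by (rule has_derivative_compose[of "\<lambda>t. (y, t)", OF _ schwartz_has_derivative[OF \<phi>]])
         (auto intro!: derivative_eq_intros)
    then show ?thesis
      unfolding f_def f'_def by (auto intro!: derivative_eq_intros)
  qed
  have b1: "norm (\<phi> (y, t)) \<le> K / (1 + norm t) ^ ?D" for t
    using order_trans[OF K(2) sec[OF K(1)]] .
  have b2: "norm (?\<psi> (y, t)) \<le> L / (1 + norm t) ^ ?D" for t
    using order_trans[OF L(2) sec[OF L(1)]] .
  have m1: "(\<lambda>t. \<phi> (y, t)) \<in> borel_measurable borel" "(\<lambda>t. ?\<psi> (y, t)) \<in> borel_measurable borel"
    using borel_measurable_schwartz[OF \<phi>] borel_measurable_schwartz[OF \<psi>] by (auto intro: measurable_compose[rotated])
  have mc: "(\<lambda>t. cis (- (\<tau> \<bullet> t))) \<in> borel_measurable borel"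
    by (intro borel_measurable_continuous_onI continuous_intros)
  have i1: "integrable lborel (\<lambda>t. cis (- (\<tau> \<bullet> t)) * \<phi> (y, t))"
    by (rule integrable_of_decay[where K = K]) (use b1 m1 mc in \<open>auto simp: norm_mult intro: borel_measurable_times\<close>)
  have i2: "integrable lborel (\<lambda>t. cis (- (\<tau> \<bullet> t)) * ?\<psi> (y, t))"
    by (rule integrable_of_decay[where K = L]) (use b2 m1 mc in \<open>auto simp: norm_mult intro: borel_measurable_times\<close>)
  have f'b: "f' t ?b = cis (- (\<tau> \<bullet> t)) * ?\<psi> (y, t) - \<i> * of_real (\<tau> $ i) * (cis (- (\<tau> \<bullet> t)) * \<phi> (y, t))" for t
    by (simp add: f'_def inner_axis scaleR_conv_of_real)
  \<comment> \<open>The vanishing lemma takes one constant for the function and its derivative, so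
    the two bounds are added.\<close>
  let ?M = "K + (L + \<bar>\<tau> $ i\<bar> * K)"
  have "(LINT t|lborel. f' t ?b) = 0"
  proof (rule integral_directional_derivative_eq_0[OF der])
    fix t
    have nn: "0 \<le> \<bar>\<tau> $ i\<bar> * K" using K(1) by simp
    have "norm (f t) \<le> K / (1 + norm t) ^ ?D"
      using b1[of t] by (simp add: f_def norm_mult)
    also have "\<dots> \<le> ?M / (1 + norm t) ^ ?D"
      using L(1) nn by (intro divide_right_mono) auto
    finally show "norm (f t) \<le> ?M / (1 + norm t) ^ ?D" .
    have "norm (f' t ?b) \<le> norm (?\<psi> (y, t)) + \<bar>\<tau> $ i\<bar> * norm (\<phi> (y, t))"
      unfolding f'b by (rule order_trans[OF norm_triangle_ineq4]) (simp add: norm_mult)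
    also have "\<dots> \<le> L / (1 + norm t) ^ ?D + \<bar>\<tau> $ i\<bar> * (K / (1 + norm t) ^ ?D)"
      by (intro add_mono mult_left_mono b1 b2) auto
    also have "\<dots> = (L + \<bar>\<tau> $ i\<bar> * K) / (1 + norm t) ^ ?D"
      by (simp add: add_divide_distrib)
    also have "\<dots> \<le> ?M / (1 + norm t) ^ ?D"
      using K(1) by (intro divide_right_mono) auto
    finally show "norm (f' t ?b) \<le> ?M / (1 + norm t) ^ ?D" .
  qed
  then show ?thesis
    unfolding f'b partial_fourier_def using i1 i2 by simp
qed

text \<open>Each factor \<open>\<tau> $ i\<close> is traded for a derivative in \<open>t\<close>,
  which is again Schwartz; hence the induction with arbitrary \<open>\<phi>\<close>. In the base
  case the majorant depends on \<open>t\<close> alone, which makes the bound uniform in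
  \<open>y\<close>.\<close>

lemma partial_fourier_coordinate_bound:
  fixes \<phi> :: "(real ^ 'd) \<times> (real ^ 'r) \<Rightarrow> complex"
  assumes "\<phi> \<in> schwartz"
  shows "\<exists>K. \<forall>y \<tau>. \<bar>\<tau> $ i\<bar> ^ N * norm (partial_fourier \<phi> y \<tau>) \<le> K"
  using assms
proof (induction N arbitrary: \<phi>)
  case 0
  let ?D = "DIM(real ^ 'r) + 1"
  obtain K where K: "0 \<le> K" "\<And>p. norm (\<phi> p) \<le> K / (1 + norm p) ^ ?D" using schwartz_decay[OF 0] by blast
  have "norm (partial_fourier \<phi> y \<tau>) \<le> (LINT t|lborel. K * (1 / (1 + norm (t :: real ^ 'r)) ^ ?D))" for y \<tau>
    unfolding partial_fourier_def
  proof (rule order_trans[OF Bochner_Integration.integral_norm_bound], rule Bochner_Integration.integral_mono)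
    have mc: "(\<lambda>t. cis (- (\<tau> \<bullet> t))) \<in> borel_measurable borel"
      by (intro borel_measurable_continuous_onI continuous_intros)
    have m1: "(\<lambda>t. \<phi> (y, t)) \<in> borel_measurable borel"
      using borel_measurable_schwartz[OF 0] by (auto intro: measurable_compose[rotated])
    have b: "norm (cis (- (\<tau> \<bullet> t)) * \<phi> (y, t)) \<le> K * (1 / (1 + norm t) ^ ?D)" for t
    proof -
      have "norm (\<phi> (y, t)) \<le> K / (1 + norm (y, t)) ^ ?D" by (rule K)
      also have "\<dots> \<le> K / (1 + norm t) ^ ?D"
        using K(1) by (intro divide_left_mono power_mono add_left_mono mult_pos_pos zero_less_power)
          (auto intro: add_pos_nonneg simp: norm_Pair)
      finally show ?thesis by (simp add: norm_mult)
    qed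
    have "integrable lborel (\<lambda>t. cis (- (\<tau> \<bullet> t)) * \<phi> (y, t))"
      by (rule integrable_of_decay[where K = K]) (use b m1 mc in \<open>auto intro: borel_measurable_times\<close>)
    then show "integrable lborel (\<lambda>t. norm (cis (- (\<tau> \<bullet> t)) * \<phi> (y, t)))"
      by (rule integrable_norm)
    show "integrable lborel (\<lambda>t. K * (1 / (1 + norm (t :: real ^ 'r)) ^ ?D))"
      by (rule integrable_mult_right) (rule integrable_inverse_power_norm)
    show "norm (cis (- (\<tau> \<bullet> t)) * \<phi> (y, t)) \<le> K * (1 / (1 + norm t) ^ ?D)" for t
      by (rule b)
  qed
  then show ?case by auto
next
  case (Suc N)
  have "(\<lambda>p. frechet_derivative \<phi> (at p) (0, axis i 1)) \<in> schwartz"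
    by (rule schwartz_partial[OF Suc.prems]) (auto simp: Basis_prod_def axis_in_Basis_iff)
  from Suc.IH[OF this] show ?case
    by (simp add: partial_fourier_partial[OF Suc.prems] norm_mult mult.assoc mult.left_commute)
qed

lemma partial_fourier_decay:
  fixes \<phi> :: "(real ^ 'd) \<times> (real ^ 'r) \<Rightarrow> complex"
  assumes \<phi>: "\<phi> \<in> schwartz"
  obtains K where "0 \<le> K" "\<And>y \<tau>. norm (partial_fourier \<phi> y \<tau>) \<le> K / (1 + norm \<tau>) ^ N"
proof -
  obtain K0 where K0: "\<And>y \<tau>. norm (partial_fourier \<phi> y \<tau>) \<le> K0"
    using partial_fourier_coordinate_bound[OF \<phi>, of _ 0] by auto
  have "\<forall>i. \<exists>K. \<forall>y \<tau>. \<bar>\<tau> $ i\<bar> ^ N * norm (partial_fourier \<phi> y \<tau>) \<le> K"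
    using partial_fourier_coordinate_bound[OF \<phi>] by blast
  then obtain K where K: "\<And>i y \<tau>. \<bar>\<tau> $ i\<bar> ^ N * norm (partial_fourier \<phi> y \<tau>) \<le> K i" by metis
  define R where "R = real (CARD('r))"
  define L where "L = (1 + R) ^ N * (K0 + (\<Sum>i\<in>UNIV. K i))"
  have le: "(1 + norm \<tau>) ^ N * norm (partial_fourier \<phi> y \<tau>) \<le> L" for y \<tau>
  proof -
    \<comment> \<open>Including 1 in the maximum absorbs the summand 1 of
      \<open>1 + norm \<tau>\<close>; afterwards \<open>M ^ N\<close> is either 1 or one of the
      powers that are already controlled.\<close>
    define M where "M = Max (insert 1 (range (\<lambda>i. \<bar>\<tau> $ i\<bar>)))"
    have M1: "1 \<le> M" unfolding M_def by (intro Max_ge) auto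
    have Mi: "\<bar>\<tau> $ i\<bar> \<le> M" for i unfolding M_def by (intro Max_ge) auto
    have "norm \<tau> \<le> (\<Sum>i\<in>UNIV. \<bar>\<tau> $ i\<bar>)" by (rule norm_le_l1_cart)
    also have "\<dots> \<le> (\<Sum>i\<in>(UNIV :: 'r set). M)" by (intro sum_mono Mi)
    finally have "1 + norm \<tau> \<le> (1 + R) * M" using M1 by (simp add: R_def algebra_simps)
    then have "(1 + norm \<tau>) ^ N \<le> (1 + R) ^ N * M ^ N"
      by (subst power_mult_distrib[symmetric]) (intro power_mono, auto)
    also have "M ^ N \<le> 1 + (\<Sum>i\<in>UNIV. \<bar>\<tau> $ i\<bar> ^ N)"
    proof -
      have "M \<in> insert 1 (range (\<lambda>i. \<bar>\<tau> $ i\<bar>))" unfolding M_def by (intro Max_in) auto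
      then consider "M = 1" | i where "M = \<bar>\<tau> $ i\<bar>" by auto
      then show ?thesis
      proof cases
        case 2
        have "\<bar>\<tau> $ i\<bar> ^ N \<le> (\<Sum>i\<in>UNIV. \<bar>\<tau> $ i\<bar> ^ N)" by (rule member_le_sum) auto
        then show ?thesis using 2 by simp
      qed (simp add: sum_nonneg)
    qed
    finally have "(1 + norm \<tau>) ^ N \<le> (1 + R) ^ N * (1 + (\<Sum>i\<in>UNIV. \<bar>\<tau> $ i\<bar> ^ N))"
      by (simp add: mult_left_mono R_def)
    then have "(1 + norm \<tau>) ^ N * norm (partial_fourier \<phi> y \<tau>)
        \<le> (1 + R) ^ N * (1 + (\<Sum>i\<in>UNIV. \<bar>\<tau> $ i\<bar> ^ N)) * norm (partial_fourier \<phi> y \<tau>)"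
      by (intro mult_right_mono) auto
    also have "\<dots> = (1 + R) ^ N * (norm (partial_fourier \<phi> y \<tau>)
        + (\<Sum>i\<in>UNIV. \<bar>\<tau> $ i\<bar> ^ N * norm (partial_fourier \<phi> y \<tau>)))"
      by (simp add: algebra_simps sum_distrib_left)
    also have "\<dots> \<le> L"
      unfolding L_def by (intro mult_left_mono add_mono sum_mono K K0) (auto simp: R_def)
    finally show ?thesis .
  qed
  show ?thesis
  proof
    show "0 \<le> L" by (rule order_trans[OF _ le[of 0 0]]) simp
    show "norm (partial_fourier \<phi> y \<tau>) \<le> L / (1 + norm \<tau>) ^ N" for y \<tau>
      using le[of \<tau> y] by (simp add: field_simps add_pos_nonneg)
  qed
qed

subsection \<open>Sums of products of Laguerre polynomials\<close>

text \<open>The Cauchy product formula for finitely many factors, by splitting off one factor at a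
  time. The exponents are extensional functions, in the form used by
  \<open>multi_indices\<close>.\<close>

lemma fps_nth_prod_multi_index:
  fixes F :: "'a \<Rightarrow> 'b :: comm_ring_1 fps"
  assumes "finite A"
  shows "fps_nth (\<Prod>a\<in>A. F a) m = (\<Sum>k | k \<in> A \<rightarrow>\<^sub>E UNIV \<and> sum k A = m. \<Prod>a\<in>A. fps_nth (F a) (k a))"
  using assms
proof (induction A arbitrary: m)
  case empty
  have "{k. k \<in> {} \<rightarrow>\<^sub>E (UNIV :: nat set) \<and> sum k {} = m} = (if m = 0 then {\<lambda>_ :: 'a. undefined} else {})"
    by auto
  then show ?case by simp
next
  case (insert x A)
  let ?I = "\<lambda>A m. {k. k \<in> A \<rightarrow>\<^sub>E (UNIV :: nat set) \<and> sum k A = m}"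
  have fin: "finite (?I A l)" for l
  proof (rule finite_subset)
    show "?I A l \<subseteq> A \<rightarrow>\<^sub>E {..l}"
      using insert.hyps(1) by (auto simp: PiE_iff extensional_def intro: member_le_sum)
  qed (simp add: finite_PiE insert.hyps)
  have "fps_nth (\<Prod>a\<in>insert x A. F a) m = (\<Sum>i\<in>{0..m}. \<Sum>k\<in>?I A (m - i). fps_nth (F x) i * (\<Prod>a\<in>A. fps_nth (F a) (k a)))"
    using insert by (simp add: fps_mult_nth sum_distrib_left)
  also have "\<dots> = (\<Sum>(i, k)\<in>Sigma {0..m} (\<lambda>i. ?I A (m - i)). fps_nth (F x) i * (\<Prod>a\<in>A. fps_nth (F a) (k a)))"
    by (intro sum.Sigma) (use fin in auto)
  also have "\<dots> = (\<Sum>k\<in>?I (insert x A) m. \<Prod>a\<in>insert x A. fps_nth (F a) (k a))"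
  \<comment> \<open>The inverse map resets the value at \<open>x\<close> to
    \<open>undefined\<close>, since members of \<open>A \<rightarrow>\<^sub>E UNIV\<close> take that
    value outside \<open>A\<close>.\<close>
  proof (rule sum.reindex_bij_witness[where j = "\<lambda>(i, k). k(x := i)" and i = "\<lambda>k. (k x, k(x := undefined))"])
    fix p assume p: "p \<in> Sigma {0..m} (\<lambda>i. ?I A (m - i))"
    obtain i k where [simp]: "p = (i, k)" by fastforce
    have k: "k \<in> A \<rightarrow>\<^sub>E UNIV" "sum k A = m - i" "i \<le> m" using p by auto
    have *: "(k(x := i)) a = k a" if "a \<in> A" for a using that insert.hyps by auto
    have s: "sum (k(x := i)) A = sum k A" by (intro sum.cong refl *)
    show "(\<lambda>k. (k x, k(x := undefined))) ((\<lambda>(i, k). k(x := i)) p) = p"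
      using k insert.hyps by (auto simp: PiE_iff extensional_def)
    show "(\<lambda>(i, k). k(x := i)) p \<in> ?I (insert x A) m"
      using k insert.hyps s by (auto simp: PiE_iff extensional_def)
    have "(\<Prod>a\<in>A. fps_nth (F a) ((k(x := i)) a)) = (\<Prod>a\<in>A. fps_nth (F a) (k a))"
      by (intro prod.cong refl arg_cong2[where f = fps_nth] *)
    then show "(\<Prod>a\<in>insert x A. fps_nth (F a) ((\<lambda>(i, k). k(x := i)) p a)) =
        (case p of (i, k) \<Rightarrow> fps_nth (F x) i * (\<Prod>a\<in>A. fps_nth (F a) (k a)))"
      using insert.hyps by simp
  next
    fix k assume k: "k \<in> ?I (insert x A) m"
    have s: "sum (k(x := undefined)) A = sum k A" using insert.hyps by (intro sum.cong) auto
    show "(\<lambda>(i, k). k(x := i)) ((\<lambda>k. (k x, k(x := undefined))) k) = k" by auto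
    show "(k x, k(x := undefined)) \<in> Sigma {0..m} (\<lambda>i. ?I A (m - i))"
      using k insert.hyps s by (auto simp: PiE_iff extensional_def)
  qed
  finally show ?case .
qed

abbreviation fps_geometric :: "real fps" where
  "fps_geometric \<equiv> inverse (1 - fps_X)"

text \<open>One more factor \<open>fps_geometric\<close> replaces the coefficients by their partial
  sums, and the hockey-stick identity evaluates these.\<close>

lemma fps_nth_geometric_power:
  "fps_nth (fps_geometric ^ Suc i) j = real ((i + j) choose j)"
proof (induction i arbitrary: j)
  case 0
  show ?case by (simp add: fps_inverse_one_minus_fps_X)
next
  case (Suc i)
  have "fps_nth (fps_geometric ^ Suc (Suc i)) j = fps_nth (fps_geometric ^ Suc i * fps_geometric) j"
    by (simp add: mult.commute)
  also have "\<dots> = (\<Sum>l\<le>j. real ((i + l) choose l))"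
    unfolding fps_mult_nth Suc.IH by (simp add: fps_inverse_one_minus_fps_X atLeast0AtMost)
  also have "\<dots> = real ((Suc i + j) choose j)"
    by (simp add: sum_choose_lower flip: of_nat_sum)
  finally show ?case .
qed

text \<open>As \<open>b\<close> has no constant term, \<open>b ^ i\<close> has no coefficients below
  degree \<open>i\<close>. The inner sum of the composition can therefore run up to \<open>k\<close>
  for every degree, after which the two sums may be exchanged.\<close>

lemma fps_nth_mult_compose:
  fixes a b c :: "real fps"
  assumes "fps_nth b 0 = 0"
  shows "fps_nth (c * (a oo b)) k = (\<Sum>i\<le>k. fps_nth a i * fps_nth (c * b ^ i) k)"
proof -
  have "fps_nth (c * (a oo b)) k = (\<Sum>l\<le>k. fps_nth c (k - l) * (\<Sum>i=0..l. fps_nth a i * fps_nth (b ^ i) l))"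
    unfolding mult.commute[of c "a oo b"] fps_mult_nth fps_compose_nth atLeast0AtMost
    by (intro sum.cong refl mult.commute)
  also have "\<dots> = (\<Sum>l\<le>k. fps_nth c (k - l) * (\<Sum>i\<le>k. fps_nth a i * fps_nth (b ^ i) l))"
    using startsby_zero_power_prefix[OF assms]
    by (intro sum.cong refl arg_cong2[where f = "(*)"] sum.mono_neutral_left) auto
  also have "\<dots> = (\<Sum>i\<le>k. fps_nth a i * fps_nth (b ^ i * c) k)"
    unfolding sum_distrib_left fps_mult_nth atLeast0AtMost by (subst sum.swap) (simp only: mult_ac)
  finally show ?thesis by (simp add: mult.commute)
qed

text \<open>The classical generating function \<open>exp (- x z / (1 - z)) / (1 - z)\<close>. Its
  expansion in powers of \<open>- x\<close> leads to the series
  \<open>z ^ i / (1 - z) ^ (i + 1)\<close>, whose coefficients are binomial.\<close>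

lemma laguerre_generating_function:
  "fps_nth (fps_geometric * (fps_exp (- x) oo (fps_X * fps_geometric))) k = laguerre 0 k x"
proof -
  have "fps_nth (fps_geometric * (fps_X * fps_geometric) ^ i) k = real (k choose (k - i))" if "i \<le> k" for i
  proof -
    have "fps_geometric * (fps_X * fps_geometric) ^ i = fps_X ^ i * fps_geometric ^ Suc i"
      by (simp add: power_mult_distrib)
    then show ?thesis
      using that by (simp only: fps_X_power_mult_nth fps_nth_geometric_power) simp
  qed
  then show ?thesis
    unfolding laguerre_def
    by (subst fps_nth_mult_compose)
       (auto intro!: sum.cong simp: binomial_gbinomial[symmetric] power_minus[of x] field_simps)
qed

text \<open>For positive \<open>n\<close> this is the generalized Laguerre polynomial of degree
  \<open>m\<close> with parameter \<open>n - 1\<close>, given by its generating function.\<close>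

definition laguerre_sum :: "nat \<Rightarrow> nat \<Rightarrow> real \<Rightarrow> real" where
  "laguerre_sum n m s = fps_nth (fps_geometric ^ n * (fps_exp (- s) oo (fps_X * fps_geometric))) m"

text \<open>In the product of the generating functions the exponents add up, so only the sum of the
  arguments survives; the claim compares the coefficients of degree \<open>m\<close>.\<close>

lemma sum_multi_indices_laguerre:
  "(\<Sum>k\<in>multi_indices n m. \<Prod>j=1..n. laguerre 0 (k j) (x j)) = laguerre_sum n m (\<Sum>j=1..n. x j)"
proof -
  let ?b = "fps_X * fps_geometric"
  have "(\<Prod>j\<in>A. fps_geometric * (fps_exp (- x j) oo ?b)) = fps_geometric ^ card A * (fps_exp (- sum x A) oo ?b)"
    if "finite A" for A
    using that
  proof (induction A)
    case (insert a A)
    have "fps_exp (- sum x (insert a A)) = fps_exp (- x a) * fps_exp (- sum x A)"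
      using insert.hyps by (simp flip: fps_exp_add_mult)
    then show ?case
      using insert by (simp add: fps_compose_mult_distrib mult_ac)
  qed (simp add: fps_eq_iff fps_compose_nth)
  from this[of "{1..n}"] have "laguerre_sum n m (\<Sum>j=1..n. x j)
      = fps_nth (\<Prod>j=1..n. fps_geometric * (fps_exp (- x j) oo ?b)) m"
    by (simp add: laguerre_sum_def)
  also have "\<dots> = (\<Sum>k\<in>multi_indices n m. \<Prod>j=1..n. laguerre 0 (k j) (x j))"
    by (simp only: fps_nth_prod_multi_index finite_atLeastAtMost multi_indices_def laguerre_generating_function)
  finally show ?thesis by simp
qed

lemma laguerre_sum_eq:
  "laguerre_sum n m s = (\<Sum>i\<le>m. (- s) ^ i / fact i * fps_nth (fps_geometric ^ n * (fps_X * fps_geometric) ^ i) m)"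
  unfolding laguerre_sum_def by (subst fps_nth_mult_compose) auto

lemma continuous_on_laguerre_sum: "continuous_on A (laguerre_sum n m)"
  unfolding laguerre_sum_eq by (intro continuous_intros) auto

text \<open>The rate \<open>1/4\<close> is chosen for the later argument \<open>s = 2 * S\<close>:
  the polynomial then costs at most \<open>exp (S / 2)\<close>, half of what the factor
  \<open>exp (- S)\<close> provides.\<close>

lemma laguerre_sum_bound:
  obtains K where "0 \<le> K" "\<And>s. 0 \<le> s \<Longrightarrow> \<bar>laguerre_sum n m s\<bar> \<le> K * exp (s / 4)"
proof -
  let ?c = "\<lambda>i. fps_nth (fps_geometric ^ n * (fps_X * fps_geometric) ^ i) m"
  let ?K = "\<Sum>i\<le>m. 4 ^ i * \<bar>?c i\<bar>"
  have "\<bar>laguerre_sum n m s\<bar> \<le> ?K * exp (s / 4)" if s: "0 \<le> s" for s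
  proof -
    have "\<bar>laguerre_sum n m s\<bar> \<le> (\<Sum>i\<le>m. \<bar>(- s) ^ i / fact i * ?c i\<bar>)"
      unfolding laguerre_sum_eq by (rule sum_abs)
    also have "\<dots> = (\<Sum>i\<le>m. 4 ^ i * ((s / 4) ^ i / fact i) * \<bar>?c i\<bar>)"
      using s by (intro sum.cong refl) (simp add: abs_mult power_abs power_divide)
    also have "\<dots> \<le> (\<Sum>i\<le>m. 4 ^ i * exp (s / 4) * \<bar>?c i\<bar>)"
      using s by (intro sum_mono mult_right_mono mult_left_mono power_over_fact_le_exp) auto
    finally show ?thesis by (simp add: sum_distrib_left sum_distrib_right mult_ac)
  qed
  then show ?thesis by (intro that[of ?K]) (auto intro: sum_nonneg)
qed

subsection \<open>The skew-symmetric matrices in adapted coordinates\<close>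

lemma sum_pairs: "(\<Sum>k=1..2*n. f k) = (\<Sum>j=1..n. f (2 * j - 1) + f (2 * j))" for f :: "nat \<Rightarrow> 'a :: comm_monoid_add"
proof (induction n)
  case (Suc n)
  have "{1..2 * Suc n} = insert (2 * n + 2) (insert (2 * n + 1) {1..2 * n})" by auto
  then show ?case using Suc by (simp add: ac_simps)
qed simp

lemma continuous_on_Bmat: "continuous_on A (Bmat B)"
  unfolding Bmat_def by (intro continuous_intros)

lemma Bmat_scaleR: "Bmat B (s *\<^sub>R \<tau>) = s *\<^sub>R Bmat B \<tau>"
  by (simp add: Bmat_def vec_eq_iff sum_distrib_left mult.assoc)

lemma continuous_on_matrix_vector_mult_pair:
  fixes f :: "'a :: topological_space \<Rightarrow> real ^ 'n ^ 'm"
  assumes "continuous_on A f" "continuous_on A g"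
  shows "continuous_on A (\<lambda>x. f x *v g x)"
  unfolding matrix_vector_mult_def using assms by (intro continuous_intros)

lemma power_matrix_vector_mult_continuous:
  "continuous_on A (\<lambda>p :: (real ^ 'd) \<times> (real ^ 'r). (((*v) (Bmat B (snd p))) ^^ i) (fst p))"
proof (induction i)
  case (Suc i)
  then show ?case
    by (auto intro!: continuous_on_matrix_vector_mult_pair continuous_on_compose2[OF continuous_on_Bmat] continuous_intros)
qed (auto intro: continuous_intros)

lemma sets_borel_snd_eq_0:
  "{p :: 'a :: euclidean_space \<times> 'b :: euclidean_space. snd p = 0} \<in> sets borel"
  by (intro borel_closed closed_Collect_eq continuous_intros)

locale nondegenerate_group =
  fixes B :: "real ^ 'd \<Rightarrow> real ^ 'd \<Rightarrow> real ^ 'r"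
    and n :: nat
    and \<mu> :: "real ^ 'r \<Rightarrow> nat \<Rightarrow> real"
    and v :: "real ^ 'r \<Rightarrow> nat \<Rightarrow> real ^ 'd"
  assumes card: "CARD('d) = 2 * n"
    and nondeg: "nondegenerate B"
    and eigen: "eigenvalue_family B n \<mu>"
    and adapted: "adapted_basis B n \<mu> v"
begin

lemma n_pos: "1 \<le> n"
  using card zero_less_card_finite[where 'a = 'd] by linarith

lemma orthonormal:
  "\<tau> \<noteq> 0 \<Longrightarrow> k \<in> {1..2*n} \<Longrightarrow> l \<in> {1..2*n} \<Longrightarrow> v \<tau> k \<bullet> v \<tau> l = (if k = l then 1 else 0)"
  using adapted unfolding adapted_basis_def by blast

lemma block:
  "\<tau> \<noteq> 0 \<Longrightarrow> k \<in> {1..2*n} \<Longrightarrow> l \<in> {1..2*n} \<Longrightarrow> v \<tau> k \<bullet> (Bmat B \<tau> *v v \<tau> l) = block_entry (\<mu> \<tau>) k l"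
  using adapted unfolding adapted_basis_def by blast

lemma mu_pos: "\<tau> \<noteq> 0 \<Longrightarrow> j \<in> {1..n} \<Longrightarrow> 0 < \<mu> \<tau> j"
  using eigen unfolding eigenvalue_family_def by blast

text \<open>Orthonormal vectors are independent, and here their number equals the dimension, so they
  span the space.\<close>

lemma expand:
  assumes "\<tau> \<noteq> 0"
  shows "(\<Sum>k=1..2*n. (y \<bullet> v \<tau> k) *\<^sub>R v \<tau> k) = y"
proof -
  let ?V = "v \<tau> ` {1..2*n}"
  have inj: "inj_on (v \<tau>) {1..2*n}"
    by (rule inj_onI) (metis assms orthonormal zero_neq_one)
  have orth: "pairwise orthogonal ?V"
    unfolding pairwise_def orthogonal_def using orthonormal[OF assms] by force
  have nz: "0 \<notin> ?V"
    using orthonormal[OF assms] by force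
  have ind: "independent ?V" by (rule pairwise_orthogonal_independent[OF orth nz])
  have "card ?V = 2 * n" using inj by (simp add: card_image)
  then have "UNIV \<subseteq> span ?V"
    using ind card by (intro card_ge_dim_independent) auto
  then have "y \<in> span ?V" by blast
  then obtain u where u: "y = (\<Sum>w\<in>?V. u w *\<^sub>R w)"
    by (auto simp: span_finite)
  then have y: "y = (\<Sum>k=1..2*n. u (v \<tau> k) *\<^sub>R v \<tau> k)"
    using inj by (simp add: sum.reindex)
  have "y \<bullet> v \<tau> k = u (v \<tau> k)" if k: "k \<in> {1..2*n}" for k
  proof -
    have "y \<bullet> v \<tau> k = (\<Sum>l=1..2*n. u (v \<tau> l) * (v \<tau> l \<bullet> v \<tau> k))"
      by (subst y) (simp add: inner_sum_left)
    also have "\<dots> = (\<Sum>l=1..2*n. if l = k then u (v \<tau> k) else 0)"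
      using orthonormal[OF assms _ k] by (intro sum.cong) auto
    finally show ?thesis using k by simp
  qed
  then show ?thesis by (subst (2) y) (intro sum.cong; simp)
qed

lemma norm_sq_eq_sum_pair_norm_sq:
  assumes "\<tau> \<noteq> 0"
  shows "(norm y)\<^sup>2 = (\<Sum>j=1..n. pair_norm_sq (v \<tau>) j y)"
proof -
  have "(norm y)\<^sup>2 = y \<bullet> (\<Sum>k=1..2*n. (y \<bullet> v \<tau> k) *\<^sub>R v \<tau> k)"
    by (simp only: expand[OF assms] power2_norm_eq_inner)
  also have "\<dots> = (\<Sum>k=1..2*n. (y \<bullet> v \<tau> k)\<^sup>2)"
    by (simp add: inner_sum_right power2_eq_square)
  finally show ?thesis by (simp only: sum_pairs pair_norm_sq_def)
qed

lemma coordinate_Bmat: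
  assumes "\<tau> \<noteq> 0" "k \<in> {1..2*n}"
  shows "(Bmat B \<tau> *v y) \<bullet> v \<tau> k = (\<Sum>l=1..2*n. (y \<bullet> v \<tau> l) * block_entry (\<mu> \<tau>) k l)"
proof -
  have "(Bmat B \<tau> *v y) \<bullet> v \<tau> k = v \<tau> k \<bullet> (Bmat B \<tau> *v (\<Sum>l=1..2*n. (y \<bullet> v \<tau> l) *\<^sub>R v \<tau> l))"
    by (simp only: expand[OF assms(1)] inner_commute)
  also have "\<dots> = (\<Sum>l=1..2*n. (y \<bullet> v \<tau> l) * (v \<tau> k \<bullet> (Bmat B \<tau> *v v \<tau> l)))"
    by (simp add: linear_sum[OF matrix_vector_mul_linear] linear_cmul[OF matrix_vector_mul_linear] inner_sum_right)
  finally show ?thesis using block[OF assms] by simp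
qed

text \<open>On the \<open>j\<close>-th coordinate plane \<open>Bmat B \<tau>\<close> acts as a
  rotation by a right angle followed by multiplication with \<open>\<mu> \<tau> j\<close>.\<close>

lemma pair_norm_sq_Bmat:
  assumes \<tau>: "\<tau> \<noteq> 0" and j: "j \<in> {1..n}"
  shows "pair_norm_sq (v \<tau>) j (Bmat B \<tau> *v y) = (\<mu> \<tau> j)\<^sup>2 * pair_norm_sq (v \<tau>) j y"
proof -
  have k: "2 * j - 1 \<in> {1..2*n}" "2 * j \<in> {1..2*n}" using j by auto
  \<comment> \<open>Writing \<open>j\<close> as a successor removes the truncated subtraction in
    \<open>2 * j - 1\<close>, so that the parity conditions in \<open>block_entry\<close> can be
    decided.\<close>
  obtain i where i: "j = Suc i" using j by (cases j) auto
  have "(Bmat B \<tau> *v y) \<bullet> v \<tau> (2 * j - 1) = (\<Sum>l=1..2*n. if l = 2 * j then - \<mu> \<tau> j * (y \<bullet> v \<tau> (2 * j)) else 0)"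
    unfolding coordinate_Bmat[OF \<tau> k(1)]
    by (intro sum.cong refl) (auto simp: block_entry_def i)
  then have 1: "(Bmat B \<tau> *v y) \<bullet> v \<tau> (2 * j - 1) = - \<mu> \<tau> j * (y \<bullet> v \<tau> (2 * j))" using k by simp
  have "(Bmat B \<tau> *v y) \<bullet> v \<tau> (2 * j) = (\<Sum>l=1..2*n. if l = 2 * j - 1 then \<mu> \<tau> j * (y \<bullet> v \<tau> (2 * j - 1)) else 0)"
    unfolding coordinate_Bmat[OF \<tau> k(2)]
    by (intro sum.cong refl) (auto simp: block_entry_def i)
  then have 2: "(Bmat B \<tau> *v y) \<bullet> v \<tau> (2 * j) = \<mu> \<tau> j * (y \<bullet> v \<tau> (2 * j - 1))" using k by simp
  show ?thesis
    unfolding pair_norm_sq_def 1 2 by (simp add: power_mult_distrib algebra_simps)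
qed

lemma norm_sq_Bmat_power:
  assumes \<tau>: "\<tau> \<noteq> 0"
  shows "(norm ((((*v) (Bmat B \<tau>)) ^^ i) y))\<^sup>2 = (\<Sum>j=1..n. ((\<mu> \<tau> j)\<^sup>2) ^ i * pair_norm_sq (v \<tau>) j y)"
proof -
  have "pair_norm_sq (v \<tau>) j ((((*v) (Bmat B \<tau>)) ^^ i) y) = ((\<mu> \<tau> j)\<^sup>2) ^ i * pair_norm_sq (v \<tau>) j y"
    if "j \<in> {1..n}" for j
    by (induction i) (simp_all add: pair_norm_sq_Bmat[OF \<tau> that])
  then show ?thesis
    unfolding norm_sq_eq_sum_pair_norm_sq[OF \<tau>] by (intro sum.cong) auto
qed

text \<open>This recovers an eigenvalue from \<open>B\<close> itself, as the length of the image of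
  a unit vector. Size and homogeneity of \<open>\<mu>\<close> are read off from it.\<close>

lemma norm_Bmat_basis:
  assumes \<tau>: "\<tau> \<noteq> 0" and j: "j \<in> {1..n}"
  shows "norm (Bmat B \<tau> *v v \<tau> (2 * j)) = \<mu> \<tau> j" "norm (v \<tau> (2 * j)) = 1"
proof -
  have k: "2 * j \<in> {1..2*n}" using j by auto
  have p: "pair_norm_sq (v \<tau>) i (v \<tau> (2 * j)) = (if i = j then 1 else 0)" if "i \<in> {1..n}" for i
  proof -
    have "2 * i - 1 \<in> {1..2*n}" "2 * i \<in> {1..2*n}" "2 * j \<noteq> 2 * i - 1" using that by auto presburger
    then show ?thesis
      unfolding pair_norm_sq_def using orthonormal[OF \<tau> k] by auto
  qed
  have "(norm (Bmat B \<tau> *v v \<tau> (2 * j)))\<^sup>2 = (\<Sum>i=1..n. (\<mu> \<tau> i)\<^sup>2 * (if i = j then 1 else 0))"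
    using norm_sq_Bmat_power[OF \<tau>, of 1 "v \<tau> (2 * j)"] p by simp
  also have "\<dots> = (\<mu> \<tau> j)\<^sup>2" using j by (simp add: if_distrib cong: if_cong)
  finally show "norm (Bmat B \<tau> *v v \<tau> (2 * j)) = \<mu> \<tau> j"
    using mu_pos[OF \<tau> j] by (simp add: power2_eq_iff_nonneg)
  have "v \<tau> (2 * j) \<bullet> v \<tau> (2 * j) = 1" using orthonormal[OF \<tau> k k] by simp
  then show "norm (v \<tau> (2 * j)) = 1" by (simp add: norm_eq_sqrt_inner)
qed

text \<open>The quotient \<open>\<mu> \<tau> j / norm \<tau>\<close> is a value of the continuous
  function \<open>norm (Bmat B \<tau> *v y)\<close> on a product of two unit spheres. By compactness
  this function attains its bounds, and non-degeneracy makes the minimum positive.\<close>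

lemma mu_bounds:
  obtains c C where "0 < c" "0 < C" "\<And>\<tau> j. \<tau> \<noteq> 0 \<Longrightarrow> j \<in> {1..n} \<Longrightarrow> c * norm \<tau> \<le> \<mu> \<tau> j \<and> \<mu> \<tau> j \<le> C * norm \<tau>"
proof -
  let ?S = "sphere (0 :: real ^ 'd) 1 \<times> sphere (0 :: real ^ 'r) 1"
  let ?f = "\<lambda>p. norm (Bmat B (snd p) *v fst p)"
  have comp: "compact ?S" by (intro compact_Times) auto
  have ne: "?S \<noteq> {}" by simp
  have cont: "continuous_on ?S ?f"
    by (intro continuous_on_norm continuous_on_matrix_vector_mult_pair continuous_on_compose2[OF continuous_on_Bmat] continuous_intros) auto
  obtain p where p: "p \<in> ?S" "\<And>q. q \<in> ?S \<Longrightarrow> ?f p \<le> ?f q"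
    using continuous_attains_inf[OF comp ne cont] by blast
  obtain q where q: "q \<in> ?S" "\<And>q'. q' \<in> ?S \<Longrightarrow> ?f q' \<le> ?f q"
    using continuous_attains_sup[OF comp ne cont] by blast
  have "snd p \<noteq> 0" "fst p \<noteq> 0" using p(1) by auto
  then have "invertible (Bmat B (snd p))" using nondeg unfolding nondegenerate_def by blast
  then obtain A where A: "A ** Bmat B (snd p) = mat 1" unfolding invertible_def by blast
  have "A *v (Bmat B (snd p) *v fst p) = fst p"
    by (simp add: matrix_vector_mul_assoc A)
  then have "Bmat B (snd p) *v fst p \<noteq> 0"
    using \<open>fst p \<noteq> 0\<close> by auto
  then have pos: "0 < ?f p" by simp
  then have posq: "0 < ?f q" using q(2)[OF p(1)] by linarith
  show ?thesis
  proof (rule that[OF pos posq])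
    fix \<tau> :: "real ^ 'r" and j assume \<tau>: "\<tau> \<noteq> 0" and j: "j \<in> {1..n}"
    let ?q = "(v \<tau> (2 * j), \<tau> /\<^sub>R norm \<tau>)"
    have qS: "?q \<in> ?S" using \<tau> norm_Bmat_basis(2)[OF \<tau> j] by simp
    have eq: "?f ?q = \<mu> \<tau> j / norm \<tau>"
      using norm_Bmat_basis(1)[OF \<tau> j] by (simp add: Bmat_scaleR scaleR_matrix_vector_assoc[symmetric] divide_inverse mult.commute)
    have "?f p \<le> \<mu> \<tau> j / norm \<tau>" "\<mu> \<tau> j / norm \<tau> \<le> ?f q"
      using p(2)[OF qS] q(2)[OF qS] by (simp_all only: eq)
    then show "?f p * norm \<tau> \<le> \<mu> \<tau> j \<and> \<mu> \<tau> j \<le> ?f q * norm \<tau>"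
      using \<tau> by (simp add: field_simps)
  qed
qed

lemma v_scaleR: "0 < s \<Longrightarrow> \<tau> \<noteq> 0 \<Longrightarrow> k \<in> {1..2*n} \<Longrightarrow> v (s *\<^sub>R \<tau>) k = v \<tau> k"
proof -
  assume s: "0 < s" "\<tau> \<noteq> 0" "k \<in> {1..2*n}"
  have dir: "v \<tau>' k = v (\<tau>' /\<^sub>R norm \<tau>') k" if "\<tau>' \<noteq> 0" for \<tau>'
    using adapted s(3) that unfolding adapted_basis_def by blast
  have "s *\<^sub>R \<tau> \<noteq> 0" using s by simp
  note dir[OF this] dir[OF s(2)]
  moreover have "(s *\<^sub>R \<tau>) /\<^sub>R norm (s *\<^sub>R \<tau>) = \<tau> /\<^sub>R norm \<tau>"
    using s by simp
  ultimately show ?thesis by metis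
qed

lemma mu_scaleR:
  assumes s: "0 < s" and \<tau>: "\<tau> \<noteq> 0" and j: "j \<in> {1..n}"
  shows "\<mu> (s *\<^sub>R \<tau>) j = s * \<mu> \<tau> j"
proof -
  have k: "2 * j \<in> {1..2*n}" using j by auto
  have s\<tau>: "s *\<^sub>R \<tau> \<noteq> 0" using s \<tau> by simp
  have "\<mu> (s *\<^sub>R \<tau>) j = norm (Bmat B (s *\<^sub>R \<tau>) *v v (s *\<^sub>R \<tau>) (2 * j))"
    using norm_Bmat_basis(1)[OF s\<tau> j] by simp
  also have "\<dots> = s * norm (Bmat B \<tau> *v v \<tau> (2 * j))"
    using s v_scaleR[OF s \<tau> k] by (simp add: Bmat_scaleR scaleR_matrix_vector_assoc[symmetric])
  finally show ?thesis using norm_Bmat_basis(1)[OF \<tau> j] by simp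
qed

subsection \<open>The function \<open>Q\<^sub>m\<close>\<close>

text \<open>\<open>weighted_norm_sq\<close> and \<open>mu_prod\<close> are the quantities called
  \<open>S\<close> and \<open>D\<close> in the introductory text.\<close>

definition weighted_norm_sq :: "real ^ 'd \<Rightarrow> real ^ 'r \<Rightarrow> real" where
  "weighted_norm_sq y \<tau> = (\<Sum>j=1..n. \<mu> \<tau> j * pair_norm_sq (v \<tau>) j y)"

definition mu_prod :: "real ^ 'r \<Rightarrow> real" where
  "mu_prod \<tau> = (\<Prod>j=1..n. 2 * \<mu> \<tau> j / pi)"

lemma Qm_eq:
  "Qm n \<mu> v m y \<tau> = mu_prod \<tau> * laguerre_sum n m (2 * weighted_norm_sq y \<tau>) * exp (- weighted_norm_sq y \<tau>)"
proof -
  let ?p = "\<lambda>j. pair_norm_sq (v \<tau>) j y"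
  have "laguerre_fun n \<mu> v k y \<tau> = mu_prod \<tau> * exp (- weighted_norm_sq y \<tau>) * (\<Prod>j=1..n. laguerre 0 (k j) (2 * \<mu> \<tau> j * ?p j))" for k
  proof -
    have "exp (- weighted_norm_sq y \<tau>) = (\<Prod>j=1..n. exp (- \<mu> \<tau> j * ?p j))"
      by (simp only: weighted_norm_sq_def sum_negf[symmetric] exp_sum finite_atLeastAtMost mult_minus_left)
    then show ?thesis
      unfolding laguerre_fun_def mu_prod_def by (simp only: prod.distrib mult_ac)
  qed
  then have "Qm n \<mu> v m y \<tau> = mu_prod \<tau> * exp (- weighted_norm_sq y \<tau>) *
      (\<Sum>k\<in>multi_indices n m. \<Prod>j=1..n. laguerre 0 (k j) (2 * \<mu> \<tau> j * ?p j))"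
    by (simp add: Qm_def sum_distrib_left)
  then show ?thesis
    unfolding sum_multi_indices_laguerre by (simp add: weighted_norm_sq_def sum_distrib_left mult_ac)
qed

text \<open>The Laguerre factor uses up half of the Gaussian, and the remaining
  \<open>exp (- (S / 2))\<close> is estimated by \<open>S \<ge> c |\<tau>| |y|\<^sup>2\<close>. This
  is why the rate is half of the lower constant for the eigenvalues.\<close>

lemma Qm_bound:
  obtains K c where "0 \<le> K" "0 < c"
    "\<And>y \<tau>. \<tau> \<noteq> 0 \<Longrightarrow> \<bar>Qm n \<mu> v m y \<tau>\<bar> \<le> K * norm \<tau> ^ n * exp (- (c * norm \<tau> * (norm y)\<^sup>2))"
proof -
  obtain c C where c: "0 < c" "0 < C" "\<And>\<tau> j. \<tau> \<noteq> 0 \<Longrightarrow> j \<in> {1..n} \<Longrightarrow> c * norm \<tau> \<le> \<mu> \<tau> j \<and> \<mu> \<tau> j \<le> C * norm \<tau>"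
    using mu_bounds by blast
  obtain L where L: "0 \<le> L" "\<And>s. 0 \<le> s \<Longrightarrow> \<bar>laguerre_sum n m s\<bar> \<le> L * exp (s / 4)"
    using laguerre_sum_bound by blast
  let ?K = "(2 * C / pi) ^ n * L"
  have "\<bar>Qm n \<mu> v m y \<tau>\<bar> \<le> ?K * norm \<tau> ^ n * exp (- (c / 2 * norm \<tau> * (norm y)\<^sup>2))" if \<tau>: "\<tau> \<noteq> 0" for y \<tau>
  proof -
    let ?S = "weighted_norm_sq y \<tau>"
    have p0: "0 \<le> pair_norm_sq (v \<tau>) j y" for j by (simp add: pair_norm_sq_def)
    have S: "c * norm \<tau> * (norm y)\<^sup>2 \<le> ?S"
      unfolding weighted_norm_sq_def norm_sq_eq_sum_pair_norm_sq[OF \<tau>] sum_distrib_left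
      using c(3)[OF \<tau>] p0 by (intro sum_mono mult_right_mono) auto
    then have S0: "0 \<le> ?S" using c(1) by (intro order_trans[OF _ S]) auto
    have D0: "0 \<le> mu_prod \<tau>"
      unfolding mu_prod_def using mu_pos[OF \<tau>] by (intro prod_nonneg) (auto intro: less_imp_le)
    have "mu_prod \<tau> \<le> (\<Prod>j=1..n. 2 * C / pi * norm \<tau>)"
      unfolding mu_prod_def
    proof (rule prod_mono)
      fix j assume j: "j \<in> {1..n}"
      show "0 \<le> 2 * \<mu> \<tau> j / pi \<and> 2 * \<mu> \<tau> j / pi \<le> 2 * C / pi * norm \<tau>"
        using c(3)[OF \<tau> j] mu_pos[OF \<tau> j] by (auto simp: divide_simps)
    qed
    then have D: "mu_prod \<tau> \<le> (2 * C / pi) ^ n * norm \<tau> ^ n"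
      by (simp add: power_mult_distrib power_divide)
    have "\<bar>Qm n \<mu> v m y \<tau>\<bar> = mu_prod \<tau> * \<bar>laguerre_sum n m (2 * ?S)\<bar> * exp (- ?S)"
      unfolding Qm_eq using D0 by (simp add: abs_mult)
    also have "\<dots> \<le> ((2 * C / pi) ^ n * norm \<tau> ^ n) * (L * exp (2 * ?S / 4)) * exp (- ?S)"
      using D D0 L(2)[of "2 * ?S"] S0 c(2) by (intro mult_right_mono mult_mono) auto
    also have "\<dots> = ?K * norm \<tau> ^ n * exp (- (?S / 2))"
      by (simp add: mult_ac flip: exp_add)
    also have "\<dots> \<le> ?K * norm \<tau> ^ n * exp (- (c / 2 * norm \<tau> * (norm y)\<^sup>2))"
      using S L(1) c(2) by (intro mult_left_mono) auto
    finally show ?thesis .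
  qed
  then show ?thesis
    using c L by (intro that[of ?K "c / 2"]) auto
qed

text \<open>The adapted basis is unchanged by positive scaling of \<open>\<tau>\<close>, the
  eigenvalues scale by \<open>1 / s\<^sup>2\<close> and the squared coordinates by
  \<open>s\<^sup>2\<close>. So the weighted norm is invariant, and only the product of the
  \<open>n\<close> eigenvalues contributes.\<close>

lemma Qm_scale:
  assumes s: "0 < s" and \<tau>: "\<tau> \<noteq> 0"
  shows "Qm n \<mu> v m (s *\<^sub>R y) (\<tau> /\<^sub>R s\<^sup>2) = Qm n \<mu> v m y \<tau> / s ^ (2 * n)"
proof -
  have i: "0 < inverse (s\<^sup>2)" using s by simp
  have pn: "pair_norm_sq (v (\<tau> /\<^sub>R s\<^sup>2)) j (s *\<^sub>R y) = s\<^sup>2 * pair_norm_sq (v \<tau>) j y" if "j \<in> {1..n}" for j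
  proof -
    have "2 * j - 1 \<in> {1..2*n}" "2 * j \<in> {1..2*n}" using that by auto
    then show ?thesis
      using v_scaleR[OF i \<tau>] by (simp add: pair_norm_sq_def power_mult_distrib algebra_simps)
  qed
  have S: "weighted_norm_sq (s *\<^sub>R y) (\<tau> /\<^sub>R s\<^sup>2) = weighted_norm_sq y \<tau>"
    unfolding weighted_norm_sq_def using s mu_scaleR[OF i \<tau>] pn by (intro sum.cong) auto
  have "mu_prod (\<tau> /\<^sub>R s\<^sup>2) = (\<Prod>j=1..n. 2 * \<mu> \<tau> j / pi / s\<^sup>2)"
    unfolding mu_prod_def using s mu_scaleR[OF i \<tau>] by (intro prod.cong) (auto simp: field_simps)
  also have "\<dots> = mu_prod \<tau> / s ^ (2 * n)"
    unfolding mu_prod_def prod_dividef by (simp add: power_mult)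
  finally show ?thesis unfolding Qm_eq S by simp
qed

text \<open>
  \<open>\<mu>\<close> and \<open>v\<close> need not depend measurably on \<open>\<tau>\<close>. But \<open>Q\<^sub>m\<close> involves them only through the product of
  the eigenvalues, the square root of a determinant, and through \<open>\<Sum>j. \<mu>\<^sub>j |y\<^sub>j|\<^sup>2\<close>. Approximating
  the square root by polynomials, the latter is a limit of linear combinations of the
  functions \<open>\<Sum>j. \<mu>\<^sub>j ^ (2 * i) |y\<^sub>j|\<^sup>2 = |B\<^sup>i y|\<^sup>2\<close>.
\<close>

lemma borel_measurable_weighted_norm_sq:
  "(\<lambda>p. if snd p = 0 then 0 else weighted_norm_sq (fst p) (snd p)) \<in> borel_measurable borel"
proof -
  \<comment> \<open>The same \<open>N\<close> controls the interval and the accuracy: for fixed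
    \<open>\<tau>\<close> every squared eigenvalue eventually lies in \<open>{0..real N}\<close>,
    while the error tends to 0.\<close>
  have "\<exists>a M. \<forall>x\<in>{0..real N}. \<bar>sqrt x - (\<Sum>i\<le>M. a i * x ^ i)\<bar> < 1 / real (Suc N)" for N :: nat
  proof -
    obtain g where g: "real_polynomial_function g" "\<And>x. x \<in> {0..real N} \<Longrightarrow> \<bar>sqrt x - g x\<bar> < 1 / real (Suc N)"
      by (rule Stone_Weierstrass_real_polynomial_function[of "{0..real N}" sqrt "1 / real (Suc N)"])
         (auto intro!: continuous_intros)
    from g(1) obtain a M where "g = (\<lambda>x. \<Sum>i\<le>M. a i * x ^ i)"
      unfolding real_polynomial_function_iff_sum by blast
    with g(2) show ?thesis by blast
  qed
  then obtain a M where a: "\<And>N x. x \<in> {0..real N} \<Longrightarrow> \<bar>sqrt x - (\<Sum>i\<le>M N. a N i * x ^ i)\<bar> < 1 / real (Suc N)"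
    by metis
  define f where "f N p = (if snd p = 0 then 0 else
      (\<Sum>i\<le>M N. a N i * (norm ((((*v) (Bmat B (snd p))) ^^ i) (fst p)))\<^sup>2))" for N :: nat and p :: "(real ^ 'd) \<times> (real ^ 'r)"
  have f_meas: "f N \<in> borel_measurable borel" for N
  proof -
    have "continuous_on UNIV (\<lambda>p :: (real ^ 'd) \<times> (real ^ 'r). \<Sum>i\<le>M N. a N i * (norm ((((*v) (Bmat B (snd p))) ^^ i) (fst p)))\<^sup>2)"
      by (intro continuous_intros power_matrix_vector_mult_continuous)
    then show ?thesis
      unfolding f_def by (intro measurable_If borel_measurable_continuous_onI) (auto simp: sets_borel_snd_eq_0)
  qed
  have lim: "(\<lambda>N. f N p) \<longlonglongrightarrow> (if snd p = 0 then 0 else weighted_norm_sq (fst p) (snd p))" for p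
  proof (cases "snd p = 0")
    case False
    let ?g = "\<lambda>j N. \<Sum>i\<le>M N. a N i * ((\<mu> (snd p) j)\<^sup>2) ^ i"
    have fN: "f N p = (\<Sum>j=1..n. ?g j N * pair_norm_sq (v (snd p)) j (fst p))" for N
      unfolding f_def norm_sq_Bmat_power[OF False]
      by (simp add: False sum_distrib_left sum_distrib_right mult_ac, subst sum.swap, rule refl)
    have "(?g j) \<longlonglongrightarrow> \<mu> (snd p) j" if j: "j \<in> {1..n}" for j
    proof -
      have "(\<lambda>N. ?g j N - sqrt ((\<mu> (snd p) j)\<^sup>2)) \<longlonglongrightarrow> 0"
      proof (rule Lim_null_comparison)
        obtain N0 :: nat where N0: "(\<mu> (snd p) j)\<^sup>2 \<le> real N0" using real_arch_simple by blast
        show "\<forall>\<^sub>F N in sequentially. norm (?g j N - sqrt ((\<mu> (snd p) j)\<^sup>2)) \<le> 1 / real (Suc N)"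
          using eventually_ge_at_top[of N0]
        proof eventually_elim
          case (elim N)
          then have "(\<mu> (snd p) j)\<^sup>2 \<in> {0..real N}" using N0 by auto
          from a[OF this] show ?case by (simp add: abs_minus_commute)
        qed
      qed (rule LIMSEQ_Suc[OF lim_1_over_n])
      then show ?thesis
        using mu_pos[OF False j] by (simp add: LIM_zero_iff)
    qed
    then show ?thesis
      unfolding fN weighted_norm_sq_def using False by (auto intro!: tendsto_intros)
  qed (simp add: f_def)
  show ?thesis
    by (rule borel_measurable_LIMSEQ_metric[OF f_meas lim])
qed

lemma borel_measurable_mu_prod: "(\<lambda>\<tau>. if \<tau> = 0 then 0 else mu_prod \<tau>) \<in> borel_measurable borel"
proof -
  \<comment> \<open>The characteristic polynomial at \<open>z = 0\<close> equals the square of the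
    product of the \<open>\<mu> \<tau> j\<close>, since each conjugate pair of roots contributes
    \<open>(\<mu> \<tau> j)\<^sup>2\<close>.\<close>
  let ?A = "\<lambda>\<tau>. mat 0 - (\<chi> k l. complex_of_real (Bmat B \<tau> $ k $ l))"
  have eq: "mu_prod \<tau> = (2 / pi) ^ n * sqrt (Re (det (?A \<tau>)))" if \<tau>: "\<tau> \<noteq> 0" for \<tau>
  proof -
    have "det (?A \<tau>) = (\<Prod>j=1..n. (0 - \<i> * of_real (\<mu> \<tau> j)) * (0 + \<i> * of_real (\<mu> \<tau> j)))"
      using eigen \<tau> unfolding eigenvalue_family_def by blast
    also have "\<dots> = (\<Prod>j=1..n. of_real ((\<mu> \<tau> j)\<^sup>2))"
      by (intro prod.cong refl) (simp add: power2_eq_square algebra_simps)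
    also have "\<dots> = of_real ((\<Prod>j=1..n. \<mu> \<tau> j)\<^sup>2)"
      by (simp only: prod_power_distrib of_real_prod)
    finally have det: "det (?A \<tau>) = of_real ((\<Prod>j=1..n. \<mu> \<tau> j)\<^sup>2)" .
    have "sqrt (Re (det (?A \<tau>))) = (\<Prod>j=1..n. \<mu> \<tau> j)"
      unfolding det Re_complex_of_real real_sqrt_abs
      using mu_pos[OF \<tau>] by (intro abs_of_nonneg prod_nonneg) (auto intro: less_imp_le)
    then show ?thesis
      unfolding mu_prod_def by (simp add: prod.distrib prod_dividef power_divide)
  qed
  have "continuous_on UNIV (\<lambda>\<tau>. (2 / pi) ^ n * sqrt (Re (det (?A \<tau>))))"
    unfolding det_def Bmat_def by (intro continuous_intros)
  then have "(\<lambda>\<tau>. (2 / pi) ^ n * sqrt (Re (det (?A \<tau>)))) \<in> borel_measurable borel"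
    by (rule borel_measurable_continuous_onI)
  then have "(\<lambda>\<tau>. if \<tau> = 0 then 0 else (2 / pi) ^ n * sqrt (Re (det (?A \<tau>)))) \<in> borel_measurable borel"
    by (intro measurable_If) auto
  then show ?thesis
    by (rule back_subst[of "\<lambda>f. f \<in> borel_measurable borel"]) (auto simp: eq)
qed

lemma borel_measurable_Qm: "(\<lambda>p. Qm n \<mu> v m (fst p) (snd p)) \<in> borel_measurable borel"
proof -
  let ?S = "\<lambda>p. if snd p = 0 then 0 else weighted_norm_sq (fst p) (snd p)"
  let ?D = "\<lambda>p :: (real ^ 'd) \<times> (real ^ 'r). if snd p = 0 then 0 else mu_prod (snd p)"
  have [measurable]: "?S \<in> borel_measurable borel" by (rule borel_measurable_weighted_norm_sq)
  have [measurable]: "?D \<in> borel_measurable borel"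
    by (rule measurable_compose[OF _ borel_measurable_mu_prod])
      (intro borel_measurable_continuous_onI continuous_intros)
  have [measurable]: "laguerre_sum n m \<in> borel_measurable borel"
    by (intro borel_measurable_continuous_onI continuous_on_laguerre_sum)
  \<comment> \<open>At \<open>\<tau> = 0\<close> the values of \<open>\<mu>\<close> and
    \<open>v\<close> are arbitrary but fixed, so this slice is a continuous function of
    \<open>y\<close> and is treated as a separate branch.\<close>
  have "continuous_on UNIV (\<lambda>p :: (real ^ 'd) \<times> (real ^ 'r). Qm n \<mu> v m (fst p) 0)"
    unfolding Qm_def laguerre_fun_def pair_norm_sq_def laguerre_def by (intro continuous_intros) auto
  then have Q0: "(\<lambda>p :: (real ^ 'd) \<times> (real ^ 'r). Qm n \<mu> v m (fst p) 0) \<in> borel_measurable borel"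
    by (rule borel_measurable_continuous_onI)
  have "(\<lambda>p. ?D p * laguerre_sum n m (2 * ?S p) * exp (- ?S p)) \<in> borel_measurable borel"
    by measurable
  then have "(\<lambda>p :: (real ^ 'd) \<times> (real ^ 'r). if snd p = 0 then Qm n \<mu> v m (fst p) 0
      else ?D p * laguerre_sum n m (2 * ?S p) * exp (- ?S p)) \<in> borel_measurable borel"
    by (intro measurable_If Q0) (auto simp: sets_borel_snd_eq_0)
  then show ?thesis
    by (rule back_subst[of "\<lambda>f. f \<in> borel_measurable borel"]) (auto simp: Qm_eq)
qed

end

subsection \<open>Product integrals and dilations\<close>

lemma lborel_integral_fst:
  fixes f :: "'a :: euclidean_space \<times> 'b :: euclidean_space \<Rightarrow> 'c :: {banach, second_countable_topology}"
  assumes "integrable lborel f"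
  shows "(LINT p|lborel. f p) = (LINT x|lborel. LINT y|lborel. f (x, y))"
    and "integrable lborel (\<lambda>x. LINT y|lborel. f (x, y))"
  using assms lborel_pair.integral_fst'[of f] lborel_pair.integrable_fst'[of f]
  by (simp_all add: lborel_prod)

lemma lborel_integrable_mult:
  fixes f :: "'a :: euclidean_space \<Rightarrow> real" and g :: "'b :: euclidean_space \<Rightarrow> real"
  assumes f: "integrable lborel f" and g: "integrable lborel g"
  shows "integrable lborel (\<lambda>p. f (fst p) * g (snd p))"
proof -
  have [measurable]: "f \<in> borel_measurable borel" "g \<in> borel_measurable borel"
    using f g by (auto dest: borel_measurable_integrable)
  have "integrable (lborel \<Otimes>\<^sub>M lborel) (\<lambda>p. f (fst p) * g (snd p))"
  proof (rule lborel_pair.Fubini_integrable)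
    show "integrable lborel (\<lambda>x. LINT y|lborel. norm (f (fst (x, y)) * g (snd (x, y))))"
      using f g by (simp add: abs_mult)
    show "AE x in lborel. integrable lborel (\<lambda>y. f (fst (x, y)) * g (snd (x, y)))"
      using g by simp
  qed simp
  then show ?thesis by (simp add: lborel_prod)
qed

text \<open>Isotropic scaling and the parabolic dilation are both of this form, so one change of
  variables serves for both.\<close>

definition diag_scale :: "('a :: euclidean_space \<Rightarrow> real) \<Rightarrow> 'a \<Rightarrow> 'a" where
  "diag_scale c x = (\<Sum>j\<in>Basis. (c j * (x \<bullet> j)) *\<^sub>R j)"

lemma borel_measurable_diag_scale: "diag_scale c \<in> borel_measurable borel"
  unfolding diag_scale_def by simp

lemma integral_diag_scale:
  fixes f :: "'a :: euclidean_space \<Rightarrow> 'b :: {banach, second_countable_topology}"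
  assumes c: "\<And>j. j \<in> Basis \<Longrightarrow> 0 < c j" and [measurable]: "f \<in> borel_measurable borel"
  shows "(LINT x|lborel. f x) = (\<Prod>j\<in>Basis. c j) *\<^sub>R (LINT x|lborel. f (diag_scale c x))"
proof -
  note [measurable] = borel_measurable_diag_scale
  have eq: "lborel = density (distr lborel borel (diag_scale c)) (\<lambda>_. ennreal (\<Prod>j\<in>Basis. c j))"
    using lborel_affine_euclidean[of c 0] c by (simp add: diag_scale_def[abs_def] less_imp_neq[symmetric] less_imp_le)
  have p: "0 \<le> (\<Prod>j\<in>Basis. c j)" using c by (intro prod_nonneg) (auto intro: less_imp_le)
  show ?thesis
    by (subst eq, subst integral_density) (simp_all add: p integral_distr)
qed

lemma nn_integral_diag_scale:
  fixes f :: "'a :: euclidean_space \<Rightarrow> ennreal"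
  assumes c: "\<And>j. j \<in> Basis \<Longrightarrow> 0 < c j" and [measurable]: "f \<in> borel_measurable borel"
  shows "(\<integral>\<^sup>+x. f x \<partial>lborel) = ennreal (\<Prod>j\<in>Basis. c j) * (\<integral>\<^sup>+x. f (diag_scale c x) \<partial>lborel)"
proof -
  note [measurable] = borel_measurable_diag_scale
  have eq: "lborel = density (distr lborel borel (diag_scale c)) (\<lambda>_. ennreal (\<Prod>j\<in>Basis. c j))"
    using lborel_affine_euclidean[of c 0] c by (simp add: diag_scale_def[abs_def] less_imp_neq[symmetric] less_imp_le)
  show ?thesis
    by (subst eq, subst nn_integral_density) (simp_all add: nn_integral_distr nn_integral_cmult)
qed

lemma diag_scale_const: "diag_scale (\<lambda>_. s) x = s *\<^sub>R x"
  by (simp add: diag_scale_def euclidean_representation flip: scaleR_scaleR scaleR_sum_right)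

lemma integral_scaleR_lborel:
  fixes f :: "'a :: euclidean_space \<Rightarrow> 'b :: {banach, second_countable_topology}"
  assumes "0 < s" "f \<in> borel_measurable borel"
  shows "(LINT x|lborel. f x) = s ^ DIM('a) *\<^sub>R (LINT x|lborel. f (s *\<^sub>R x))"
  using integral_diag_scale[of "\<lambda>_. s" f] assms by (simp add: diag_scale_const)

lemma nn_integral_scaleR_lborel:
  fixes f :: "'a :: euclidean_space \<Rightarrow> ennreal"
  assumes "0 < s" "f \<in> borel_measurable borel"
  shows "(\<integral>\<^sup>+x. f x \<partial>lborel) = ennreal (s ^ DIM('a)) * (\<integral>\<^sup>+x. f (s *\<^sub>R x) \<partial>lborel)"
  using nn_integral_diag_scale[of "\<lambda>_. s" f] assms by (simp add: diag_scale_const)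

section \<open>Parabolic dilations and the homogeneous norm\<close>

definition dilate :: "real \<Rightarrow> 'a :: real_vector \<times> 'b :: real_vector \<Rightarrow> 'a \<times> 'b" where
  "dilate s p = (s *\<^sub>R fst p, s\<^sup>2 *\<^sub>R snd p)"

lemma integral_dilate:
  fixes f :: "'a :: euclidean_space \<times> 'b :: euclidean_space \<Rightarrow> 'c :: {banach, second_countable_topology}"
  assumes s: "0 < s" and f: "f \<in> borel_measurable borel"
  shows "(LINT p|lborel. f p) = s ^ (DIM('a) + 2 * DIM('b)) *\<^sub>R (LINT p|lborel. f (dilate s p))"
proof -
  \<comment> \<open>Basis vectors of the product have exactly one nonzero component, so
    \<open>snd b = 0\<close> singles out those of the first factor. The product of these weights is
    the Jacobian, whose exponent is the homogeneous dimension.\<close>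
  let ?c = "\<lambda>b :: 'a \<times> 'b. if snd b = 0 then s else s\<^sup>2"
  let ?A = "(\<lambda>u. (u, 0)) ` (Basis :: 'a set) :: ('a \<times> 'b) set"
  let ?B = "(\<lambda>v. (0, v)) ` (Basis :: 'b set) :: ('a \<times> 'b) set"
  have nz: "j \<noteq> 0" if "j \<in> (Basis :: 'b set)" for j using that nonzero_Basis by blast
  have basis: "(\<Sum>b\<in>Basis. g b) = (\<Sum>u\<in>Basis. g (u, 0)) + (\<Sum>u\<in>Basis. g (0, u))" for g :: "'a \<times> 'b \<Rightarrow> 'a \<times> 'b"
    unfolding Basis_prod_def using nz
    by (subst sum.union_disjoint) (auto simp: sum.reindex inj_on_def)
  have "diag_scale ?c p = dilate s p" for p :: "'a \<times> 'b"
  proof -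
    have "diag_scale ?c p = (\<Sum>u\<in>Basis. (s * (fst p \<bullet> u)) *\<^sub>R (u, 0)) + (\<Sum>u\<in>Basis. (s\<^sup>2 * (snd p \<bullet> u)) *\<^sub>R (0, u))"
      unfolding diag_scale_def basis using nz by (simp add: inner_prod_def)
    also have "\<dots> = dilate s p"
      by (simp add: dilate_def prod_eq_iff fst_sum snd_sum euclidean_representation flip: scaleR_scaleR scaleR_sum_right)
    finally show ?thesis .
  qed
  moreover have "(\<Prod>b\<in>Basis. ?c b) = s ^ (DIM('a) + 2 * DIM('b))"
    unfolding Basis_prod_def using nz
    by (subst prod.union_disjoint) (auto simp: prod.reindex inj_on_def power_add power_mult)
  ultimately show ?thesis
    using integral_diag_scale[of ?c f] s f by auto
qed

definition hom_norm :: "'a :: real_normed_vector \<times> 'b :: real_normed_vector \<Rightarrow> real" where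
  "hom_norm p = root 4 (norm (fst p) ^ 4 + norm (snd p) ^ 2)"

lemma hom_norm_nonneg: "0 \<le> hom_norm p"
  by (simp add: hom_norm_def)

lemma hom_norm_power4: "hom_norm p ^ 4 = norm (fst p) ^ 4 + norm (snd p) ^ 2"
  by (simp add: hom_norm_def)

lemma hom_norm_eq_0_iff: "hom_norm p = 0 \<longleftrightarrow> p = 0"
  by (simp add: hom_norm_def add_nonneg_eq_0_iff prod_eq_iff)

lemma hom_norm_pos: "p \<noteq> 0 \<Longrightarrow> 0 < hom_norm p"
  using hom_norm_eq_0_iff[of p] hom_norm_nonneg[of p] by linarith

lemma hom_norm_dilate: "0 \<le> s \<Longrightarrow> hom_norm (dilate s p) = s * hom_norm p"
proof -
  assume "0 \<le> s"
  then have "norm (fst (dilate s p)) ^ 4 + norm (snd (dilate s p)) ^ 2 = s ^ 4 * (norm (fst p) ^ 4 + norm (snd p) ^ 2)"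
    by (simp add: dilate_def power_mult_distrib algebra_simps flip: power_mult)
  then show ?thesis
    using \<open>0 \<le> s\<close> unfolding hom_norm_def by (simp add: real_root_mult real_root_power_cancel)
qed

lemma norm_fst_le_hom_norm: "norm (fst p) \<le> hom_norm p"
  by (rule power_le_imp_le_base[of _ 3]) (simp_all add: hom_norm_power4 hom_norm_nonneg)

lemma norm_snd_le_hom_norm: "norm (snd p) \<le> hom_norm p ^ 2"
proof (rule power_le_imp_le_base[of _ 1])
  have "(hom_norm p ^ 2) ^ 2 = hom_norm p ^ 4" by (simp flip: power_mult)
  then show "norm (snd p) ^ Suc 1 \<le> (hom_norm p ^ 2) ^ Suc 1"
    by (simp add: hom_norm_power4 numeral_2_eq_2[symmetric])
qed simp

lemma continuous_on_hom_norm: "continuous_on A hom_norm"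
  unfolding hom_norm_def by (intro continuous_intros)

lemma borel_measurable_hom_norm:
  "(hom_norm :: 'a :: euclidean_space \<times> 'b :: euclidean_space \<Rightarrow> real) \<in> borel_measurable borel"
  by (intro borel_measurable_continuous_onI continuous_on_hom_norm)

lemma dilate_dilate: "dilate s (dilate t p) = dilate (s * t) p"
  by (simp add: dilate_def power_mult_distrib)

lemma dilate_1: "dilate 1 p = p"
  by (simp add: dilate_def)

lemma dilate_eq_0_iff: "s \<noteq> 0 \<Longrightarrow> dilate s p = 0 \<longleftrightarrow> p = 0"
  by (auto simp: dilate_def prod_eq_iff)

lemma continuous_on_dilate:
  "continuous_on A (dilate s :: 'a :: real_normed_vector \<times> 'b :: real_normed_vector \<Rightarrow> _)"
  unfolding dilate_def by (intro continuous_intros)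

lemma mem_hom_ball_iff: "p \<in> hom_ball e \<longleftrightarrow> hom_norm p \<le> e"
  by (cases p) (simp add: hom_ball_def hom_norm_def)

lemma mem_hom_sphere_iff: "p \<in> hom_sphere \<longleftrightarrow> hom_norm p = 1"
proof -
  have "p \<in> hom_sphere \<longleftrightarrow> hom_norm p ^ 4 = 1 ^ 4"
    by (cases p) (simp add: hom_sphere_def hom_norm_power4)
  also have "\<dots> \<longleftrightarrow> hom_norm p = 1"
    using hom_norm_nonneg[of p] by (subst power_eq_iff_eq_base) auto
  finally show ?thesis .
qed

lemma compact_hom_sphere: "compact (hom_sphere :: ((real ^ 'd) \<times> (real ^ 'r)) set)"
unfolding compact_eq_bounded_closed
proof
  have "norm p \<le> 2" if "p \<in> hom_sphere" for p :: "(real ^ 'd) \<times> (real ^ 'r)"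
  proof -
    have "hom_norm p = 1" using that by (simp add: mem_hom_sphere_iff)
    then have "norm (fst p) \<le> 1" "norm (snd p) \<le> 1"
      using norm_fst_le_hom_norm[of p] norm_snd_le_hom_norm[of p] by simp_all
    then show ?thesis
      using norm_Pair_le[of "fst p" "snd p"] by simp
  qed
  then show "bounded (hom_sphere :: ((real ^ 'd) \<times> (real ^ 'r)) set)"
    unfolding bounded_iff by blast
  have "closed {p :: (real ^ 'd) \<times> (real ^ 'r). hom_norm p = 1}"
    by (intro closed_Collect_eq continuous_on_hom_norm continuous_intros)
  also have "{p :: (real ^ 'd) \<times> (real ^ 'r). hom_norm p = 1} = hom_sphere"
    by (auto simp: mem_hom_sphere_iff)
  finally show "closed (hom_sphere :: ((real ^ 'd) \<times> (real ^ 'r)) set)" .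
qed

lemma power_times_exp_le:
  fixes t a :: real
  assumes "0 \<le> t" "0 < a"
  shows "(1 + t) ^ M * exp (- (a * t)) \<le> fact M * exp a / a ^ M"
proof -
  have "(a * (1 + t)) ^ M / fact M \<le> exp (a * (1 + t))"
    using assms by (intro power_over_fact_le_exp) auto
  then have "(1 + t) ^ M \<le> fact M * exp (a * (1 + t)) / a ^ M"
    using assms by (simp only: power_mult_distrib) (simp add: field_simps)
  then have "(1 + t) ^ M * exp (- (a * t)) \<le> fact M * exp (a * (1 + t)) / a ^ M * exp (- (a * t))"
    by (intro mult_right_mono) auto
  also have "\<dots> = fact M * exp a / a ^ M"
    by (simp add: exp_minus exp_add algebra_simps)
  finally show ?thesis .
qed

subsection \<open>Homogeneous kernels\<close>

text \<open>All that matters about \<open>Q\<^sub>m\<close> from here on is a Gaussian bound and homogeneity.\<close>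

locale homogeneous_kernel =
  fixes n :: nat
    and Q :: "real ^ 'd \<Rightarrow> real ^ 'r \<Rightarrow> real"
    and P :: "(real ^ 'd) \<times> (real ^ 'r) \<Rightarrow> complex"
    and K c :: real
  assumes card: "CARD('d) = 2 * n"
    and Q_measurable: "(\<lambda>p. Q (fst p) (snd p)) \<in> borel_measurable borel"
    and K: "0 \<le> K" and c: "0 < c"
    and Q_bound: "\<And>y \<tau>. \<tau> \<noteq> 0 \<Longrightarrow> \<bar>Q y \<tau>\<bar> \<le> K * norm \<tau> ^ n * exp (- (c * norm \<tau> * (norm y)\<^sup>2))"
    and Q_scale: "\<And>s y \<tau>. 0 < s \<Longrightarrow> \<tau> \<noteq> 0 \<Longrightarrow> Q (s *\<^sub>R y) (\<tau> /\<^sub>R s\<^sup>2) = Q y \<tau> / s ^ (2 * n)"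
    and P_eq: "\<And>y t. y \<noteq> 0 \<Longrightarrow> P (y, t) = (LINT \<tau>|lborel. cis (t \<bullet> \<tau>) * of_real (Q y \<tau>)) / of_real ((2 * pi) ^ CARD('r))"
    and P_continuous: "continuous_on (- {0}) P"
begin

lemma n_pos: "1 \<le> n"
  using card zero_less_card_finite[where 'a = 'd] by linarith

lemma Q_section_measurable: "Q y \<in> borel_measurable borel"
  using measurable_compose[of "\<lambda>\<tau>. (y, \<tau>)" borel borel, OF _ Q_measurable] by simp

lemma P_measurable: "P \<in> borel_measurable borel"
proof -
  have "(\<lambda>p. if p \<in> - {0} then P p else P 0) \<in> borel_measurable borel"
    by (intro borel_measurable_continuous_on_if P_continuous) (auto intro: continuous_intros)
  moreover have "(\<lambda>p. if p \<in> - {0} then P p else P 0) = P" by auto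
  ultimately show ?thesis by simp
qed

text \<open>For fixed nonzero \<open>y\<close> the Gaussian bound decays exponentially in
  \<open>\<tau>\<close> at rate \<open>c * (norm y)\<^sup>2\<close>, which beats the polynomial
  factor. The bound has no such decay at \<open>y = 0\<close>.\<close>

lemma integrable_Q:
  assumes y: "y \<noteq> 0"
  shows "integrable lborel (Q y)"
proof -
  define a where "a = c * (norm y)\<^sup>2"
  have a: "0 < a" using c y by (simp add: a_def)
  let ?D = "DIM(real ^ 'r) + 1"
  let ?M = "K * (fact (n + ?D) * exp a / a ^ (n + ?D))"
  show ?thesis
  proof (rule Bochner_Integration.integrable_bound)
    show "integrable lborel (\<lambda>\<tau> :: real ^ 'r. ?M * (1 / (1 + norm \<tau>) ^ ?D))"
      by (rule integrable_mult_right) (rule integrable_inverse_power_norm)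
    show "Q y \<in> borel_measurable lborel" using Q_section_measurable by simp
    have "norm (Q y \<tau>) \<le> norm (?M * (1 / (1 + norm \<tau>) ^ ?D))" if \<tau>: "\<tau> \<noteq> 0" for \<tau>
    proof -
      have pos: "0 < (1 + norm \<tau>) ^ ?D" by (intro zero_less_power add_pos_nonneg) auto
      have "norm (Q y \<tau>) \<le> K * norm \<tau> ^ n * exp (- (a * norm \<tau>))"
        using Q_bound[OF \<tau>, of y] by (simp add: a_def mult_ac)
      also have "\<dots> \<le> K * (1 + norm \<tau>) ^ n * exp (- (a * norm \<tau>))"
        using K by (intro mult_right_mono mult_left_mono power_mono) auto
      also have "\<dots> = K * ((1 + norm \<tau>) ^ (n + ?D) * exp (- (a * norm \<tau>))) * (1 / (1 + norm \<tau>) ^ ?D)"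
      proof -
        have "K * x * e = K * (x * d * e) * (1 / d)" if "0 < d" for x d e :: real using that by simp
        from this[OF pos] show ?thesis by (simp only: power_add)
      qed
      also have "\<dots> \<le> ?M * (1 / (1 + norm \<tau>) ^ ?D)"
        using K pos a by (intro mult_right_mono mult_left_mono power_times_exp_le) auto
      finally show ?thesis by (simp only: real_norm_def)
    qed
    then show "AE \<tau> in lborel. norm (Q y \<tau>) \<le> norm (?M * (1 / (1 + norm \<tau>) ^ ?D))"
      by (intro AE_mp[OF AE_lborel_singleton[of "0 :: real ^ 'r"] AE_I2]; blast)
  qed
qed

text \<open>Substituting \<open>\<tau> / s\<^sup>2\<close> in the integral gives \<open>s\<close> to
  the power \<open>- 2 r\<close>, and the homogeneity of \<open>Q\<close> gives the remaining
  \<open>- 2 n\<close>. This covers nonzero \<open>y\<close>; the rest follows by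
  continuity.\<close>

lemma P_dilate:
  assumes s: "0 < s" and p: "p \<noteq> 0"
  shows "P (dilate s p) = P p / of_real (s ^ (2 * n + 2 * CARD('r)))"
proof -
  have main: "P (s *\<^sub>R y, s\<^sup>2 *\<^sub>R t) = P (y, t) / of_real (s ^ (2 * n + 2 * CARD('r)))" if y: "y \<noteq> 0" for y t
  proof -
    have sy: "s *\<^sub>R y \<noteq> 0" using s y by simp
    have [measurable]: "(\<lambda>\<tau>. cis (u \<bullet> \<tau>)) \<in> borel_measurable borel" for u :: "real ^ 'r"
      by (intro borel_measurable_continuous_onI continuous_intros)
    note [measurable] = Q_section_measurable
    let ?f = "\<lambda>\<tau>. cis ((s\<^sup>2 *\<^sub>R t) \<bullet> \<tau>) * of_real (Q (s *\<^sub>R y) \<tau>)"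
    have m: "?f \<in> borel_measurable borel"
      by measurable
    have "(LINT \<tau>|lborel. ?f \<tau>) = (1 / s\<^sup>2) ^ CARD('r) *\<^sub>R (LINT \<tau>|lborel. ?f ((1 / s\<^sup>2) *\<^sub>R \<tau>))"
      using integral_scaleR_lborel[of "1 / s\<^sup>2" ?f] s m by simp
    also have "(LINT \<tau>|lborel. ?f ((1 / s\<^sup>2) *\<^sub>R \<tau>)) = (LINT \<tau>|lborel. cis (t \<bullet> \<tau>) * of_real (Q y \<tau>) / of_real (s ^ (2 * n)))"
    proof (rule integral_cong_AE)
      have "?f ((1 / s\<^sup>2) *\<^sub>R \<tau>) = cis (t \<bullet> \<tau>) * of_real (Q y \<tau>) / of_real (s ^ (2 * n))" if "\<tau> \<noteq> 0" for \<tau>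
        using Q_scale[OF s that, of y] s by (simp add: inverse_eq_divide)
      then show "AE \<tau> in lborel. ?f ((1 / s\<^sup>2) *\<^sub>R \<tau>) = cis (t \<bullet> \<tau>) * of_real (Q y \<tau>) / of_real (s ^ (2 * n))"
        by (intro AE_mp[OF AE_lborel_singleton[of "0 :: real ^ 'r"] AE_I2]; blast)
      show "(\<lambda>\<tau>. ?f ((1 / s\<^sup>2) *\<^sub>R \<tau>)) \<in> borel_measurable lborel"
        using measurable_compose[OF _ m, of "\<lambda>\<tau>. (1 / s\<^sup>2) *\<^sub>R \<tau>" lborel] by simp
      show "(\<lambda>\<tau>. cis (t \<bullet> \<tau>) * of_real (Q y \<tau>) / of_real (s ^ (2 * n))) \<in> borel_measurable lborel"
        by measurable
    qed
    finally have "(LINT \<tau>|lborel. ?f \<tau>) = (1 / s\<^sup>2) ^ CARD('r) *\<^sub>R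
        ((LINT \<tau>|lborel. cis (t \<bullet> \<tau>) * of_real (Q y \<tau>)) / of_real (s ^ (2 * n)))"
      by simp
    then show ?thesis
      using s unfolding P_eq[OF sy] P_eq[OF y]
      by (simp add: scaleR_conv_of_real power_add power_mult power_divide del: inner_scaleR_left)
  qed
  show ?thesis
  proof (cases "fst p = 0")
    case False
    then show ?thesis using main[of "fst p" "snd p"] by (simp add: dilate_def)
  next
    case True
    then have t: "snd p \<noteq> 0" using p by (auto simp: prod_eq_iff)
    let ?t = "snd p"
    \<comment> \<open>Since \<open>?t\<close> is nonzero, this function is continuous also at
      \<open>y = 0\<close>, and it vanishes for every other \<open>y\<close>.\<close>
    let ?f = "\<lambda>y. P (dilate s (y, ?t)) - P (y, ?t) / of_real (s ^ (2 * n + 2 * CARD('r)))"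
    have "continuous_on UNIV ?f"
      using t s by (intro continuous_intros continuous_on_compose2[OF P_continuous]
          continuous_on_compose2[OF continuous_on_dilate]) (auto simp: dilate_def zero_prod_def)
    then have "isCont ?f 0" by (simp add: continuous_on_eq_continuous_at)
    then have "(?f \<longlongrightarrow> ?f 0) (at 0)" by (simp add: isCont_def)
    moreover have "(?f \<longlongrightarrow> 0) (at 0)"
      by (rule tendsto_eventually) (auto simp: eventually_at_filter dilate_def main)
    ultimately have "?f 0 = 0" by (intro tendsto_unique[OF at_neq_bot])
    then show ?thesis using True by (cases p) auto
  qed
qed

text \<open>\<open>P\<close> is bounded on the compact unit sphere, and homogeneity carries the
  bound along the dilation orbits.\<close>

lemma P_bound:
  obtains M where "0 \<le> M" "\<And>p. p \<noteq> 0 \<Longrightarrow> norm (P p) \<le> M / hom_norm p ^ (2 * n + 2 * CARD('r))"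
proof -
  have "continuous_on hom_sphere P"
    by (rule continuous_on_subset[OF P_continuous]) (auto simp: hom_sphere_def zero_prod_def)
  then have "bounded (P ` hom_sphere)"
    by (intro compact_imp_bounded compact_continuous_image compact_hom_sphere)
  then obtain M where M: "\<And>p. p \<in> hom_sphere \<Longrightarrow> norm (P p) \<le> M" "0 \<le> M"
    unfolding bounded_pos by (auto intro: less_imp_le)
  show ?thesis
  proof (rule that[OF M(2)])
    fix p :: "(real ^ 'd) \<times> (real ^ 'r)" assume p: "p \<noteq> 0"
    let ?h = "hom_norm p"
    have h: "0 < ?h" using hom_norm_pos[OF p] .
    let ?q = "dilate (1 / ?h) p"
    have q: "?q \<noteq> 0" using p h by (simp add: dilate_eq_0_iff)
    have "?q \<in> hom_sphere" using h by (simp add: mem_hom_sphere_iff hom_norm_dilate)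
    then have "norm (P ?q) \<le> M" by (rule M)
    moreover have "P (dilate ?h ?q) = P ?q / of_real (?h ^ (2 * n + 2 * CARD('r)))" by (rule P_dilate[OF h q])
    moreover have "dilate ?h ?q = p" using h by (simp add: dilate_dilate dilate_1)
    ultimately show "norm (P p) \<le> M / ?h ^ (2 * n + 2 * CARD('r))"
      using h by (simp add: norm_divide norm_power divide_right_mono)
  qed
qed

text \<open>As \<open>norm t\<close> is at most the square of the homogeneous norm, \<open>P\<close>
  decays like \<open>norm t\<close> to the power \<open>- (n + r)\<close>. Since \<open>n\<close> is
  at least 1, this exponent reaches \<open>r + 1\<close>, so the bound is integrable in
  \<open>t\<close>.\<close>

lemma P_bound_outside:
  assumes a: "0 < a"
  obtains M where "0 \<le> M"
    "\<And>p. a \<le> hom_norm p \<Longrightarrow> norm (P p) \<le> M"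
    "\<And>p. a \<le> hom_norm p \<Longrightarrow> norm (P p) \<le> M * (1 / (1 + norm (snd p)) ^ (DIM(real ^ 'r) + 1))"
proof -
  obtain M where M: "0 \<le> M" "\<And>p. p \<noteq> 0 \<Longrightarrow> norm (P p) \<le> M / hom_norm p ^ (2 * n + 2 * CARD('r))"
    using P_bound by blast
  let ?D = "DIM(real ^ 'r) + 1"
  \<comment> \<open>With this choice \<open>k\<close> and \<open>k * norm t\<close> are each at most
    half of the squared homogeneous norm.\<close>
  define k where "k = min (a\<^sup>2) 1 / 2"
  have k: "0 < k" "k \<le> 1" using a by (auto simp: k_def)
  have b2: "norm (P p) \<le> M / k ^ (n + CARD('r)) * (1 / (1 + norm (snd p)) ^ ?D)" if h: "a \<le> hom_norm p" for p
  proof -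
    have p: "p \<noteq> 0" using h a hom_norm_eq_0_iff[of p] by auto
    have D: "?D \<le> n + CARD('r)" using n_pos by simp
    have pos: "0 < (1 + norm (snd p)) ^ N" for N by (intro zero_less_power add_pos_nonneg) auto
    have "a\<^sup>2 \<le> (hom_norm p)\<^sup>2" using h a by (intro power_mono) auto
    then have h2: "k * (1 + norm (snd p)) \<le> (hom_norm p)\<^sup>2"
    proof -
      assume "a\<^sup>2 \<le> (hom_norm p)\<^sup>2"
      moreover have "norm (snd p) \<le> (hom_norm p)\<^sup>2" by (rule norm_snd_le_hom_norm)
      moreover have "k \<le> a\<^sup>2 / 2" by (simp add: k_def)
      moreover have "k * norm (snd p) \<le> 1 / 2 * norm (snd p)"
        by (intro mult_right_mono) (auto simp: k_def)
      ultimately show ?thesis by (simp add: algebra_simps)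
    qed
    have "norm (P p) \<le> M / ((hom_norm p)\<^sup>2) ^ (n + CARD('r))"
      using M(2)[OF p] by (simp add: power_mult[symmetric] algebra_simps)
    also have "\<dots> \<le> M / (k * (1 + norm (snd p))) ^ (n + CARD('r))"
    proof (rule divide_left_mono)
      show "(k * (1 + norm (snd p))) ^ (n + CARD('r)) \<le> ((hom_norm p)\<^sup>2) ^ (n + CARD('r))"
        using h2 k by (intro power_mono) auto
      have "0 < (k * (1 + norm (snd p))) ^ (n + CARD('r))" using k(1) pos[of "n + CARD('r)"] by (simp add: power_mult_distrib)
      then show "0 < (hom_norm p ^ 2) ^ (n + CARD('r)) * (k * (1 + norm (snd p))) ^ (n + CARD('r))"
        using hom_norm_pos[OF p] by (intro mult_pos_pos) auto
    qed (rule M(1))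
    also have "\<dots> = M / k ^ (n + CARD('r)) * (1 / (1 + norm (snd p)) ^ (n + CARD('r)))"
      by (simp add: power_mult_distrib)
    also have "\<dots> \<le> M / k ^ (n + CARD('r)) * (1 / (1 + norm (snd p)) ^ ?D)"
    proof (intro mult_left_mono divide_left_mono)
      show "(1 + norm (snd p)) ^ ?D \<le> (1 + norm (snd p)) ^ (n + CARD('r))" using D by (intro power_increasing) auto
      show "0 < (1 + norm (snd p)) ^ (n + CARD('r)) * (1 + norm (snd p)) ^ ?D" by (intro mult_pos_pos pos)
      show "0 \<le> M / k ^ (n + CARD('r))" using M(1) k(1) by simp
    qed simp
    finally show ?thesis .
  qed
  have nn: "0 \<le> M / k ^ (n + CARD('r))" using M(1) k(1) by simp
  show ?thesis
  proof (rule that[OF nn _ b2])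
    fix p :: "(real ^ 'd) \<times> (real ^ 'r)" assume h: "a \<le> hom_norm p"
    have "1 \<le> (1 + norm (snd p)) ^ ?D" by (intro one_le_power) auto
    moreover have "1 / x \<le> 1" if "1 \<le> x" for x :: real using that by simp
    ultimately have "1 / (1 + norm (snd p)) ^ ?D \<le> 1" by blast
    then have "M / k ^ (n + CARD('r)) * (1 / (1 + norm (snd p)) ^ ?D) \<le> M / k ^ (n + CARD('r)) * 1"
      using nn by (rule mult_left_mono)
    then show "norm (P p) \<le> M / k ^ (n + CARD('r))" using b2[OF h] by linarith
  qed
qed

text \<open>The set may be unbounded in \<open>t\<close>, but the decay of \<open>P\<close> in
  \<open>t\<close> and the finite volume of a ball in \<open>y\<close> give an integrable product
  majorant.\<close>

lemma integrable_indicator_P: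
  assumes S: "S \<in> sets borel" and a: "0 < a" and h: "\<And>p. p \<in> S \<Longrightarrow> a \<le> hom_norm p"
    and b: "\<And>p. p \<in> S \<Longrightarrow> norm (fst p) \<le> b"
  shows "integrable lborel (\<lambda>p. indicator S p * P p)"
proof -
  let ?D = "DIM(real ^ 'r) + 1"
  obtain M where M: "0 \<le> M" "\<And>p. a \<le> hom_norm p \<Longrightarrow> norm (P p) \<le> M * (1 / (1 + norm (snd p)) ^ ?D)"
    using P_bound_outside[OF a] by metis
  have "emeasure lborel (cball (0 :: real ^ 'd) b) < \<infinity>" by (rule emeasure_lborel_cball_finite)
  then have "integrable lborel (\<lambda>p :: (real ^ 'd) \<times> (real ^ 'r).
      indicator (cball 0 b) (fst p) * (M * (1 / (1 + norm (snd p)) ^ ?D)))"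
    by (intro lborel_integrable_mult integrable_mult_right integrable_inverse_power_norm integrable_real_indicator) auto
  then show ?thesis
  proof (rule Bochner_Integration.integrable_bound)
    have [measurable]: "S \<in> sets borel" "P \<in> borel_measurable borel" using S P_measurable by auto
    show "(\<lambda>p. indicator S p * P p) \<in> borel_measurable lborel" by measurable
    have "norm (indicator S p * P p) \<le> indicator (cball 0 b) (fst p) * (M * (1 / (1 + norm (snd p)) ^ ?D))" for p
    proof (cases "p \<in> S")
      case True
      then show ?thesis using M(2)[OF h[OF True]] b[OF True] by simp
    next
      case False
      have "0 \<le> M * (1 / (1 + norm (snd p)) ^ ?D)"
        using M(1) by (intro mult_nonneg_nonneg divide_nonneg_nonneg zero_le_power) auto
      then show ?thesis using False by (simp add: indicator_def del: power_Suc)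
    qed
    then show "AE p in lborel. norm (indicator S p * P p) \<le>
        norm (indicator (cball 0 b) (fst p) * (M * (1 / (1 + norm (snd p)) ^ ?D)))"
      by (intro AE_I2) (simp only: real_norm_def, rule order_trans[OF _ abs_ge_self])
  qed
qed

text \<open>The Jacobian of the dilation cancels the homogeneity of \<open>P\<close> exactly, so
  integration against \<open>P\<close> is dilation invariant.\<close>

lemma integral_dilate_P:
  assumes s: "0 < s" and S[measurable]: "S \<in> sets borel" and g[measurable]: "g \<in> borel_measurable borel"
  shows "(LINT p|lborel. indicator S p * (g p * P p))
    = (LINT p|lborel. indicator S (dilate s p) * (g (dilate s p) * P p))"
proof -
  have [measurable]: "P \<in> borel_measurable borel" by (rule P_measurable)
  have [measurable]: "(dilate s :: (real ^ 'd) \<times> (real ^ 'r) \<Rightarrow> _) \<in> borel_measurable borel"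
    by (intro borel_measurable_continuous_onI continuous_on_dilate)
  let ?f = "\<lambda>p. indicator S p * (g p * P p)"
  have "(LINT p|lborel. ?f p) = s ^ (2 * n + 2 * CARD('r)) *\<^sub>R (LINT p|lborel. ?f (dilate s p))"
    using integral_dilate[OF s, of ?f] by (simp add: card)
  also have "\<dots> = (LINT p|lborel. s ^ (2 * n + 2 * CARD('r)) *\<^sub>R ?f (dilate s p))"
    by simp
  also have "\<dots> = (LINT p|lborel. indicator S (dilate s p) * (g (dilate s p) * P p))"
  proof (rule integral_cong_AE)
    have "s ^ (2 * n + 2 * CARD('r)) *\<^sub>R ?f (dilate s p) = indicator S (dilate s p) * (g (dilate s p) * P p)" if "p \<noteq> 0" for p
      using s by (simp add: P_dilate[OF s that] scaleR_conv_of_real)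
    then show "AE p in lborel. s ^ (2 * n + 2 * CARD('r)) *\<^sub>R ?f (dilate s p) = indicator S (dilate s p) * (g (dilate s p) * P p)"
      by (intro AE_mp[OF AE_lborel_singleton[of "0 :: (real ^ 'd) \<times> (real ^ 'r)"] AE_I2]; blast)
  qed measurable
  finally show ?thesis .
qed

section \<open>The distribution as an absolutely convergent integral\<close>

definition dist_integrand :: "((real ^ 'd) \<times> (real ^ 'r) \<Rightarrow> complex) \<Rightarrow> (real ^ 'd) \<times> (real ^ 'r) \<Rightarrow> complex" where
  "dist_integrand \<phi> p = of_real (Q (fst p) (snd p)) * partial_fourier \<phi> (fst p) (- snd p)"

lemma borel_measurable_dist_integrand:
  assumes \<phi>: "\<phi> \<in> schwartz"
  shows "dist_integrand \<phi> \<in> borel_measurable borel"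
proof -
  let ?f = "\<lambda>(p :: (real ^ 'd) \<times> (real ^ 'r), t). cis (- ((- snd p) \<bullet> t)) * \<phi> (fst p, t)"
  have "continuous_on UNIV ?f"
    unfolding case_prod_unfold
    by (intro continuous_intros continuous_on_compose2[OF schwartz_continuous[OF \<phi>]]) auto
  then have "?f \<in> borel_measurable (borel \<Otimes>\<^sub>M borel)"
    unfolding borel_prod by (rule borel_measurable_continuous_onI)
  also have "borel_measurable (borel \<Otimes>\<^sub>M borel) = borel_measurable (borel \<Otimes>\<^sub>M (lborel :: (real ^ 'r) measure))"
    by (intro measurable_cong_sets sets_pair_measure_cong refl sets_lborel[symmetric])
  finally have "(\<lambda>p. partial_fourier \<phi> (fst p) (- snd p)) \<in> borel_measurable borel"
    unfolding partial_fourier_def by (rule lborel.borel_measurable_lebesgue_integral)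
  then show ?thesis
    unfolding dist_integrand_def[abs_def] using Q_measurable by measurable
qed

lemma gaussian_nn_integral_finite: "(\<integral>\<^sup>+y. ennreal (exp (- (c * (norm (y :: real ^ 'd))\<^sup>2))) \<partial>lborel) < \<infinity>"
proof -
  let ?D = "DIM(real ^ 'd) + 1"
  let ?M = "exp c * (fact ?D * exp c / c ^ ?D)"
  have "integrable lborel (\<lambda>y :: real ^ 'd. exp (- (c * (norm y)\<^sup>2)))"
  proof (rule integrable_of_decay[where K = ?M])
    show "(\<lambda>y :: real ^ 'd. exp (- (c * (norm y)\<^sup>2))) \<in> borel_measurable borel" by measurable
    fix y :: "real ^ 'd"
    have pos: "0 < (1 + norm y) ^ ?D" by (intro zero_less_power add_pos_nonneg) auto
    \<comment> \<open>This yields \<open>norm y - 1 \<le> (norm y)\<^sup>2\<close> and reduces the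
      Gaussian to a plain exponential, for which \<open>power_times_exp_le\<close> is
      available.\<close>
    have "0 \<le> (norm y - 1)\<^sup>2" by simp
    then have "2 * norm y \<le> (norm y)\<^sup>2 + 1" by (simp add: power2_eq_square algebra_simps)
    then have "norm y - 1 \<le> (norm y)\<^sup>2" using norm_ge_zero[of y] by linarith
    then have "c * (norm y - 1) \<le> c * (norm y)\<^sup>2" using c by simp
    then have "exp (- (c * (norm y)\<^sup>2)) \<le> exp (c + - (c * norm y))" by (simp add: algebra_simps)
    also have "\<dots> = exp c * ((1 + norm y) ^ ?D * exp (- (c * norm y))) / (1 + norm y) ^ ?D"
    proof -
      have "x * e = x * (d * e) / d" if "0 < d" for x d e :: real using that by simp
      from this[OF pos, of "exp c" "exp (- (c * norm y))"] show ?thesis by (simp only: exp_add)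
    qed
    also have "\<dots> \<le> ?M / (1 + norm y) ^ ?D"
      using c pos by (intro divide_right_mono mult_left_mono power_times_exp_le) auto
    finally show "norm (exp (- (c * (norm y)\<^sup>2))) \<le> ?M / (1 + norm y) ^ ?D" by simp
  qed
  then show ?thesis by (auto simp: integrable_iff_bounded)
qed

text \<open>The majorant \<open>G\<close> is integrated over \<open>y\<close> first. Scaling
  \<open>y\<close> by the square root of \<open>norm \<tau>\<close> in dimension \<open>2 n\<close>
  absorbs the factor \<open>norm \<tau> ^ n\<close>, so the inner integral is a constant times the
  integrable weight \<open>w \<tau>\<close>.\<close>

lemma integrable_dist_integrand:
  assumes \<phi>: "\<phi> \<in> schwartz"
  shows "integrable lborel (dist_integrand \<phi>)"
proof -
  let ?D = "DIM(real ^ 'r) + 1"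
  obtain L where L: "0 \<le> L" "\<And>y \<tau>. norm (partial_fourier \<phi> y \<tau>) \<le> L / (1 + norm \<tau>) ^ ?D"
    using partial_fourier_decay[OF \<phi>] by metis
  define w where "w \<tau> = K * L * (1 / (1 + norm (\<tau> :: real ^ 'r)) ^ ?D)" for \<tau>
  define G where "G p = w (snd p) * (norm (snd p) ^ n * exp (- (c * norm (snd p) * (norm (fst p))\<^sup>2)))"
    for p :: "(real ^ 'd) \<times> (real ^ 'r)"
  have w: "integrable lborel w"
    unfolding w_def by (rule integrable_mult_right) (rule integrable_inverse_power_norm)
  have w0: "0 \<le> w \<tau>" for \<tau>
    unfolding w_def using K L(1) by (intro mult_nonneg_nonneg divide_nonneg_nonneg zero_le_power) auto
  have G0: "0 \<le> G p" for p unfolding G_def by (intro mult_nonneg_nonneg w0) auto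
  have wm [measurable]: "w \<in> borel_measurable borel" using borel_measurable_integrable[OF w] by simp
  have Gm: "G \<in> borel_measurable (lborel \<Otimes>\<^sub>M lborel)"
    unfolding G_def[abs_def] by measurable
  define E where "E = (\<integral>\<^sup>+y. ennreal (exp (- (c * (norm (y :: real ^ 'd))\<^sup>2))) \<partial>lborel)"
  have inner: "(\<integral>\<^sup>+y. ennreal (G (y, \<tau>)) \<partial>lborel) = ennreal (w \<tau>) * E" if \<tau>: "\<tau> \<noteq> 0" for \<tau>
  proof -
    define s where "s = sqrt (norm \<tau>)"
    have s: "0 < s" "s\<^sup>2 = norm \<tau>" using \<tau> by (auto simp: s_def)
    have "E = ennreal (s ^ (2 * n)) * (\<integral>\<^sup>+y. ennreal (exp (- (c * (norm (s *\<^sub>R (y :: real ^ 'd)))\<^sup>2))) \<partial>lborel)"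
      unfolding E_def by (subst nn_integral_scaleR_lborel[OF s(1)]) (simp_all add: card)
    also have "s ^ (2 * n) = norm \<tau> ^ n" by (simp add: power_mult s)
    also have "(\<lambda>y :: real ^ 'd. exp (- (c * (norm (s *\<^sub>R y))\<^sup>2))) = (\<lambda>y. exp (- (c * norm \<tau> * (norm y)\<^sup>2)))"
      by (simp add: power_mult_distrib s mult.assoc)
    finally have E: "E = ennreal (norm \<tau> ^ n) * (\<integral>\<^sup>+y. ennreal (exp (- (c * norm \<tau> * (norm (y :: real ^ 'd))\<^sup>2))) \<partial>lborel)" .
    have "(\<integral>\<^sup>+y. ennreal (G (y, \<tau>)) \<partial>lborel)
        = (\<integral>\<^sup>+y. ennreal (w \<tau>) * (ennreal (norm \<tau> ^ n) * ennreal (exp (- (c * norm \<tau> * (norm (y :: real ^ 'd))\<^sup>2)))) \<partial>lborel)"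
      unfolding G_def by (intro nn_integral_cong) (simp add: ennreal_mult w0)
    then show ?thesis unfolding E by (simp add: nn_integral_cmult)
  qed
  have "(\<integral>\<^sup>+p. ennreal (G p) \<partial>lborel) = (\<integral>\<^sup>+\<tau>. \<integral>\<^sup>+y. ennreal (G (y, \<tau>)) \<partial>lborel \<partial>lborel)"
    using lborel_pair.nn_integral_snd[of "\<lambda>p. ennreal (G p)"] Gm by (simp add: lborel_prod)
  also have "\<dots> = (\<integral>\<^sup>+\<tau>. ennreal (w \<tau>) * E \<partial>lborel)"
    by (rule nn_integral_cong_AE) (intro AE_mp[OF AE_lborel_singleton[of 0] AE_I2]; use inner in blast)
  also have "\<dots> = (\<integral>\<^sup>+\<tau>. ennreal (w \<tau>) \<partial>lborel) * E"
    by (simp add: nn_integral_multc)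
  also have "\<dots> < \<infinity>"
    using w w0 gaussian_nn_integral_finite by (simp add: integrable_iff_bounded E_def ennreal_mult_less_top)
  finally have "integrable lborel G"
    using Gm G0 by (intro integrableI_bounded) (auto simp: lborel_prod)
  then show ?thesis
  proof (rule Bochner_Integration.integrable_bound)
    show "dist_integrand \<phi> \<in> borel_measurable lborel"
      using borel_measurable_dist_integrand[OF \<phi>] by simp
    have "norm (dist_integrand \<phi> p) \<le> norm (G p)" if p: "snd p \<noteq> 0" for p
    proof -
      have "norm (dist_integrand \<phi> p) \<le> (K * norm (snd p) ^ n * exp (- (c * norm (snd p) * (norm (fst p))\<^sup>2))) * (L / (1 + norm (- snd p)) ^ ?D)"
        unfolding dist_integrand_def norm_mult norm_of_real
        using K by (intro mult_mono Q_bound[OF p] L(2)) auto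
      also have "\<dots> = G p" by (simp add: G_def w_def)
      finally show ?thesis using G0[of p] by simp
    qed
    moreover have "AE p in (lborel :: ((real ^ 'd) \<times> (real ^ 'r)) measure). snd p \<noteq> 0"
    proof -
      have "AE p in lborel \<Otimes>\<^sub>M (lborel :: (real ^ 'r) measure). snd (p :: (real ^ 'd) \<times> (real ^ 'r)) \<noteq> 0"
      proof (rule lborel_pair.AE_pair_measure)
        show "{p \<in> space (lborel \<Otimes>\<^sub>M lborel). snd (p :: (real ^ 'd) \<times> (real ^ 'r)) \<noteq> 0} \<in> sets (lborel \<Otimes>\<^sub>M lborel)"
          unfolding lborel_prod sets_lborel by (simp add: Collect_neg_eq sets_borel_snd_eq_0 borel_comp)
      qed (auto intro: AE_lborel_singleton)
      then show ?thesis unfolding lborel_prod .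
    qed
    ultimately show "AE p in lborel. norm (dist_integrand \<phi> p) \<le> norm (G p)" by auto
  qed
qed

lemma borel_measurable_snd_section:
  fixes f :: "'a :: euclidean_space \<times> 'b :: euclidean_space \<Rightarrow> complex"
  shows "f \<in> borel_measurable borel \<Longrightarrow> (\<lambda>t. f (y, t)) \<in> borel_measurable borel"
  by (rule measurable_compose[of "\<lambda>t. (y, t)"]) simp_all

lemma schwartz_section_integrable:
  assumes \<phi>: "\<phi> \<in> schwartz"
  shows "integrable lborel (\<lambda>t. \<phi> (y :: real ^ 'd, t :: real ^ 'r))"
proof -
  let ?D = "DIM(real ^ 'r) + 1"
  obtain L where L: "0 \<le> L" "\<And>p. norm (\<phi> p) \<le> L / (1 + norm p) ^ ?D" using schwartz_decay[OF \<phi>] by blast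
  show ?thesis
  proof (rule integrable_of_decay)
    show "(\<lambda>t. \<phi> (y, t)) \<in> borel_measurable borel"
      by (rule borel_measurable_snd_section[OF borel_measurable_schwartz[OF \<phi>]])
    fix t
    have "norm (\<phi> (y, t)) \<le> L / (1 + norm (y, t)) ^ ?D" by (rule L)
    also have "\<dots> \<le> L / (1 + norm t) ^ ?D"
      using L(1) by (intro divide_left_mono power_mono add_left_mono mult_pos_pos zero_less_power)
        (auto intro: add_pos_nonneg simp: norm_Pair)
    finally show "norm (\<phi> (y, t)) \<le> L / (1 + norm t) ^ ?D" .
  qed
qed

text \<open>Fubini in \<open>t\<close> and \<open>\<tau>\<close> for fixed nonzero \<open>y\<close>,
  where both \<open>Q y\<close> and the section of \<open>\<phi>\<close> are integrable. The
  argument \<open>- \<tau>\<close> of the partial Fourier transform produces the phase that occurs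
  in \<open>P\<close>.\<close>

lemma integral_dist_integrand_section:
  assumes \<phi>: "\<phi> \<in> schwartz" and y: "y \<noteq> 0"
  shows "(LINT \<tau>|lborel. dist_integrand \<phi> (y, \<tau>)) = of_real ((2 * pi) ^ CARD('r)) * (LINT t|lborel. \<phi> (y, t) * P (y, t))"
proof -
  have [measurable]: "Q y \<in> borel_measurable borel" by (rule Q_section_measurable)
  have [measurable]: "(\<lambda>t. \<phi> (y, t)) \<in> borel_measurable borel"
    by (rule borel_measurable_snd_section[OF borel_measurable_schwartz[OF \<phi>]])
  have cis_m: "(\<lambda>p :: (real ^ 'r) \<times> (real ^ 'r). cis (fst p \<bullet> snd p)) \<in> borel_measurable (borel \<Otimes>\<^sub>M borel)"
    unfolding borel_prod by (intro borel_measurable_continuous_onI continuous_intros)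
  let ?F = "\<lambda>\<tau> t. cis (t \<bullet> \<tau>) * of_real (Q y \<tau>) * \<phi> (y, t)"
  have "integrable (lborel \<Otimes>\<^sub>M lborel) (case_prod ?F)"
  proof (rule Bochner_Integration.integrable_bound)
    show "integrable (lborel \<Otimes>\<^sub>M lborel) (\<lambda>p. \<bar>Q y (fst p)\<bar> * norm (\<phi> (y, snd p)))"
      unfolding lborel_prod
      by (rule lborel_integrable_mult) (intro integrable_abs integrable_Q y integrable_norm schwartz_section_integrable \<phi>)+
    have "(\<lambda>p. cis (fst p \<bullet> snd p) * of_real (Q y (fst p)) * \<phi> (y, snd p)) \<in> borel_measurable (borel \<Otimes>\<^sub>M borel)"
      using cis_m by measurable
    then show "case_prod ?F \<in> borel_measurable (lborel \<Otimes>\<^sub>M lborel)"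
      by (simp add: case_prod_unfold inner_commute cong: measurable_cong_sets)
  qed (auto simp: norm_mult)
  then have "(LINT t|lborel. LINT \<tau>|lborel. ?F \<tau> t) = (LINT \<tau>|lborel. LINT t|lborel. ?F \<tau> t)"
    by (rule lborel_pair.Fubini_integral)
  also have "(LINT \<tau>|lborel. LINT t|lborel. ?F \<tau> t) = (LINT \<tau>|lborel. dist_integrand \<phi> (y, \<tau>))"
  proof (rule Bochner_Integration.integral_cong[OF refl])
    fix \<tau>
    have "(LINT t|lborel. ?F \<tau> t) = (LINT t|lborel. of_real (Q y \<tau>) * (cis (- ((- \<tau>) \<bullet> t)) * \<phi> (y, t)))"
      by (intro Bochner_Integration.integral_cong) (auto simp: inner_commute mult_ac)
    then show "(LINT t|lborel. ?F \<tau> t) = dist_integrand \<phi> (y, \<tau>)"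
      unfolding dist_integrand_def partial_fourier_def by simp
  qed
  also have "(LINT t|lborel. LINT \<tau>|lborel. ?F \<tau> t) = (LINT t|lborel. of_real ((2 * pi) ^ CARD('r)) * (\<phi> (y, t) * P (y, t)))"
    unfolding P_eq[OF y] by (intro Bochner_Integration.integral_cong) auto
  finally show ?thesis by simp
qed

section \<open>Cylinders, caps and shells, and the principal value\<close>

definition cylinder :: "real \<Rightarrow> ((real ^ 'd) \<times> (real ^ 'r)) set" where
  "cylinder e = {p. e < norm (fst p)}"

text \<open>\<open>cylinder e\<close> is the exterior of a solid cylinder around the axis
  \<open>y = 0\<close>; \<open>cap e\<close> is what it lacks to fill the exterior of the
  homogeneous ball. A cap is unbounded in \<open>t\<close>, so the decay of \<open>P\<close> in
  \<open>t\<close> matters there.\<close>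

definition cap :: "real \<Rightarrow> ((real ^ 'd) \<times> (real ^ 'r)) set" where
  "cap e = {p. e < hom_norm p \<and> norm (fst p) \<le> e}"

definition shell :: "real \<Rightarrow> ((real ^ 'd) \<times> (real ^ 'r)) set" where
  "shell e = {p. e < norm (fst p) \<and> norm (fst p) \<le> 2 * e}"

lemma sets_regions [measurable]:
  "cylinder e \<in> sets borel" "cap e \<in> sets borel" "shell e \<in> sets borel"
  "(- hom_ball e :: ((real ^ 'd) \<times> (real ^ 'r)) set) \<in> sets borel"
proof -
  have [measurable]: "(hom_norm :: (real ^ 'd) \<times> (real ^ 'r) \<Rightarrow> real) \<in> borel_measurable borel"
    by (rule borel_measurable_hom_norm)
  have [measurable]: "(\<lambda>p :: (real ^ 'd) \<times> (real ^ 'r). norm (fst p)) \<in> borel_measurable borel"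
    by (intro borel_measurable_continuous_onI continuous_intros)
  have "{p \<in> space borel. e < norm (fst p)} \<in> sets (borel :: ((real ^ 'd) \<times> (real ^ 'r)) measure)"
    "{p \<in> space borel. e < hom_norm p \<and> norm (fst p) \<le> e} \<in> sets (borel :: ((real ^ 'd) \<times> (real ^ 'r)) measure)"
    "{p \<in> space borel. e < norm (fst p) \<and> norm (fst p) \<le> 2 * e} \<in> sets (borel :: ((real ^ 'd) \<times> (real ^ 'r)) measure)"
    "{p \<in> space borel. e < hom_norm p} \<in> sets (borel :: ((real ^ 'd) \<times> (real ^ 'r)) measure)"
    by measurable
  moreover have "- hom_ball e = {p :: (real ^ 'd) \<times> (real ^ 'r). e < hom_norm p}"
    by (auto simp: mem_hom_ball_iff)
  ultimately show "cylinder e \<in> sets borel" "cap e \<in> sets borel" "shell e \<in> sets borel"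
    "(- hom_ball e :: ((real ^ 'd) \<times> (real ^ 'r)) set) \<in> sets borel"
    by (simp_all add: cylinder_def cap_def shell_def)
qed

lemma indicator_compl_hom_ball:
  "indicator (- hom_ball e) p = (indicator (cylinder e) p + indicator (cap e) p :: complex)"
  using norm_fst_le_hom_norm[of p]
  by (auto simp: indicator_def cylinder_def cap_def mem_hom_ball_iff)

lemma indicator_cylinder:
  "0 < e \<Longrightarrow> indicator (cylinder e) p = (indicator (cylinder (2 * e)) p + indicator (shell e) p :: complex)"
  by (auto simp: indicator_def cylinder_def shell_def)

lemma dilate_mem_cap_iff: "0 < s \<Longrightarrow> dilate s p \<in> cap (s * e) \<longleftrightarrow> p \<in> cap e"
  by (simp add: cap_def hom_norm_dilate) (simp add: dilate_def)

lemma dilate_mem_shell_iff: "0 < s \<Longrightarrow> dilate s p \<in> shell (s * e) \<longleftrightarrow> p \<in> shell e"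
  by (simp add: shell_def dilate_def mult.left_commute)

lemma integrable_schwartz_times_P:
  assumes \<phi>: "\<phi> \<in> schwartz" and a: "0 < a" and S [measurable]: "S \<in> sets borel"
    and h: "\<And>p. p \<in> S \<Longrightarrow> a \<le> hom_norm p"
  shows "integrable lborel (\<lambda>p. indicator S p * (\<phi> p * P p))"
proof -
  let ?D = "DIM((real ^ 'd) \<times> (real ^ 'r)) + 1"
  have [measurable]: "\<phi> \<in> borel_measurable borel" "P \<in> borel_measurable borel"
    using borel_measurable_schwartz[OF \<phi>] P_measurable by auto
  obtain M where M: "0 \<le> M" "\<And>p. a \<le> hom_norm p \<Longrightarrow> norm (P p) \<le> M"
    using P_bound_outside[OF a] by metis
  obtain L where L: "0 \<le> L" "\<And>p. norm (\<phi> p) \<le> L / (1 + norm p) ^ ?D" using schwartz_decay[OF \<phi>] by blast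
  show ?thesis
  proof (rule integrable_of_decay)
    show "(\<lambda>p. indicator S p * (\<phi> p * P p)) \<in> borel_measurable borel" by measurable
    fix p :: "(real ^ 'd) \<times> (real ^ 'r)"
    have nn: "0 \<le> L / (1 + norm p) ^ ?D" by (rule order_trans[OF norm_ge_zero L(2)])
    show "norm (indicator S p * (\<phi> p * P p)) \<le> L * M / (1 + norm p) ^ ?D"
    proof (cases "p \<in> S")
      case True
      have "norm (\<phi> p) * norm (P p) \<le> L / (1 + norm p) ^ ?D * M"
        by (intro mult_mono L(2) M(2) h True nn) auto
      then show ?thesis using True by (simp add: norm_mult)
    next
      case False
      have "0 \<le> L / (1 + norm p) ^ ?D * M" using nn M(1) by (rule mult_nonneg_nonneg)
      then show ?thesis using False by simp
    qed
  qed
qed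

lemma cylinder_hom_norm: "p \<in> cylinder e \<Longrightarrow> e \<le> hom_norm p"
  using norm_fst_le_hom_norm[of p] by (simp add: cylinder_def)

lemma shell_hom_norm: "p \<in> shell e \<Longrightarrow> e \<le> hom_norm p"
  using norm_fst_le_hom_norm[of p] by (simp add: shell_def)

lemma integrable_cap_P: "0 < e \<Longrightarrow> integrable lborel (\<lambda>p. indicator (cap e) p * P p)"
  by (rule integrable_indicator_P[of _ e e]) (auto simp: cap_def sets_regions[unfolded cap_def])

lemma integrable_shell_P: "0 < e \<Longrightarrow> integrable lborel (\<lambda>p. indicator (shell e) p * P p)"
  by (rule integrable_indicator_P[of _ e "2 * e"]) (auto simp: shell_hom_norm sets_regions, simp add: shell_def)

text \<open>Every slice that meets the cylinder exterior has nonzero \<open>y\<close>, so the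
  section identity applies to each slice and is then integrated over \<open>y\<close>.\<close>

lemma integral_cylinder:
  assumes \<phi>: "\<phi> \<in> schwartz" and e: "0 < e"
  shows "of_real ((2 * pi) ^ CARD('r)) * (LINT p|lborel. indicator (cylinder e) p * (\<phi> p * P p))
    = (LINT p|lborel. indicator (cylinder e) p * dist_integrand \<phi> p)"
proof -
  have i1: "integrable lborel (\<lambda>p. indicator (cylinder e) p * (\<phi> p * P p))"
    by (rule integrable_schwartz_times_P[OF \<phi> e]) (auto simp: cylinder_hom_norm sets_regions)
  have i2: "integrable lborel (\<lambda>p. indicator (cylinder e) p * dist_integrand \<phi> p)"
  proof -
    have "integrable lborel (\<lambda>p. indicator (cylinder e) p *\<^sub>R dist_integrand \<phi> p)"
      by (rule integrable_mult_indicator) (use integrable_dist_integrand[OF \<phi>] sets_regions in auto)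
    then show ?thesis by (simp add: scaleR_conv_of_real of_real_indicator)
  qed
  have ind: "indicator (cylinder e) (y, t) = (if e < norm y then 1 else 0 :: complex)" for y t
    by (simp add: cylinder_def)
  have "of_real ((2 * pi) ^ CARD('r)) * (LINT t|lborel. indicator (cylinder e) (y, t) * (\<phi> (y, t) * P (y, t)))
      = (LINT \<tau>|lborel. indicator (cylinder e) (y, \<tau>) * dist_integrand \<phi> (y, \<tau>))" for y
  proof (cases "e < norm y")
    case True
    then have "y \<noteq> 0" using e by auto
    from integral_dist_integrand_section[OF \<phi> this] True show ?thesis by (simp add: ind)
  qed (simp add: ind)
  then show ?thesis
    unfolding lborel_integral_fst(1)[OF i1] lborel_integral_fst(1)[OF i2] by (simp flip: integral_mult_right_zero)
qed

text \<open>Dominated convergence on the Fourier side, where the integrand is absolutely integrable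
  over the whole space and the excluded axis \<open>y = 0\<close> is a null set.\<close>

lemma integral_cylinder_tendsto:
  assumes \<phi>: "\<phi> \<in> schwartz"
  shows "((\<lambda>e. LINT p|lborel. indicator (cylinder e) p * (\<phi> p * P p)) \<longlongrightarrow>
    (LINT p|lborel. dist_integrand \<phi> p) / of_real ((2 * pi) ^ CARD('r))) (at_right 0)"
proof -
  have [measurable]: "dist_integrand \<phi> \<in> borel_measurable borel" by (rule borel_measurable_dist_integrand[OF \<phi>])
  have "((\<lambda>e. LINT p|lborel. indicator (cylinder e) p * dist_integrand \<phi> p) \<longlongrightarrow> (LINT p|lborel. dist_integrand \<phi> p)) (at_right 0)"
  proof (rule integral_dominated_convergence_at_right[where w = "\<lambda>p. norm (dist_integrand \<phi> p)"])
    show "integrable lborel (\<lambda>p. norm (dist_integrand \<phi> p))"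
      using integrable_dist_integrand[OF \<phi>] by simp
    have "((\<lambda>e. indicator (cylinder e) p * dist_integrand \<phi> p) \<longlongrightarrow> dist_integrand \<phi> p) (at_right 0)"
      if p: "fst p \<noteq> 0" for p
    proof (rule tendsto_eventually)
      have "\<forall>\<^sub>F e in at_right 0. e < norm (fst p)"
        using p by (intro order_tendstoD(2)[OF tendsto_ident_at]) auto
      then show "\<forall>\<^sub>F e in at_right 0. indicator (cylinder e) p * dist_integrand \<phi> p = dist_integrand \<phi> p"
        by eventually_elim (simp add: cylinder_def)
    qed
    moreover have "AE p in (lborel :: ((real ^ 'd) \<times> (real ^ 'r)) measure). fst p \<noteq> 0"
    proof -
      have "AE p in (lborel :: (real ^ 'd) measure) \<Otimes>\<^sub>M (lborel :: (real ^ 'r) measure). fst p \<noteq> 0"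
      proof (rule lborel_pair.AE_pair_measure)
        have "closed {p :: (real ^ 'd) \<times> (real ^ 'r). fst p = 0}"
          by (intro closed_Collect_eq continuous_intros)
        then show "{p \<in> space (lborel \<Otimes>\<^sub>M lborel). fst (p :: (real ^ 'd) \<times> (real ^ 'r)) \<noteq> 0} \<in> sets (lborel \<Otimes>\<^sub>M lborel)"
          unfolding lborel_prod sets_lborel by (simp add: Collect_neg_eq borel_comp borel_closed)
        show "AE x in (lborel :: (real ^ 'd) measure). AE y in (lborel :: (real ^ 'r) measure). fst (x, y) \<noteq> 0"
          by (intro AE_mp[OF AE_lborel_singleton[of "0 :: real ^ 'd"] AE_I2]) auto
      qed
      then show ?thesis unfolding lborel_prod .
    qed
    ultimately show "AE p in lborel. ((\<lambda>e. indicator (cylinder e) p * dist_integrand \<phi> p) \<longlongrightarrow> dist_integrand \<phi> p) (at_right 0)"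
      by auto
    show "\<forall>\<^sub>F e in at_right 0. AE p in lborel. norm (indicator (cylinder e) p * dist_integrand \<phi> p) \<le> norm (dist_integrand \<phi> p)"
      by (intro always_eventually allI AE_I2) (simp add: norm_mult indicator_def)
  qed measurable
  then have "((\<lambda>e. (LINT p|lborel. indicator (cylinder e) p * dist_integrand \<phi> p) / of_real ((2 * pi) ^ CARD('r))) \<longlongrightarrow>
      (LINT p|lborel. dist_integrand \<phi> p) / of_real ((2 * pi) ^ CARD('r))) (at_right 0)"
    by (intro tendsto_intros) auto
  then show ?thesis
  proof (rule Lim_transform_eventually)
    have "\<forall>\<^sub>F e in at_right 0. (0::real) < e" by (rule eventually_at_right_less)
    then show "\<forall>\<^sub>F e in at_right 0. (LINT p|lborel. indicator (cylinder e) p * dist_integrand \<phi> p) / of_real ((2 * pi) ^ CARD('r))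
        = (LINT p|lborel. indicator (cylinder e) p * (\<phi> p * P p))"
      by eventually_elim (simp add: field_simps flip: integral_cylinder[OF \<phi>])
  qed
qed

text \<open>The region is fixed and only the test function is dilated. It stays bounded and
  converges pointwise to \<open>\<phi> 0\<close>, so a multiple of \<open>P\<close> on the region
  dominates.\<close>

lemma integral_dilated_tendsto:
  assumes \<phi>: "\<phi> \<in> schwartz" and S [measurable]: "S \<in> sets borel"
    and int: "integrable lborel (\<lambda>p. indicator S p * P p)"
  shows "((\<lambda>s. LINT p|lborel. indicator S p * (\<phi> (dilate s p) * P p)) \<longlongrightarrow>
    \<phi> 0 * (LINT p|lborel. indicator S p * P p)) (at_right 0)"
proof -
  have [measurable]: "\<phi> \<in> borel_measurable borel" "P \<in> borel_measurable borel"
    using borel_measurable_schwartz[OF \<phi>] P_measurable by auto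
  have [measurable]: "(\<lambda>p :: (real ^ 'd) \<times> (real ^ 'r). dilate s p) \<in> borel_measurable borel" for s
    by (intro borel_measurable_continuous_onI continuous_on_dilate)
  obtain L where L: "0 \<le> L" "\<And>p. norm (\<phi> p) \<le> L" using schwartz_decay[OF \<phi>, of 0] by auto
  have "((\<lambda>s. LINT p|lborel. indicator S p * (\<phi> (dilate s p) * P p)) \<longlongrightarrow>
      (LINT p|lborel. indicator S p * (\<phi> 0 * P p))) (at_right 0)"
  proof (rule integral_dominated_convergence_at_right[where w = "\<lambda>p. L * norm (indicator S p * P p)"])
    show "integrable lborel (\<lambda>p. L * norm (indicator S p * P p))"
      by (intro integrable_mult_right integrable_norm int)
    have "((\<lambda>s. \<phi> (dilate s p)) \<longlongrightarrow> \<phi> 0) (at_right 0)" for p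
    proof -
      have "continuous_on UNIV (\<lambda>s. \<phi> (dilate s p))"
        unfolding dilate_def by (intro continuous_on_compose2[OF schwartz_continuous[OF \<phi>]] continuous_intros) auto
      then have "isCont (\<lambda>s. \<phi> (dilate s p)) 0" by (simp add: continuous_on_eq_continuous_at)
      then have "((\<lambda>s. \<phi> (dilate s p)) \<longlongrightarrow> \<phi> (dilate 0 p)) (at_right 0)"
        unfolding isCont_def by (rule filterlim_mono) (auto intro: at_le)
      then show ?thesis by (simp add: dilate_def zero_prod_def)
    qed
    then show "AE p in lborel. ((\<lambda>s. indicator S p * (\<phi> (dilate s p) * P p)) \<longlongrightarrow> indicator S p * (\<phi> 0 * P p)) (at_right 0)"
      by (intro AE_I2 tendsto_intros)
    show "\<forall>\<^sub>F s in at_right 0. AE p in lborel. norm (indicator S p * (\<phi> (dilate s p) * P p)) \<le> L * norm (indicator S p * P p)"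
    proof (intro always_eventually allI AE_I2)
      fix s p
      have "norm (indicator S p * (\<phi> (dilate s p) * P p)) = norm (\<phi> (dilate s p)) * norm (indicator S p * P p)"
        by (simp add: norm_mult)
      also have "\<dots> \<le> L * norm (indicator S p * P p)"
        by (intro mult_right_mono L(2) norm_ge_zero)
      finally show "norm (indicator S p * (\<phi> (dilate s p) * P p)) \<le> L * norm (indicator S p * P p)" .
    qed
  qed measurable
  also have "(LINT p|lborel. indicator S p * (\<phi> 0 * P p)) = \<phi> 0 * (LINT p|lborel. indicator S p * P p)"
    by (simp add: mult.left_commute flip: integral_mult_right_zero)
  finally show ?thesis .
qed

text \<open>Dilation by \<open>e\<close> maps \<open>cap 1\<close> onto \<open>cap e\<close>; by
  dilation invariance the dilation then affects \<open>\<phi>\<close> alone.\<close>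

lemma integral_cap_tendsto:
  assumes \<phi>: "\<phi> \<in> schwartz"
  shows "((\<lambda>e. LINT p|lborel. indicator (cap e) p * (\<phi> p * P p)) \<longlongrightarrow>
    \<phi> 0 * (LINT p|lborel. indicator (cap 1) p * P p)) (at_right 0)"
proof (rule Lim_transform_eventually[OF integral_dilated_tendsto[OF \<phi> sets_regions(2) integrable_cap_P[OF zero_less_one]]])
  show "\<forall>\<^sub>F e in at_right 0. (LINT p|lborel. indicator (cap 1) p * (\<phi> (dilate e p) * P p))
      = (LINT p|lborel. indicator (cap e) p * (\<phi> p * P p))"
    using eventually_at_right_less[of "0 :: real"]
  proof eventually_elim
    case (elim e)
    have "indicator (cap e) (dilate e p) = (indicator (cap 1) p :: complex)" for p
      using dilate_mem_cap_iff[OF elim, of p 1] by (simp add: indicator_def)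
    then show ?case
      using integral_dilate_P[OF elim sets_regions(2) borel_measurable_schwartz[OF \<phi>], of e] by simp
  qed
qed

lemma integral_shell_tendsto:
  assumes \<phi>: "\<phi> \<in> schwartz"
  shows "((\<lambda>e. LINT p|lborel. indicator (shell e) p * (\<phi> p * P p)) \<longlongrightarrow>
    \<phi> 0 * (LINT p|lborel. indicator (shell 1) p * P p)) (at_right 0)"
proof (rule Lim_transform_eventually[OF integral_dilated_tendsto[OF \<phi> sets_regions(3) integrable_shell_P[OF zero_less_one]]])
  show "\<forall>\<^sub>F e in at_right 0. (LINT p|lborel. indicator (shell 1) p * (\<phi> (dilate e p) * P p))
      = (LINT p|lborel. indicator (shell e) p * (\<phi> p * P p))"
    using eventually_at_right_less[of "0 :: real"]
  proof eventually_elim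
    case (elim e)
    have "indicator (shell e) (dilate e p) = (indicator (shell 1) p :: complex)" for p
      using dilate_mem_shell_iff[OF elim, of p 1] by (simp add: indicator_def)
    then show ?case
      using integral_dilate_P[OF elim sets_regions(3) borel_measurable_schwartz[OF \<phi>], of e] by simp
  qed
qed

text \<open>The exterior of the homogeneous ball is the disjoint union of the cylinder exterior and
  the cap. The former contributes the distribution and the latter a multiple of
  \<open>\<phi> 0\<close>.\<close>

lemma has_pv_P:
  assumes \<phi>: "\<phi> \<in> schwartz"
  shows "has_pv P \<phi> ((LINT p|lborel. dist_integrand \<phi> p) / of_real ((2 * pi) ^ CARD('r))
    + \<phi> 0 * (LINT p|lborel. indicator (cap 1) p * P p))"
  unfolding has_pv_def
proof (intro conjI allI impI)
  have conv: "indicator A p *\<^sub>R z = indicator A p * z" for A and p :: "(real ^ 'd) \<times> (real ^ 'r)" and z :: complex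
    by (simp add: indicator_def)
  show "set_integrable lborel (- hom_ball e) (\<lambda>p. \<phi> p * P p)" if "0 < e" for e
    unfolding set_integrable_def conv
    by (rule integrable_schwartz_times_P[OF \<phi> that]) (auto simp: mem_hom_ball_iff sets_regions)
  have "((\<lambda>e. (LINT p|lborel. indicator (cylinder e) p * (\<phi> p * P p)) + (LINT p|lborel. indicator (cap e) p * (\<phi> p * P p)))
    \<longlongrightarrow> (LINT p|lborel. dist_integrand \<phi> p) / of_real ((2 * pi) ^ CARD('r))
    + \<phi> 0 * (LINT p|lborel. indicator (cap 1) p * P p)) (at_right 0)"
    by (intro tendsto_add integral_cylinder_tendsto integral_cap_tendsto \<phi>)
  then show "((\<lambda>e. LINT p:- hom_ball e|lborel. \<phi> p * P p) \<longlongrightarrow> (LINT p|lborel. dist_integrand \<phi> p) / of_real ((2 * pi) ^ CARD('r))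
    + \<phi> 0 * (LINT p|lborel. indicator (cap 1) p * P p)) (at_right 0)"
  proof (rule Lim_transform_eventually)
    show "\<forall>\<^sub>F e in at_right 0. (LINT p|lborel. indicator (cylinder e) p * (\<phi> p * P p)) + (LINT p|lborel. indicator (cap e) p * (\<phi> p * P p))
        = (LINT p:- hom_ball e|lborel. \<phi> p * P p)"
      using eventually_at_right_less[of "0 :: real"]
    proof eventually_elim
      case (elim e)
      have "integrable lborel (\<lambda>p. indicator (cylinder e) p * (\<phi> p * P p))"
        by (rule integrable_schwartz_times_P[OF \<phi> elim]) (auto simp: cylinder_hom_norm sets_regions)
      moreover have "integrable lborel (\<lambda>p. indicator (cap e) p * (\<phi> p * P p))"
        by (rule integrable_schwartz_times_P[OF \<phi> elim sets_regions(2)]) (auto simp: cap_def)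
      ultimately show ?case
        unfolding set_lebesgue_integral_def conv indicator_compl_hom_ball by (simp add: distrib_right)
    qed
  qed
qed

text \<open>
  The integrals of \<open>\<phi> P\<close> over \<open>|y| > e\<close> converge as \<open>e\<close> tends to 0, so its integrals over
  \<open>e < |y| \<le> 2 e\<close> tend to 0; by homogeneity they also tend to \<open>\<phi> 0\<close> times the integral of \<open>P\<close>
  over \<open>1 < |y| \<le> 2\<close>.
\<close>

lemma integral_shell_P_eq_0: "(LINT p|lborel. indicator (shell 1) p * P p) = 0"
proof -
  define \<phi> :: "(real ^ 'd) \<times> (real ^ 'r) \<Rightarrow> complex" where "\<phi> = (\<lambda>p. of_real (exp (- (p \<bullet> p))))"
  have \<phi>: "\<phi> \<in> schwartz" "\<phi> 0 \<noteq> 0"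
    unfolding \<phi>_def by (rule gaussian_poly_schwartz[OF gaussian_poly.base]) simp
  let ?F = "\<lambda>e. LINT p|lborel. indicator (cylinder e) p * (\<phi> p * P p)"
  let ?l = "(LINT p|lborel. dist_integrand \<phi> p) / of_real ((2 * pi) ^ CARD('r))"
  have l1: "(?F \<longlongrightarrow> ?l) (at_right 0)" by (rule integral_cylinder_tendsto[OF \<phi>(1)])
  have "filterlim (\<lambda>e :: real. 2 * e) (at_right 0) (at_right 0)"
  proof -
    have "((\<lambda>e :: real. 2 * e) \<longlongrightarrow> 2 * 0) (at_right 0)" by (intro tendsto_intros)
    moreover have "\<forall>\<^sub>F e :: real in at_right 0. 2 * e \<in> {0<..} \<and> 2 * e \<noteq> 0"
      using eventually_at_right_less[of "0 :: real"] by eventually_elim auto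
    ultimately show ?thesis by (simp add: filterlim_at)
  qed
  then have l2: "((\<lambda>e. ?F (2 * e)) \<longlongrightarrow> ?l) (at_right 0)" by (rule filterlim_compose[OF l1])
  have "((\<lambda>e. ?F e - ?F (2 * e)) \<longlongrightarrow> 0) (at_right 0)"
    using tendsto_diff[OF l1 l2] by simp
  then have "((\<lambda>e. LINT p|lborel. indicator (shell e) p * (\<phi> p * P p)) \<longlongrightarrow> 0) (at_right 0)"
  proof (rule Lim_transform_eventually)
    show "\<forall>\<^sub>F e in at_right 0. ?F e - ?F (2 * e) = (LINT p|lborel. indicator (shell e) p * (\<phi> p * P p))"
      using eventually_at_right_less[of "0 :: real"]
    proof eventually_elim
      case (elim e)
      have e2: "0 < 2 * e" using elim by simp
      have "integrable lborel (\<lambda>p. indicator (cylinder (2 * e)) p * (\<phi> p * P p))"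
        by (rule integrable_schwartz_times_P[OF \<phi>(1) e2]) (auto simp: cylinder_hom_norm sets_regions)
      moreover have "integrable lborel (\<lambda>p. indicator (shell e) p * (\<phi> p * P p))"
        by (rule integrable_schwartz_times_P[OF \<phi>(1) elim]) (auto simp: shell_hom_norm sets_regions)
      ultimately show ?case
        unfolding indicator_cylinder[OF elim] by (simp add: distrib_right)
    qed
  qed
  from tendsto_unique[OF _ this integral_shell_tendsto[OF \<phi>(1)]] \<phi>(2) show ?thesis by simp
qed

lemma integral_cap_P_scale: "0 < s \<Longrightarrow> (LINT p|lborel. indicator (cap s) p * P p) = (LINT p|lborel. indicator (cap 1) p * P p)"
  using integral_dilate_P[of s "cap s" "\<lambda>_. 1"] dilate_mem_cap_iff[of s _ 1] by (simp add: sets_regions indicator_def)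

definition annulus :: "((real ^ 'd) \<times> (real ^ 'r)) set" where
  "annulus = {p. 1 < hom_norm p \<and> hom_norm p \<le> 2}"

text \<open>As indicators, \<open>annulus = shell 1 + cap 1 - cap 2\<close>. The two cap integrals
  agree by dilation invariance and the shell integral vanishes.\<close>

lemma annulus_P:
  "integrable lborel (\<lambda>p. indicator annulus p * P p)" "(LINT p|lborel. indicator annulus p * P p) = 0"
proof -
  have "indicator annulus p = (indicator (- hom_ball 1) p - indicator (- hom_ball 2) p :: complex)" for p
    by (auto simp: annulus_def indicator_def mem_hom_ball_iff)
  then have ind: "indicator annulus p = (indicator (shell 1) p + indicator (cap 1) p - indicator (cap 2) p :: complex)" for p
    unfolding indicator_compl_hom_ball using indicator_cylinder[of 1 p] by simp
  have eq: "indicator annulus p * P p = indicator (shell 1) p * P p + indicator (cap 1) p * P p - indicator (cap 2) p * P p" for p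
    unfolding ind by (simp add: algebra_simps)
  have i: "integrable lborel (\<lambda>p. indicator (shell 1) p * P p)" "integrable lborel (\<lambda>p. indicator (cap 1) p * P p)"
    "integrable lborel (\<lambda>p. indicator (cap 2) p * P p)"
    by (intro integrable_shell_P integrable_cap_P; simp)+
  show "integrable lborel (\<lambda>p. indicator annulus p * P p)" unfolding eq using i by simp
  show "(LINT p|lborel. indicator annulus p * P p) = 0"
    unfolding eq using i integral_shell_P_eq_0 integral_cap_P_scale[of 2] by simp
qed

subsection \<open>The integral over the unit sphere\<close>

lemma sets_annulus [measurable]: "annulus \<in> sets borel"
proof -
  have [measurable]: "(hom_norm :: (real ^ 'd) \<times> (real ^ 'r) \<Rightarrow> real) \<in> borel_measurable borel"
    by (rule borel_measurable_hom_norm)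
  have "{p \<in> space borel. 1 < hom_norm p \<and> hom_norm p \<le> 2} \<in> sets (borel :: ((real ^ 'd) \<times> (real ^ 'r)) measure)"
    by measurable
  then show ?thesis by (simp add: annulus_def)
qed

text \<open>Both facts serve to show that the measure on the sphere is finite. For positivity, the
  open annulus contains a point whose homogeneous norm has fourth power 4, between 1 and 16.\<close>

lemma emeasure_annulus: "emeasure lborel annulus < \<infinity>" "emeasure lborel annulus \<noteq> 0"
proof -
  have "annulus \<subseteq> cball 0 6"
  proof
    fix p assume "p \<in> annulus"
    then have h: "hom_norm p \<le> 2" by (simp add: annulus_def)
    then have "(hom_norm p)\<^sup>2 \<le> 2\<^sup>2" by (intro power_mono hom_norm_nonneg)
    then have "norm (fst p) \<le> 2" "norm (snd p) \<le> 4"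
      using h norm_fst_le_hom_norm[of p] norm_snd_le_hom_norm[of p] by auto
    then show "p \<in> cball 0 6"
      using norm_Pair_le[of "fst p" "snd p"] by simp
  qed
  then have "emeasure lborel annulus \<le> emeasure lborel (cball (0 :: (real ^ 'd) \<times> (real ^ 'r)) 6)"
    by (intro emeasure_mono) auto
  also have "\<dots> < \<infinity>" by (rule emeasure_lborel_cball_finite)
  finally show "emeasure lborel annulus < \<infinity>" .
  let ?U = "{p :: (real ^ 'd) \<times> (real ^ 'r). 1 < hom_norm p \<and> hom_norm p < 2}"
  have open_U: "open ?U"
    by (intro open_Collect_conj open_Collect_less continuous_on_hom_norm continuous_intros)
  obtain b :: "real ^ 'r" where b: "b \<in> Basis" using nonempty_Basis by blast
  let ?p = "(0, 2 *\<^sub>R b) :: (real ^ 'd) \<times> (real ^ 'r)"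
  have h4: "hom_norm ?p ^ 4 = 4" using b by (simp add: hom_norm_power4)
  have "1 < hom_norm ?p"
    by (rule power_less_imp_less_base[of _ 4]) (simp_all add: h4 hom_norm_nonneg)
  moreover have "hom_norm ?p < 2"
    by (rule power_less_imp_less_base[of _ 4]) (simp_all add: h4)
  ultimately have "?U \<noteq> {}" by blast
  then have "\<not> negligible ?U" by (rule open_not_negligible[OF open_U])
  then have "emeasure lborel ?U \<noteq> 0"
    using open_U by (simp add: negligible_iff_emeasure0)
  moreover have "emeasure lborel ?U \<le> emeasure lborel annulus"
    by (rule emeasure_mono) (auto simp: annulus_def sets_annulus[unfolded annulus_def])
  ultimately show "emeasure lborel annulus \<noteq> 0" by auto
qed

text \<open>The weight \<open>g\<close> is left general because two cases are needed:
  \<open>f = 1\<close> with trivial weight, and \<open>f = P\<close>. Integrability of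
  \<open>f\<close> with respect to \<open>\<sigma>\<close> is not assumed; moving scalar factors out
  of a Bochner integral is valid regardless.\<close>

lemma polar_integral_annulus:
  fixes f :: "(real ^ 'd) \<times> (real ^ 'r) \<Rightarrow> complex"
  assumes \<sigma>: "polar_measure \<sigma>"
    and f: "integrable lborel (\<lambda>p. indicator annulus p * f p)"
    and hom: "\<And>s p. 0 < s \<Longrightarrow> p \<noteq> 0 \<Longrightarrow> f (dilate s p) = f p * of_real (g s)"
  shows "(LINT p|lborel. indicator annulus p * f p)
    = (LINT s|lborel. indicator {1<..2} s *\<^sub>R ((LINT p|\<sigma>. f p) * of_real (g s * s ^ (2 * n + 2 * CARD('r) - 1))))"
proof -
  have sp: "space \<sigma> = hom_sphere" using \<sigma> unfolding polar_measure_def by blast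
  let ?F = "\<lambda>p. indicator annulus p * f p"
  have "\<forall>f :: _ \<Rightarrow> complex. integrable lborel f \<longrightarrow> (LINT p|lborel. f p) =
      (LINT s:{0<..}|lborel. LINT p|\<sigma>. f (dilate s p) * of_real (s ^ (2 * n + 2 * CARD('r) - 1)))"
    using \<sigma> unfolding polar_measure_def dilate_def card by (elim conjE)
  from this[rule_format, OF f]
  have "(LINT p|lborel. ?F p) = (LINT s:{0<..}|lborel. LINT p|\<sigma>. ?F (dilate s p) * of_real (s ^ (2 * n + 2 * CARD('r) - 1)))" .
  also have "\<dots> = (LINT s|lborel. indicator {1<..2} s *\<^sub>R ((LINT p|\<sigma>. f p) * of_real (g s * s ^ (2 * n + 2 * CARD('r) - 1))))"
    unfolding set_lebesgue_integral_def
  proof (rule Bochner_Integration.integral_cong[OF refl])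
    fix s :: real
    show "indicator {0<..} s *\<^sub>R (LINT p|\<sigma>. ?F (dilate s p) * of_real (s ^ (2 * n + 2 * CARD('r) - 1)))
      = indicator {1<..2} s *\<^sub>R ((LINT p|\<sigma>. f p) * of_real (g s * s ^ (2 * n + 2 * CARD('r) - 1)))"
    proof (cases "0 < s")
      case True
      have "(LINT p|\<sigma>. ?F (dilate s p) * of_real (s ^ (2 * n + 2 * CARD('r) - 1)))
        = (LINT p|\<sigma>. f p * (indicator {1<..2} s * of_real (g s * s ^ (2 * n + 2 * CARD('r) - 1))))"
      proof (rule Bochner_Integration.integral_cong[OF refl])
        fix p assume "p \<in> space \<sigma>"
        then have h: "hom_norm p = 1" by (simp add: sp mem_hom_sphere_iff)
        then have p: "p \<noteq> 0" using hom_norm_eq_0_iff[of p] by auto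
        have "dilate s p \<in> annulus \<longleftrightarrow> s \<in> {1<..2}"
          using True h by (simp add: annulus_def hom_norm_dilate)
        then show "?F (dilate s p) * of_real (s ^ (2 * n + 2 * CARD('r) - 1))
          = f p * (indicator {1<..2} s * of_real (g s * s ^ (2 * n + 2 * CARD('r) - 1)))"
          using hom[OF True p] by (simp add: indicator_def)
      qed
      then show ?thesis using True by (simp add: indicator_def)
    qed (simp add: indicator_def)
  qed
  finally show ?thesis .
qed

text \<open>If \<open>\<sigma>\<close> were infinite, the integral of 1 over the sphere would be 0
  by the convention for \<open>measure\<close>. The polar formula for the indicator of the annulus
  would then give the annulus volume 0.\<close>

lemma finite_polar_measure:
  fixes \<sigma> :: "((real ^ 'd) \<times> (real ^ 'r)) measure"
  assumes \<sigma>: "polar_measure \<sigma>"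
  shows "finite_measure \<sigma>"
proof (rule finite_measureI, rule notI)
  assume inf: "emeasure \<sigma> (space \<sigma>) = \<infinity>"
  have i: "integrable lborel (\<lambda>p. indicator annulus p * (1 :: complex))"
  proof -
    have "integrable lborel (\<lambda>p. complex_of_real (indicator annulus p))"
      using emeasure_annulus(1) by (intro integrable_of_real integrable_real_indicator) auto
    then show ?thesis by (simp add: of_real_indicator)
  qed
  have "(LINT p|lborel. indicator annulus p * (1 :: complex)) = 0"
    using inf polar_integral_annulus[of \<sigma> "\<lambda>_. 1" "\<lambda>_. 1", OF \<sigma> i] by (simp add: measure_def)
  then have "(LINT p|lborel. complex_of_real (indicator annulus p)) = 0"
    by (simp only: of_real_indicator mult_1_right)
  then have "measure lborel annulus = 0"
    by (simp only: integral_complex_of_real) simp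
  then show False
    using emeasure_annulus by (simp add: measure_def enn2real_eq_0_iff)
qed

lemma mean_value_zero:
  assumes \<sigma>: "polar_measure \<sigma>"
  shows "integrable \<sigma> P" "(LINT p|\<sigma>. P p) = 0"
proof -
  interpret finite_measure \<sigma> by (rule finite_polar_measure[OF \<sigma>])
  have sp: "space \<sigma> = hom_sphere" and se: "sets \<sigma> = sets (restrict_space borel hom_sphere)"
    using \<sigma> unfolding polar_measure_def by blast+
  have meas: "P \<in> borel_measurable \<sigma>"
    using measurable_restrict_space1[OF P_measurable, of hom_sphere] measurable_cong_sets[OF se refl] by blast
  obtain M where M: "\<And>p. p \<noteq> 0 \<Longrightarrow> norm (P p) \<le> M / hom_norm p ^ (2 * n + 2 * CARD('r))"
    using P_bound by blast
  have "norm (P p) \<le> M" if "p \<in> space \<sigma>" for p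
  proof -
    have "hom_norm p = 1" using that by (simp add: sp mem_hom_sphere_iff)
    moreover from this have "p \<noteq> 0" using hom_norm_eq_0_iff[of p] by auto
    ultimately show ?thesis using M[of p] by simp
  qed
  then show "integrable \<sigma> P"
    by (intro integrable_const_bound[of _ M] AE_I2 meas)
  let ?I = "LINT p|\<sigma>. P p"
  \<comment> \<open>Positivity makes the truncated subtraction exact, so that homogeneity and polar
    density combine to \<open>1 / s\<close>.\<close>
  have N: "2 * n + 2 * CARD('r) = Suc (2 * n + 2 * CARD('r) - 1)" using n_pos by simp
  have "0 = (LINT p|lborel. indicator annulus p * P p)" by (rule annulus_P(2)[symmetric])
  also have "\<dots> = (LINT s|lborel. indicator {1<..2} s *\<^sub>R
      (?I * of_real (1 / s ^ (2 * n + 2 * CARD('r)) * s ^ (2 * n + 2 * CARD('r) - 1))))"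
    by (rule polar_integral_annulus[OF \<sigma> annulus_P(1)]) (simp add: P_dilate)
  also have "\<dots> = (LINT s|lborel. ?I * of_real (indicator {1<..2} s * (1 / s)))"
  proof (rule Bochner_Integration.integral_cong[OF refl])
    fix s :: real
    have pw: "1 / s ^ (2 * n + 2 * CARD('r)) * s ^ (2 * n + 2 * CARD('r) - 1) = 1 / s" if "1 < s"
    proof -
      have "1 / s ^ Suc k * s ^ k = 1 / s" for k using that by simp
      from this[of "2 * n + 2 * CARD('r) - 1"] show ?thesis by (simp only: N[symmetric])
    qed
    then show "indicator {1<..2} s *\<^sub>R (?I * of_real (1 / s ^ (2 * n + 2 * CARD('r)) * s ^ (2 * n + 2 * CARD('r) - 1)))
        = ?I * of_real (indicator {1<..2} s * (1 / s))"
    proof (cases "1 < s")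
      case True
      show ?thesis unfolding pw[OF True] by (simp add: indicator_def)
    qed simp
  qed
  also have "\<dots> = ?I * of_real (LINT s|lborel. indicator {1<..2} s * (1 / s))"
    by (simp only: integral_mult_right_zero integral_complex_of_real)
  finally have eq: "?I * of_real (LINT s|lborel. indicator {1<..2} s * (1 / s)) = 0" by simp
  have i: "integrable lborel (\<lambda>s :: real. indicator {1<..2} s * (1 / s))"
  proof (rule Bochner_Integration.integrable_bound)
    show "integrable lborel (indicator {1<..2 :: real} :: real \<Rightarrow> real)" by simp
  qed (auto simp: indicator_def)
  \<comment> \<open>Only the nonvanishing of the radial integral matters, so the lower bound
    \<open>1/2\<close> replaces its exact value \<open>ln 2\<close>.\<close>
  have "(LINT s|lborel. indicator {1<..2 :: real} s * (1 / 2 :: real)) \<le> (LINT s|lborel. indicator {1<..2} s * (1 / s))"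
  proof (rule Bochner_Integration.integral_mono[OF _ i])
    show "integrable lborel (\<lambda>s. indicator {1<..2 :: real} s * (1 / 2 :: real))"
      by (intro integrable_mult_left integrable_real_indicator) auto
  qed (auto simp: indicator_def field_simps)
  then have "(LINT s|lborel. indicator {1<..2} s * (1 / s :: real)) \<noteq> 0" by simp
  with eq show "?I = 0" by simp
qed

end

theorem theorem1p1:
  fixes B :: "real ^ 'd \<Rightarrow> real ^ 'd \<Rightarrow> real ^ 'r"
    and n m :: nat
    and \<mu> :: "real ^ 'r \<Rightarrow> nat \<Rightarrow> real"
    and v :: "real ^ 'r \<Rightarrow> nat \<Rightarrow> real ^ 'd"
    and P :: "(real ^ 'd) \<times> (real ^ 'r) \<Rightarrow> complex"
    and \<sigma> :: "((real ^ 'd) \<times> (real ^ 'r)) measure"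
  assumes "CARD('d) = 2 * n"
    and "skew_bilinear B"
    and "nondegenerate B"
    and "eigenvalue_family B n \<mu>"
    and "adapted_basis B n \<mu> v"
    and "is_Pm n \<mu> v m P"
    and "polar_measure \<sigma>"
  shows "(\<exists>C::complex. \<forall>\<phi>\<in>schwartz.
            integrable lborel (Pm_dist_integrand n \<mu> v m \<phi>) \<and>
            (\<exists>L. has_pv P \<phi> L \<and> Pm_dist n \<mu> v m \<phi> = L + C * \<phi> 0))
         \<and> integrable \<sigma> P \<and> (LINT p|\<sigma>. P p) = 0"
proof -
  interpret nondegenerate_group B n \<mu> v
    by unfold_locales (use assms in auto)
  obtain K c where "0 \<le> K" "0 < c"
    "\<And>y \<tau>. \<tau> \<noteq> 0 \<Longrightarrow> \<bar>Qm n \<mu> v m y \<tau>\<bar> \<le> K * norm \<tau> ^ n * exp (- (c * norm \<tau> * (norm y)\<^sup>2))"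
    using Qm_bound by blast
  then interpret kernel: homogeneous_kernel n "Qm n \<mu> v m" P K c
    using assms(6) borel_measurable_Qm Qm_scale card
    by unfold_locales (auto simp: is_Pm_def Pm_integral_def)
  have dist: "Pm_dist_integrand n \<mu> v m \<phi> = kernel.dist_integrand \<phi>" for \<phi>
    by (auto simp: Pm_dist_integrand_def kernel.dist_integrand_def)
  \<comment> \<open>\<open>has_pv_P\<close> gives the principal value as the distribution plus
    \<open>\<phi> 0\<close> times the cap integral; solving for the distribution changes the
    sign.\<close>
  let ?C = "- (LINT p|lborel. indicator (kernel.cap 1) p * P p)"
  have "integrable lborel (Pm_dist_integrand n \<mu> v m \<phi>) \<and>
      (\<exists>L. has_pv P \<phi> L \<and> Pm_dist n \<mu> v m \<phi> = L + ?C * \<phi> 0)" if \<phi>: "\<phi> \<in> schwartz" for \<phi>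
    using kernel.integrable_dist_integrand[OF \<phi>] kernel.has_pv_P[OF \<phi>]
    by (auto simp: dist Pm_dist_def intro!: exI)
  moreover have "integrable \<sigma> P" "(LINT p|\<sigma>. P p) = 0"
    using kernel.mean_value_zero[OF assms(7)] by auto
  ultimately show ?thesis by blast
qed

end
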